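(* Let $G=(X,w,\kappa,\mu)$ be a connected graph, $1\le p<\infty$ and $T>0$. If $p>1$, assume in addition that $\sum_{y\in X}\frac{w(x,y)^p}{\mu(y)^{p-1}}<\infty$ for every $x\in X$. Suppose that $f:\mathbb R\to\mathbb R$ is uniformly Lipschitz with constant $L>0$ and $f(0)=0$, and that $$\sup_{x\in X}\frac{\sum_{y\in X}w(x,y)+\kappa(x)}{\mu(x)}<\infty.$$ Let $u_0\in\ell^p(X,\mu)$ and $h\in L^1_{\mathrm{loc}}([0,T];\ell^p(X,\mu))$, and assume that one of the following holds: a) $u_0\ge 0$ and $h(t)\ge 0$ for all $t$ (or $u_0\le 0$ and $h(t)\le 0$ for all $t$); b) $u_0$ or $h(t)$ changes sign and $G$ satisfies condition (IP) or condition (B). Then the unique mild solution $u$ of the problem $$\partial_t u+\mathcal A u=h \ \text{ in } (0,T)\times X,\qquad u(0)=u_0 \ \text{ in } X$$ is a strong solution and $$u(t)=u(0)-\int_0^t\mathcal Au(s)\,ds+\int_0^th(s)\,ds\qquad\forall t\in(0,T).$$ Moreover, if $h\in C([0,T];\ell^p(X,\mu))$, then $u$ is a classical solution.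
   Context: A graph $G=(X,w,\kappa,\mu)$ consists of a countable set $X$ (nodes), an edge-weight $w:X\times X\to[0,\infty)$ with $w(x,y)=w(y,x)$, $w(x,x)=0$ and $\sum_{y\in X}w(x,y)<\infty$ for all $x,y\in X$, a killing term $\kappa:X\to[0,\infty)$, and a node measure $\mu:X\to(0,\infty)$. Write $x\sim y$ iff $w(x,y)>0$. A walk is a (possibly infinite) sequence of nodes $\{x_i\}_{i\ge0}$ with $x_i\sim x_{i+1}$; a path is a walk with no repeated nodes; $G$ is connected if any two nodes are joined by a finite walk. (IP): for every infinite path $\{x_n\}_n$, $\sum_n\mu(x_n)=\infty$. (B): $\sup_{x\in X}\frac{\sum_{y\in X}w(x,y)}{\mu(x)}<\infty$. $C(X)$ is the set of real functions on $X$; $\ell^p(X,\mu)=\{u\in C(X):\sum_x|u(x)|^p\mu(x)<\infty\}$ with norm $\|u\|_p=(\sum_x|u(x)|^p\mu(x))^{1/p}$. Inequalities between functions on $X$ are pointwise. The formal graph Laplacian $\Delta$ has domain $\operatorname{dom}(\Delta)=\{u\in C(X):\sum_{y}w(x,y)|u(y)|<\infty\ \forall x\in X\}$ and acts by $$\Delta u(x)=\frac1{\mu(x)}\sum_{y\in X}w(x,y)(u(x)-u(y))+\frac{\kappa(x)}{\mu(x)}u(x).$$ Set $(Fu)(x)=-f(u(x))$, $\mathcal A=F+\Delta$ and $\operatorname{dom}_p(\mathcal A)=\{u\in\ell^p(X,\mu): u\in\operatorname{dom}(\Delta),\ \mathcal Au\in\ell^p(X,\mu)\}$. $\epsilon$-discretization: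 for $\epsilon>0$, a pair consisting of a partition $0=t_0<t_1<\dots<t_N\le T$ and elements $h_1,\dots,h_N\in\ell^p(X,\mu)$ such that $t_k-t_{k-1}\le\epsilon$ for all $k$, $T-t_N\le\epsilon$, and $\sum_{k=1}^N\int_{t_{k-1}}^{t_k}\|h(t)-h_k\|_p\,dt\le\epsilon$. $\epsilon$-approximate solution (subordinate to an $\epsilon$-discretization): if there exist $u_1,\dots,u_N\in\operatorname{dom}_p(\mathcal A)$ with $(\operatorname{id}+\lambda_k\mathcal A)u_k=u_{k-1}+\lambda_kh_k$, $\lambda_k=t_k-t_{k-1}$, $k=1,\dots,N$ (starting from the given $u_0$), it is the function $u_\epsilon$ on $[0,t_N]$ with $u_\epsilon(0)=u_0$ and $u_\epsilon(t)=u_k$ for $t\in(t_{k-1},t_k]$. Mild solution (for $T<\infty$): a function $u\in C([0,T];\ell^p(X,\mu))$ such that for every $\epsilon>0$ there are an $\epsilon$-discretization of $([0,T];h)$ and an $\epsilon$-approximate solution $u_\epsilon$ subordinate to it with $\|u(t)-u_\epsilon(t)\|_p<\epsilon$ for all $t\in[0,t_N]$. Strong solution: $u:[0,T]\to\ell^p(X,\mu)$ with $u(t)\in\operatorname{dom}_p(\mathcal A)$ for every $t\in[0,T]$, $u\in C([0,T];\ell^p(X,\mu))\cap W^{1,1}_{\mathrm{loc}}((0,T);\ell^p(X,\mu))$, $\partial_tu(t,x)+\mathcal Au(t,x)=h(t,x)$ for almost every $t\in(0,T)$, and $u(0)=u_0$. Classical solution: $u:[0,T]\to\ell^p(X,\mu)$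 with $u(t)\in\operatorname{dom}_p(\mathcal A)$ for every $t\in[0,T]$, $u\in C([0,T];\ell^p(X,\mu))\cap C^1((0,T);\ell^p(X,\mu))$, $\partial_tu(t,x)+\mathcal Au(t,x)=h(t,x)$ for every $t\in(0,T)$, and $u(0)=u_0$. *)

theory Defs
  imports "HOL-Analysis.Analysis" "HOL-Library.Function_Algebras"
begin

text \<open>
  Functions on the node set carry the pointwise vector space structure, which makes the
  library's simple Bochner integral applicable to them.
\<close>

instantiation "fun" :: (type, real_vector) real_vector
begin

definition scaleR_fun :: "real \<Rightarrow> ('a \<Rightarrow> 'b) \<Rightarrow> 'a \<Rightarrow> 'b" where
  "scaleR_fun c u = (\<lambda>x. c *\<^sub>R u x)"

instance
  by standard (simp_all add: scaleR_fun_def fun_eq_iff scaleR_add_right scaleR_add_left)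

end

lemma scaleR_fun_apply [simp]: "(c *\<^sub>R u) x = c *\<^sub>R u x"
  by (simp add: scaleR_fun_def)


section \<open>Weighted graphs\<close>

text \<open>The node set is the whole (finite or countably infinite) type \<open>'a\<close>.\<close>

definition weighted_graph ::
    "('a::countable \<Rightarrow> 'a \<Rightarrow> real) \<Rightarrow> ('a \<Rightarrow> real) \<Rightarrow> ('a \<Rightarrow> real) \<Rightarrow> bool" where
  "weighted_graph w \<kappa> \<mu> \<longleftrightarrow>
     (\<forall>x y. 0 \<le> w x y \<and> w x y = w y x) \<and>
     (\<forall>x. w x x = 0) \<and>
     (\<forall>x. (\<lambda>y. w x y) summable_on UNIV) \<and>
     (\<forall>x. 0 \<le> \<kappa> x) \<and>
     (\<forall>x. 0 < \<mu> x)"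

definition adj :: "('a \<Rightarrow> 'a \<Rightarrow> real) \<Rightarrow> 'a \<Rightarrow> 'a \<Rightarrow> bool" where
  "adj w x y \<longleftrightarrow> 0 < w x y"

definition connected_graph :: "('a \<Rightarrow> 'a \<Rightarrow> real) \<Rightarrow> bool" where
  "connected_graph w \<longleftrightarrow>
     (\<forall>x y. \<exists>n (s :: nat \<Rightarrow> 'a). s 0 = x \<and> s n = y \<and> (\<forall>i<n. adj w (s i) (s (Suc i))))"

definition infinite_path :: "('a \<Rightarrow> 'a \<Rightarrow> real) \<Rightarrow> (nat \<Rightarrow> 'a) \<Rightarrow> bool" where
  "infinite_path w s \<longleftrightarrow> inj s \<and> (\<forall>i. adj w (s i) (s (Suc i)))"

definition cond_IP :: "('a \<Rightarrow> 'a \<Rightarrow> real) \<Rightarrow> ('a \<Rightarrow> real) \<Rightarrow> bool" where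
  "cond_IP w \<mu> \<longleftrightarrow> (\<forall>s. infinite_path w s \<longrightarrow> (\<Sum>n. ennreal (\<mu> (s n))) = \<infinity>)"

definition cond_B :: "('a \<Rightarrow> 'a \<Rightarrow> real) \<Rightarrow> ('a \<Rightarrow> real) \<Rightarrow> bool" where
  "cond_B w \<mu> \<longleftrightarrow> bdd_above (range (\<lambda>x. (\<Sum>\<^sub>\<infinity>y. w x y) / \<mu> x))"


section \<open>The spaces \<open>\<ell>\<^sup>p(X, \<mu>)\<close>\<close>

definition lp :: "real \<Rightarrow> ('a \<Rightarrow> real) \<Rightarrow> ('a \<Rightarrow> real) set" where
  "lp p \<mu> = {u. (\<lambda>x. \<bar>u x\<bar> powr p * \<mu> x) summable_on UNIV}"

definition lp_norm :: "real \<Rightarrow> ('a \<Rightarrow> real) \<Rightarrow> ('a \<Rightarrow> real) \<Rightarrow> real" where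
  "lp_norm p \<mu> u = (\<Sum>\<^sub>\<infinity>x. \<bar>u x\<bar> powr p * \<mu> x) powr (1 / p)"


section \<open>Calculus of \<open>\<ell>\<^sup>p\<close>-valued functions of a real variable\<close>

text \<open>
  The space depends on the terms \<open>p\<close> and \<open>\<mu>\<close> and so is a set rather than a type.
  Hence continuity, the Bochner integral and derivatives are spelled out with respect to
  \<^const>\<open>lp_norm\<close>.
\<close>

definition lp_continuous_on ::
    "real \<Rightarrow> ('a \<Rightarrow> real) \<Rightarrow> real set \<Rightarrow> (real \<Rightarrow> 'a \<Rightarrow> real) \<Rightarrow> bool" where
  "lp_continuous_on p \<mu> S u \<longleftrightarrow>
     (\<forall>t\<in>S. u t \<in> lp p \<mu>) \<and>
     (\<forall>t\<in>S. ((\<lambda>s. lp_norm p \<mu> (u s - u t)) \<longlongrightarrow> 0) (at t within S))"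

definition lp_has_deriv ::
    "real \<Rightarrow> ('a \<Rightarrow> real) \<Rightarrow> (real \<Rightarrow> 'a \<Rightarrow> real) \<Rightarrow> ('a \<Rightarrow> real) \<Rightarrow> real \<Rightarrow> bool" where
  "lp_has_deriv p \<mu> u v t \<longleftrightarrow>
     v \<in> lp p \<mu> \<and>
     ((\<lambda>s. lp_norm p \<mu> ((1 / (s - t)) *\<^sub>R (u s - u t) - v)) \<longlongrightarrow> 0) (at t)"

definition lp_strongly_measurable ::
    "real \<Rightarrow> ('a \<Rightarrow> real) \<Rightarrow> real measure \<Rightarrow> (real \<Rightarrow> 'a \<Rightarrow> real) \<Rightarrow> bool" where
  "lp_strongly_measurable p \<mu> M g \<longleftrightarrow>
     (\<forall>t\<in>space M. g t \<in> lp p \<mu>) \<and>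
     (\<exists>s. (\<forall>i::nat. simple_function M (s i) \<and> s i ` space M \<subseteq> lp p \<mu>) \<and>
          (AE t in M. (\<lambda>i. lp_norm p \<mu> (s i t - g t)) \<longlonglongrightarrow> 0))"

text \<open>The counterpart of \<^const>\<open>has_bochner_integral\<close>.\<close>

definition lp_has_integral ::
    "real \<Rightarrow> ('a \<Rightarrow> real) \<Rightarrow> real measure \<Rightarrow> (real \<Rightarrow> 'a \<Rightarrow> real) \<Rightarrow> ('a \<Rightarrow> real) \<Rightarrow> bool" where
  "lp_has_integral p \<mu> M g I \<longleftrightarrow>
     lp_strongly_measurable p \<mu> M g \<and> I \<in> lp p \<mu> \<and>
     (\<exists>s. (\<forall>i::nat. Bochner_Integration.simple_bochner_integrable M (s i) \<and> s i ` space M \<subseteq> lp p \<mu>) \<and>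
          (\<lambda>i. \<integral>\<^sup>+t. ennreal (lp_norm p \<mu> (g t - s i t)) \<partial>M) \<longlonglongrightarrow> 0 \<and>
          (\<lambda>i. lp_norm p \<mu> (Bochner_Integration.simple_bochner_integral M (s i) - I)) \<longlonglongrightarrow> 0)"

definition lp_integrable ::
    "real \<Rightarrow> ('a \<Rightarrow> real) \<Rightarrow> real measure \<Rightarrow> (real \<Rightarrow> 'a \<Rightarrow> real) \<Rightarrow> bool" where
  "lp_integrable p \<mu> M g \<longleftrightarrow> (\<exists>I. lp_has_integral p \<mu> M g I)"

definition lp_integral ::
    "real \<Rightarrow> ('a \<Rightarrow> real) \<Rightarrow> real measure \<Rightarrow> (real \<Rightarrow> 'a \<Rightarrow> real) \<Rightarrow> 'a \<Rightarrow> real" where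
  "lp_integral p \<mu> M g =
     (if lp_integrable p \<mu> M g then (THE I. lp_has_integral p \<mu> M g I) else 0)"

definition lp_L1_loc ::
    "real \<Rightarrow> ('a \<Rightarrow> real) \<Rightarrow> real set \<Rightarrow> (real \<Rightarrow> 'a \<Rightarrow> real) set" where
  "lp_L1_loc p \<mu> S =
     {g. (\<forall>t\<in>S. g t \<in> lp p \<mu>) \<and>
         (\<forall>K. compact K \<and> K \<subseteq> S \<longrightarrow> lp_integrable p \<mu> (lebesgue_on K) g)}"

definition test_function :: "real \<Rightarrow> real \<Rightarrow> (real \<Rightarrow> real) \<Rightarrow> bool" where
  "test_function a b \<phi> \<longleftrightarrow>
     (\<forall>k t. ((deriv ^^ k) \<phi>) differentiable (at t)) \<and>
     compact (closure {t. \<phi> t \<noteq> 0}) \<and> closure {t. \<phi> t \<noteq> 0} \<subseteq> {a<..<b}"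

text \<open>
  \<open>u\<close> belongs to the local Sobolev space \<open>W^{1,1}\<close> of \<open>(a, b)\<close> with weak derivative \<open>v\<close>.
\<close>

definition lp_W11_loc_deriv ::
    "real \<Rightarrow> ('a \<Rightarrow> real) \<Rightarrow> real \<Rightarrow> real \<Rightarrow> (real \<Rightarrow> 'a \<Rightarrow> real) \<Rightarrow> (real \<Rightarrow> 'a \<Rightarrow> real) \<Rightarrow> bool" where
  "lp_W11_loc_deriv p \<mu> a b u v \<longleftrightarrow>
     u \<in> lp_L1_loc p \<mu> {a<..<b} \<and> v \<in> lp_L1_loc p \<mu> {a<..<b} \<and>
     (\<forall>\<phi>. test_function a b \<phi> \<longrightarrow>
        lp_integral p \<mu> (lebesgue_on {a<..<b}) (\<lambda>t. deriv \<phi> t *\<^sub>R u t) =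
        - lp_integral p \<mu> (lebesgue_on {a<..<b}) (\<lambda>t. \<phi> t *\<^sub>R v t))"


section \<open>The operator \<open>\<A> = F + \<Delta>\<close>\<close>

definition dom_laplacian :: "('a \<Rightarrow> 'a \<Rightarrow> real) \<Rightarrow> ('a \<Rightarrow> real) set" where
  "dom_laplacian w = {u. \<forall>x. (\<lambda>y. w x y * \<bar>u y\<bar>) summable_on UNIV}"

definition laplacian ::
    "('a \<Rightarrow> 'a \<Rightarrow> real) \<Rightarrow> ('a \<Rightarrow> real) \<Rightarrow> ('a \<Rightarrow> real) \<Rightarrow> ('a \<Rightarrow> real) \<Rightarrow> 'a \<Rightarrow> real" where
  "laplacian w \<kappa> \<mu> u =
     (\<lambda>x. 1 / \<mu> x * (\<Sum>\<^sub>\<infinity>y. w x y * (u x - u y)) + \<kappa> x / \<mu> x * u x)"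

definition op_A ::
    "(real \<Rightarrow> real) \<Rightarrow> ('a \<Rightarrow> 'a \<Rightarrow> real) \<Rightarrow> ('a \<Rightarrow> real) \<Rightarrow> ('a \<Rightarrow> real) \<Rightarrow>
     ('a \<Rightarrow> real) \<Rightarrow> 'a \<Rightarrow> real" where
  "op_A f w \<kappa> \<mu> u = (\<lambda>x. - f (u x)) + laplacian w \<kappa> \<mu> u"

definition dom_A ::
    "real \<Rightarrow> (real \<Rightarrow> real) \<Rightarrow> ('a \<Rightarrow> 'a \<Rightarrow> real) \<Rightarrow> ('a \<Rightarrow> real) \<Rightarrow> ('a \<Rightarrow> real) \<Rightarrow>
     ('a \<Rightarrow> real) set" where
  "dom_A p f w \<kappa> \<mu> = {u \<in> lp p \<mu>. u \<in> dom_laplacian w \<and> op_A f w \<kappa> \<mu> u \<in> lp p \<mu>}"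


section \<open>Notions of solution\<close>

definition eps_discretization ::
    "real \<Rightarrow> ('a \<Rightarrow> real) \<Rightarrow> real \<Rightarrow> (real \<Rightarrow> 'a \<Rightarrow> real) \<Rightarrow> real \<Rightarrow>
     nat \<Rightarrow> (nat \<Rightarrow> real) \<Rightarrow> (nat \<Rightarrow> 'a \<Rightarrow> real) \<Rightarrow> bool" where
  "eps_discretization p \<mu> T h \<epsilon> N ts hs \<longleftrightarrow>
     1 \<le> N \<and> ts 0 = 0 \<and> (\<forall>k\<in>{1..N}. ts (k - 1) < ts k) \<and> ts N \<le> T \<and>
     (\<forall>k\<in>{1..N}. hs k \<in> lp p \<mu>) \<and>
     (\<forall>k\<in>{1..N}. ts k - ts (k - 1) \<le> \<epsilon>) \<and> T - ts N \<le> \<epsilon> \<and>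
     (\<Sum>k=1..N. \<integral>\<^sup>+t\<in>{ts (k - 1)..ts k}. ennreal (lp_norm p \<mu> (h t - hs k)) \<partial>lebesgue)
       \<le> ennreal \<epsilon>"

definition eps_approx_solution ::
    "real \<Rightarrow> (real \<Rightarrow> real) \<Rightarrow> ('a \<Rightarrow> 'a \<Rightarrow> real) \<Rightarrow> ('a \<Rightarrow> real) \<Rightarrow> ('a \<Rightarrow> real) \<Rightarrow>
     ('a \<Rightarrow> real) \<Rightarrow> nat \<Rightarrow> (nat \<Rightarrow> real) \<Rightarrow> (nat \<Rightarrow> 'a \<Rightarrow> real) \<Rightarrow>
     (real \<Rightarrow> 'a \<Rightarrow> real) \<Rightarrow> bool" where
  "eps_approx_solution p f w \<kappa> \<mu> u0 N ts hs u\<^sub>\<epsilon> \<longleftrightarrow>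
     (\<exists>us :: nat \<Rightarrow> 'a \<Rightarrow> real.
        us 0 = u0 \<and>
        (\<forall>k\<in>{1..N}.
           us k \<in> dom_A p f w \<kappa> \<mu> \<and>
           us k + (ts k - ts (k - 1)) *\<^sub>R op_A f w \<kappa> \<mu> (us k) =
             us (k - 1) + (ts k - ts (k - 1)) *\<^sub>R hs k) \<and>
        u\<^sub>\<epsilon> 0 = u0 \<and>
        (\<forall>k\<in>{1..N}. \<forall>t\<in>{ts (k - 1)<..ts k}. u\<^sub>\<epsilon> t = us k))"

text \<open>
  In all three notions of solution only the values of \<open>u\<close> on \<open>[0, T]\<close> matter.
\<close>

definition mild_solution ::
    "real \<Rightarrow> (real \<Rightarrow> real) \<Rightarrow> ('a \<Rightarrow> 'a \<Rightarrow> real) \<Rightarrow> ('a \<Rightarrow> real) \<Rightarrow> ('a \<Rightarrow> real) \<Rightarrow> real \<Rightarrow>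
     ('a \<Rightarrow> real) \<Rightarrow> (real \<Rightarrow> 'a \<Rightarrow> real) \<Rightarrow> (real \<Rightarrow> 'a \<Rightarrow> real) \<Rightarrow> bool" where
  "mild_solution p f w \<kappa> \<mu> T u0 h u \<longleftrightarrow>
     lp_continuous_on p \<mu> {0..T} u \<and>
     (\<forall>\<epsilon>>0. \<exists>N ts hs u\<^sub>\<epsilon>.
        eps_discretization p \<mu> T h \<epsilon> N ts hs \<and>
        eps_approx_solution p f w \<kappa> \<mu> u0 N ts hs u\<^sub>\<epsilon> \<and>
        (\<forall>t\<in>{0..ts N}. lp_norm p \<mu> (u t - u\<^sub>\<epsilon> t) < \<epsilon>))"

definition strong_solution ::
    "real \<Rightarrow> (real \<Rightarrow> real) \<Rightarrow> ('a \<Rightarrow> 'a \<Rightarrow> real) \<Rightarrow> ('a \<Rightarrow> real) \<Rightarrow> ('a \<Rightarrow> real) \<Rightarrow> real \<Rightarrow>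
     ('a \<Rightarrow> real) \<Rightarrow> (real \<Rightarrow> 'a \<Rightarrow> real) \<Rightarrow> (real \<Rightarrow> 'a \<Rightarrow> real) \<Rightarrow> bool" where
  "strong_solution p f w \<kappa> \<mu> T u0 h u \<longleftrightarrow>
     (\<forall>t\<in>{0..T}. u t \<in> dom_A p f w \<kappa> \<mu>) \<and>
     lp_continuous_on p \<mu> {0..T} u \<and>
     (\<exists>v. lp_W11_loc_deriv p \<mu> 0 T u v \<and>
          (AE t in lebesgue_on {0<..<T}. v t + op_A f w \<kappa> \<mu> (u t) = h t)) \<and>
     u 0 = u0"

definition classical_solution ::
    "real \<Rightarrow> (real \<Rightarrow> real) \<Rightarrow> ('a \<Rightarrow> 'a \<Rightarrow> real) \<Rightarrow> ('a \<Rightarrow> real) \<Rightarrow> ('a \<Rightarrow> real) \<Rightarrow> real \<Rightarrow>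
     ('a \<Rightarrow> real) \<Rightarrow> (real \<Rightarrow> 'a \<Rightarrow> real) \<Rightarrow> (real \<Rightarrow> 'a \<Rightarrow> real) \<Rightarrow> bool" where
  "classical_solution p f w \<kappa> \<mu> T u0 h u \<longleftrightarrow>
     (\<forall>t\<in>{0..T}. u t \<in> dom_A p f w \<kappa> \<mu>) \<and>
     lp_continuous_on p \<mu> {0..T} u \<and>
     (\<exists>v. (\<forall>t\<in>{0<..<T}. lp_has_deriv p \<mu> u (v t) t) \<and>
          lp_continuous_on p \<mu> {0<..<T} v \<and>
          (\<forall>t\<in>{0<..<T}. v t + op_A f w \<kappa> \<mu> (u t) = h t)) \<and>
     u 0 = u0"


section \<open>Sign of the data\<close>

definition data_one_signed ::
    "real \<Rightarrow> ('a \<Rightarrow> real) \<Rightarrow> (real \<Rightarrow> 'a \<Rightarrow> real) \<Rightarrow> bool" where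
  "data_one_signed T u0 h \<longleftrightarrow>
     ((\<forall>x. 0 \<le> u0 x) \<and> (\<forall>t\<in>{0..T}. \<forall>x. 0 \<le> h t x)) \<or>
     ((\<forall>x. u0 x \<le> 0) \<and> (\<forall>t\<in>{0..T}. \<forall>x. h t x \<le> 0))"

text \<open>
  The data change sign if some value of \<open>u\<^sub>0\<close> or \<open>h\<close> is positive and some value of
  \<open>u\<^sub>0\<close> or \<open>h\<close> is negative; this covers data such as \<open>u\<^sub>0 \<ge> 0 \<ge> h\<close>.
\<close>

definition data_change_sign ::
    "real \<Rightarrow> ('a \<Rightarrow> real) \<Rightarrow> (real \<Rightarrow> 'a \<Rightarrow> real) \<Rightarrow> bool" where
  "data_change_sign T u0 h \<longleftrightarrow>
     ((\<exists>x. 0 < u0 x) \<or> (\<exists>t\<in>{0..T}. \<exists>x. 0 < h t x)) \<and>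
     ((\<exists>x. u0 x < 0) \<or> (\<exists>t\<in>{0..T}. \<exists>x. h t x < 0))"

end

theory Submission
  imports Defs
begin

text \<open>
  The bound on the weighted degree makes the Laplacian a bounded operator on
  \<open>\<ell>\<^sup>p(X, \<mu>)\<close>: it is multiplication by the degree minus an average over neighbours, and Jensen's
  inequality together with the symmetry of \<open>w\<close> bounds the average (\<open>average_lp\<close>,
  \<open>laplacian_bounded\<close>). Hence \<open>\<A>\<close> is defined on the whole space and Lipschitz there
  (\<open>op_A_lipschitz\<close>, \<open>dom_A_eq\<close>), and the problem is an ordinary differential equation in a Banach
  space whose integrated form is \<open>u(t) = u\<^sub>0 + \<integral>\<^sub>0\<^sup>t (h - \<A> u)\<close>. All notions of solution are compared
  with this integral equation.

  The integral equation is solved by Picard iteration, which halves a weighted supremum norm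
  (\<open>picard_contraction\<close>). A discrete Gronwall estimate (\<open>euler_error\<close>) bounds the distance between its
  solution and any \<open>\<epsilon>\<close>-approximate solution, uniformly over all \<open>\<epsilon>\<close>-discretizations
  (\<open>euler_converges\<close>). Since discretizations and approximate solutions exist for small \<open>\<epsilon>\<close>
  (\<open>discretization_exists\<close>, \<open>approx_solution_exists\<close>), the solution is mild, and since every mild solution is
  a limit of approximate ones, it is the only mild solution. Its regularity is that of the
  primitive of \<open>h - \<A> u\<close>: integrability of this function gives the weak derivative by Fubini's
  theorem (\<open>integration_by_parts_test_function\<close>), continuity gives the classical one
  (\<open>average_close\<close>).

  Because \<open>\<ell>\<^sup>p(X, \<mu>)\<close> is a set depending on \<open>p\<close> and \<open>\<mu>\<close>, and not a type, integrals are handled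
  coordinatewise. As \<open>X\<close> is countable, a function is Bochner integrable exactly if its coordinates
  are measurable and its norm has a finite integral, and its integral is the function of the
  integrals of the coordinates (\<open>lp_integrable_iff\<close>, \<open>lp_integral_coord\<close>). Norm estimates come from
  duality with finitely supported functionals (\<open>lp_leI_dual\<close>), which yields Minkowski's inequality
  for sums and for integrals in the same way.
\<close>

section \<open>Young's and Jensen's inequalities for powers\<close>

text \<open>
  This form of Young's inequality is the tangent inequality for \<open>t \<mapsto> t\<^sup>p\<close> at \<open>s\<close>. It carries
  both Jensen's inequality and the duality of \<open>\<ell>\<^sup>p\<close>.
\<close>

lemma weighted_young:
  fixes p s t :: real
  assumes "1 \<le> p" "0 \<le> s" "0 \<le> t"
  shows "p * (s powr (p - 1) * t) \<le> (p - 1) * s powr p + t powr p"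
proof (cases "p = 1 \<or> s = 0")
  case True
  then show ?thesis using assms by (auto simp: powr_one_gt_zero_iff)
next
  case False
  then have p: "1 < p" and s: "0 < s" using assms by auto
  have "s powr (p - 1) * t \<le> (s powr (p - 1)) powr (p / (p - 1)) / (p / (p - 1)) + t powr p / p"
    using p assms by (intro Youngs_inequality) (auto simp: field_simps)
  also have "(s powr (p - 1)) powr (p / (p - 1)) = s powr p"
    using p by (simp add: powr_powr)
  finally show ?thesis using p by (simp add: field_simps)
qed

text \<open>
  The total weight is only bounded by \<open>D\<close>, as it is for the weights \<open>w x y / \<mu> x\<close> of the
  neighbours of a node. The proof sums the tangent inequality at \<open>s = m / D\<close>, where \<open>m\<close> is the
  weighted sum of the \<open>t y\<close>.
\<close>

lemma jensen_finite_sum_powr: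
  fixes a t :: "'b \<Rightarrow> real"
  assumes p: "1 \<le> p" and "finite G" and a: "\<And>y. y \<in> G \<Longrightarrow> 0 \<le> a y"
    and t: "\<And>y. y \<in> G \<Longrightarrow> 0 \<le> t y" and D: "sum a G \<le> D"
  shows "(\<Sum>y\<in>G. a y * t y) powr p \<le> D powr (p - 1) * (\<Sum>y\<in>G. a y * t y powr p)"
proof -
  define m where "m = (\<Sum>y\<in>G. a y * t y)"
  define E where "E = (\<Sum>y\<in>G. a y * t y powr p)"
  have m0: "0 \<le> m" unfolding m_def using a t by (intro sum_nonneg) auto
  have E0: "0 \<le> E" unfolding E_def using a t by (intro sum_nonneg) auto
  show ?thesis
  proof (cases "m = 0")
    case True
    then show ?thesis using E0 unfolding m_def[symmetric] E_def[symmetric] by simp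
  next
    case False
    have "sum a G \<noteq> 0"
    proof
      assume "sum a G = 0"
      then have "\<forall>y\<in>G. a y = 0" using a \<open>finite G\<close> by (simp add: sum_nonneg_eq_0_iff)
      then show False using False by (simp add: m_def)
    qed
    then have D0: "0 < D" using D a by (smt (verit) sum_nonneg)
    define s where "s = m / D"
    have s0: "0 < s" using m0 False D0 by (simp add: s_def)
    have mD: "m = s * D" using D0 by (simp add: s_def)
    have sp: "s powr (p - 1) * s = s powr p" using s0 by (simp add: powr_mult_base mult.commute)
    have Dp: "D powr (p - 1) * D = D powr p" using D0 by (simp add: powr_mult_base mult.commute)
    have "p * (s powr (p - 1) * m) = (\<Sum>y\<in>G. a y * (p * (s powr (p - 1) * t y)))"
      unfolding m_def by (simp add: sum_distrib_left mult_ac)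
    also have "\<dots> \<le> (\<Sum>y\<in>G. a y * ((p - 1) * s powr p + t y powr p))"
      using a t s0 p by (intro sum_mono mult_left_mono weighted_young) auto
    also have "\<dots> = sum a G * ((p - 1) * s powr p) + E"
      unfolding E_def by (simp add: sum_distrib_right sum.distrib distrib_left)
    also have "\<dots> \<le> D * ((p - 1) * s powr p) + E"
      using p D by (intro add_right_mono mult_right_mono) auto
    finally have "p * (s powr p * D) \<le> D * ((p - 1) * s powr p) + E"
      using mD sp by (simp add: mult_ac)
    then have "s powr p * D \<le> E" by (simp add: algebra_simps)
    then have "D powr (p - 1) * (s powr p * D) \<le> D powr (p - 1) * E"
      by (intro mult_left_mono) auto
    moreover have "m powr p = D powr (p - 1) * (s powr p * D)"
      using s0 D0 Dp by (simp add: mD powr_mult mult_ac)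
    ultimately show ?thesis unfolding m_def[symmetric] E_def[symmetric] by simp
  qed
qed

section \<open>The normed space \<open>\<ell>\<^sup>p(X, \<mu>)\<close>\<close>

locale weighted_lp =
  fixes p :: real and \<mu> :: "'a::countable \<Rightarrow> real"
  assumes p_ge_1: "1 \<le> p" and mu_pos: "\<And>x. 0 < \<mu> x"
begin

abbreviation "nrm \<equiv> lp_norm p \<mu>"

lemma p_pos: "0 < p" using p_ge_1 by simp

lemma lp_norm_nonneg [simp]: "0 \<le> nrm u"
  by (simp add: lp_norm_def)

lemma lp_norm_powr: "nrm u powr p = (\<Sum>\<^sub>\<infinity>x. \<bar>u x\<bar> powr p * \<mu> x)"
proof -
  have "0 \<le> (\<Sum>\<^sub>\<infinity>x. \<bar>u x\<bar> powr p * \<mu> x)"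
    by (intro infsum_nonneg) (simp add: less_imp_le mu_pos)
  then show ?thesis using p_pos by (simp add: lp_norm_def powr_powr)
qed

lemma lp_leI:
  assumes "0 \<le> C" and "\<And>F. finite F \<Longrightarrow> (\<Sum>x\<in>F. \<bar>u x\<bar> powr p * \<mu> x) \<le> C powr p"
  shows "u \<in> lp p \<mu>" and "nrm u \<le> C"
proof -
  have s: "(\<lambda>x. \<bar>u x\<bar> powr p * \<mu> x) summable_on UNIV"
    using assms(2) by (intro nonneg_bdd_above_summable_on)
      (auto simp: less_imp_le mu_pos intro!: bdd_aboveI2)
  then show "u \<in> lp p \<mu>" by (simp add: lp_def)
  have "(\<Sum>\<^sub>\<infinity>x. \<bar>u x\<bar> powr p * \<mu> x) \<le> C powr p"
    using s assms(2) by (intro infsum_le_finite_sums) auto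
  then have "nrm u \<le> (C powr p) powr (1 / p)"
    unfolding lp_norm_def using p_pos
    by (intro powr_mono2) (auto intro!: infsum_nonneg simp: less_imp_le mu_pos)
  also have "\<dots> = C" using assms(1) p_pos by (simp add: powr_powr)
  finally show "nrm u \<le> C" .
qed

lemma lp_finite_sum_le:
  assumes "u \<in> lp p \<mu>" "finite F"
  shows "(\<Sum>x\<in>F. \<bar>u x\<bar> powr p * \<mu> x) \<le> nrm u powr p"
  unfolding lp_norm_powr using assms
  by (intro finite_sum_le_infsum) (auto simp: lp_def less_imp_le mu_pos)

lemma lp_dominated:
  assumes "v \<in> lp p \<mu>" and "0 \<le> c" and "\<And>x. \<bar>u x\<bar> \<le> c * \<bar>v x\<bar>"
  shows "u \<in> lp p \<mu>" and "nrm u \<le> c * nrm v"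
proof -
  have "(\<Sum>x\<in>F. \<bar>u x\<bar> powr p * \<mu> x) \<le> (c * nrm v) powr p" if "finite F" for F
  proof -
    have "(\<Sum>x\<in>F. \<bar>u x\<bar> powr p * \<mu> x) \<le> (\<Sum>x\<in>F. (c * \<bar>v x\<bar>) powr p * \<mu> x)"
      using assms p_pos by (intro sum_mono mult_right_mono powr_mono2) (auto simp: less_imp_le mu_pos)
    also have "\<dots> = c powr p * (\<Sum>x\<in>F. \<bar>v x\<bar> powr p * \<mu> x)"
      using assms(2) by (simp add: powr_mult sum_distrib_left mult_ac)
    also have "\<dots> \<le> c powr p * nrm v powr p"
      using assms that by (intro mult_left_mono lp_finite_sum_le) auto
    finally show ?thesis using assms(2) by (simp add: powr_mult)
  qed
  then show "u \<in> lp p \<mu>" "nrm u \<le> c * nrm v"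
    using lp_leI[of "c * nrm v" u] assms(2) by auto
qed

lemma lp_zero [simp]: "0 \<in> lp p \<mu>" "nrm 0 = 0"
  using lp_leI[of 0 0] p_pos by (auto intro: antisym)

lemmas lp_zero' [simp] = lp_zero[unfolded zero_fun_def]

lemma lp_norm_cong_abs: "(\<And>x. \<bar>u x\<bar> = \<bar>v x\<bar>) \<Longrightarrow> nrm u = nrm v"
  by (simp add: lp_norm_def)

lemma lp_norm_commute: "nrm (u - v) = nrm (v - u)"
  by (intro lp_norm_cong_abs) auto

lemma lp_scaleR: "u \<in> lp p \<mu> \<Longrightarrow> c *\<^sub>R u \<in> lp p \<mu>"
  by (rule lp_dominated[where c = "\<bar>c\<bar>" and v = u]) (auto simp: abs_mult)

lemma lp_norm_scaleR:
  assumes u: "u \<in> lp p \<mu>"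
  shows "nrm (c *\<^sub>R u) = \<bar>c\<bar> * nrm u"
proof (cases "c = 0")
  case True
  then show ?thesis by simp
next
  case False
  have "nrm u \<le> inverse \<bar>c\<bar> * nrm (c *\<^sub>R u)"
    by (rule lp_dominated) (use False u in \<open>auto simp: abs_mult lp_scaleR field_simps\<close>)
  moreover have "nrm (c *\<^sub>R u) \<le> \<bar>c\<bar> * nrm u"
    by (rule lp_dominated) (use u in \<open>auto simp: abs_mult\<close>)
  ultimately show ?thesis using False by (simp add: field_simps)
qed

text \<open>
  Point evaluations are bounded functionals. This is what reduces statements about
  \<open>\<ell>\<^sup>p\<close>-valued limits and integrals to real ones.
\<close>

lemma lp_coord:
  assumes "u \<in> lp p \<mu>"
  shows "\<bar>u x\<bar> \<le> \<mu> x powr (- 1 / p) * nrm u"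
proof -
  have "\<bar>u x\<bar> powr p * \<mu> x \<le> nrm u powr p"
    using lp_finite_sum_le[OF assms, of "{x}"] by simp
  then have "\<bar>u x\<bar> powr p \<le> nrm u powr p / \<mu> x"
    using mu_pos by (simp add: field_simps)
  then have "(\<bar>u x\<bar> powr p) powr (1 / p) \<le> (nrm u powr p / \<mu> x) powr (1 / p)"
    using p_pos by (intro powr_mono2) auto
  then have "\<bar>u x\<bar> \<le> nrm u / \<mu> x powr (1 / p)"
    using p_pos mu_pos[of x] by (simp add: powr_powr powr_divide)
  then show ?thesis by (simp add: powr_minus field_simps)
qed

text \<open>
  A nonnegative functional supported on \<open>F\<close> whose norm on \<open>\<ell>\<^sup>p\<close> is at most one. Finite supports
  keep all pairings finite sums, which commute with limits and integrals.
\<close>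

definition norming :: "'a set \<Rightarrow> ('a \<Rightarrow> real) \<Rightarrow> bool" where
  "norming F \<psi> \<longleftrightarrow> finite F \<and> (\<forall>x. 0 \<le> \<psi> x) \<and> (\<forall>v\<in>lp p \<mu>. (\<Sum>x\<in>F. \<psi> x * \<bar>v x\<bar>) \<le> nrm v)"

text \<open>
  The functional is the extremal one in Hoelder's inequality,
  \<open>\<phi> = (\<bar>u\<bar> / B)\<^sup>p\<^sup>-\<^sup>1 \<mu>\<close> on \<open>F\<close> with \<open>B\<close> the norm of \<open>u\<close> restricted to \<open>F\<close>.
\<close>

lemma norming_exists:
  assumes F: "finite F" and S: "0 < (\<Sum>x\<in>F. \<bar>u x\<bar> powr p * \<mu> x)"
  obtains \<psi> where "norming F \<psi>"
    "(\<Sum>x\<in>F. \<psi> x * \<bar>u x\<bar>) = (\<Sum>x\<in>F. \<bar>u x\<bar> powr p * \<mu> x) powr (1 / p)"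
proof -
  define S where "S = (\<Sum>x\<in>F. \<bar>u x\<bar> powr p * \<mu> x)"
  define B where "B = S powr (1 / p)"
  have B0: "0 < B" and Bp: "B powr p = S" using S p_pos by (auto simp: B_def S_def powr_powr)
  have one: "(\<Sum>x\<in>F. (\<bar>u x\<bar> / B) powr p * \<mu> x) = 1"
  proof -
    have "(\<Sum>x\<in>F. (\<bar>u x\<bar> / B) powr p * \<mu> x) = S / B powr p"
      using B0 by (simp add: S_def powr_divide sum_divide_distrib)
    then show ?thesis using Bp S by (simp add: S_def)
  qed
  define \<phi> where "\<phi> x = (\<bar>u x\<bar> / B) powr (p - 1) * \<mu> x" for x
  have holder: "(\<Sum>x\<in>F. \<phi> x * \<bar>v x\<bar>) \<le> nrm v" if v: "v \<in> lp p \<mu>" for v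
  proof (cases "nrm v = 0")
    case True
    have "v x = 0" for x using lp_coord[OF v, of x] True by simp
    then show ?thesis by simp
  next
    case False
    then have N: "0 < nrm v" using lp_norm_nonneg[of v] by linarith
    have "p * (\<Sum>x\<in>F. \<phi> x * (\<bar>v x\<bar> / nrm v))
        = (\<Sum>x\<in>F. p * ((\<bar>u x\<bar> / B) powr (p - 1) * (\<bar>v x\<bar> / nrm v)) * \<mu> x)"
      by (simp add: \<phi>_def sum_distrib_left mult_ac)
    also have "\<dots> \<le> (\<Sum>x\<in>F. ((p - 1) * (\<bar>u x\<bar> / B) powr p + (\<bar>v x\<bar> / nrm v) powr p) * \<mu> x)"
      using B0 N p_ge_1 by (intro sum_mono mult_right_mono weighted_young) (auto simp: less_imp_le mu_pos)
    also have "\<dots> = (p - 1) * 1 + (\<Sum>x\<in>F. \<bar>v x\<bar> powr p * \<mu> x) / nrm v powr p"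
    proof -
      have "(\<Sum>x\<in>F. (p - 1) * (\<bar>u x\<bar> / B) powr p * \<mu> x) = (p - 1) * 1"
        using one by (simp only: mult.assoc flip: sum_distrib_left)
      moreover have "(\<Sum>x\<in>F. (\<bar>v x\<bar> / nrm v) powr p * \<mu> x) = (\<Sum>x\<in>F. \<bar>v x\<bar> powr p * \<mu> x) / nrm v powr p"
        using N by (simp add: sum_divide_distrib powr_divide)
      ultimately show ?thesis by (simp add: distrib_right sum.distrib)
    qed
    also have "\<dots> \<le> (p - 1) * 1 + nrm v powr p / nrm v powr p"
      using lp_finite_sum_le[OF v F] by (intro add_left_mono divide_right_mono) auto
    also have "\<dots> = p * 1" using N by simp
    finally have "(\<Sum>x\<in>F. \<phi> x * (\<bar>v x\<bar> / nrm v)) \<le> 1" using p_pos by (subst (asm) mult_le_cancel_left_pos)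
    then have "(\<Sum>x\<in>F. \<phi> x * \<bar>v x\<bar>) / nrm v \<le> 1" by (simp add: sum_divide_distrib)
    then show ?thesis using N by (simp add: field_simps)
  qed
  have "\<phi> x * \<bar>u x\<bar> = B * ((\<bar>u x\<bar> / B) powr p * \<mu> x)" for x
  proof (cases "u x = 0")
    case False
    define q where "q = \<bar>u x\<bar> / B"
    have q: "0 < q" "\<bar>u x\<bar> = q * B" using False B0 by (auto simp: q_def)
    have "q powr (p - 1) * q = q powr p" using q(1) by (simp add: powr_mult_base mult.commute)
    then show ?thesis unfolding \<phi>_def q_def[symmetric] by (simp add: q(2) mult_ac)
  qed simp
  then have "(\<Sum>x\<in>F. \<phi> x * \<bar>u x\<bar>) = B"
    using one by (simp flip: sum_distrib_left)
  moreover have "norming F \<phi>"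
    using holder F by (auto simp: norming_def \<phi>_def less_imp_le mu_pos)
  ultimately show thesis using that unfolding B_def S_def by blast
qed

text \<open>
  The norm is the supremum over norming functionals, so any bound that passes through every such
  functional bounds the norm. Minkowski's inequality for sums, Fatou's lemma and Minkowski's
  inequality for integrals are all instances.
\<close>

lemma lp_leI_dual:
  assumes C: "0 \<le> C" and le: "\<And>F \<psi>. norming F \<psi> \<Longrightarrow> (\<Sum>x\<in>F. \<psi> x * \<bar>u x\<bar>) \<le> C"
  shows "u \<in> lp p \<mu>" and "nrm u \<le> C"
proof -
  have "(\<Sum>x\<in>F. \<bar>u x\<bar> powr p * \<mu> x) \<le> C powr p" if F: "finite F" for F
  proof (cases "0 < (\<Sum>x\<in>F. \<bar>u x\<bar> powr p * \<mu> x)")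
    case True
    then obtain \<psi> where "norming F \<psi>"
      "(\<Sum>x\<in>F. \<psi> x * \<bar>u x\<bar>) = (\<Sum>x\<in>F. \<bar>u x\<bar> powr p * \<mu> x) powr (1 / p)"
      using norming_exists[OF F] by blast
    then have "(\<Sum>x\<in>F. \<bar>u x\<bar> powr p * \<mu> x) powr (1 / p) \<le> C" using le by metis
    then have "((\<Sum>x\<in>F. \<bar>u x\<bar> powr p * \<mu> x) powr (1 / p)) powr p \<le> C powr p"
      using p_pos by (intro powr_mono2) auto
    then show ?thesis using True p_pos by (simp add: powr_powr)
  next
    case False
    then show ?thesis by (smt (verit) powr_ge_zero)
  qed
  then show "u \<in> lp p \<mu>" "nrm u \<le> C" using lp_leI[OF C] by auto
qed

lemma norming_le: "norming F \<psi> \<Longrightarrow> v \<in> lp p \<mu> \<Longrightarrow> (\<Sum>x\<in>F. \<psi> x * \<bar>v x\<bar>) \<le> nrm v"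
  by (simp add: norming_def)

lemma lp_add:
  assumes "u \<in> lp p \<mu>" "v \<in> lp p \<mu>"
  shows "u + v \<in> lp p \<mu>" and "nrm (u + v) \<le> nrm u + nrm v"
proof -
  have "(\<Sum>x\<in>F. \<psi> x * \<bar>(u + v) x\<bar>) \<le> nrm u + nrm v" if \<psi>: "norming F \<psi>" for F \<psi>
  proof -
    have "(\<Sum>x\<in>F. \<psi> x * \<bar>(u + v) x\<bar>) \<le> (\<Sum>x\<in>F. \<psi> x * \<bar>u x\<bar> + \<psi> x * \<bar>v x\<bar>)"
      unfolding distrib_left[symmetric] using \<psi>
      by (intro sum_mono mult_left_mono) (auto simp: norming_def)
    also have "\<dots> \<le> nrm u + nrm v"
      unfolding sum.distrib using assms \<psi> by (intro add_mono norming_le)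
    finally show ?thesis .
  qed
  then show "u + v \<in> lp p \<mu>" "nrm (u + v) \<le> nrm u + nrm v"
    using lp_leI_dual[of "nrm u + nrm v" "u + v"] by auto
qed

lemma lp_sum:
  assumes "finite A" "\<And>i. i \<in> A \<Longrightarrow> u i \<in> lp p \<mu>"
  shows "(\<Sum>i\<in>A. u i) \<in> lp p \<mu>" and "nrm (\<Sum>i\<in>A. u i) \<le> (\<Sum>i\<in>A. nrm (u i))"
proof -
  have "(\<Sum>i\<in>A. u i) \<in> lp p \<mu> \<and> nrm (\<Sum>i\<in>A. u i) \<le> (\<Sum>i\<in>A. nrm (u i))"
    using assms
  proof (induction A rule: finite_induct)
    case (insert i A)
    then have "u i \<in> lp p \<mu>" "sum u A \<in> lp p \<mu>" "nrm (sum u A) \<le> (\<Sum>i\<in>A. nrm (u i))" by auto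
    then show ?case
      unfolding sum.insert[OF insert.hyps(1,2)]
      using lp_add(1)[of "u i" "sum u A"] lp_add(2)[of "u i" "sum u A"] by (meson add_left_mono order_trans)
  qed simp
  then show "(\<Sum>i\<in>A. u i) \<in> lp p \<mu>" "nrm (\<Sum>i\<in>A. u i) \<le> (\<Sum>i\<in>A. nrm (u i))" by auto
qed

lemma lp_uminus: "u \<in> lp p \<mu> \<Longrightarrow> - u \<in> lp p \<mu>"
  using lp_scaleR[of u "-1"] by simp

lemma lp_norm_uminus [simp]: "nrm (- u) = nrm u"
  by (intro lp_norm_cong_abs) auto

lemma lp_diff:
  assumes "u \<in> lp p \<mu>" "v \<in> lp p \<mu>"
  shows "u - v \<in> lp p \<mu>" and "nrm (u - v) \<le> nrm u + nrm v"
  using lp_add[OF assms(1) lp_uminus[OF assms(2)]] by auto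

lemma lp_triangle:
  assumes "u \<in> lp p \<mu>" "v \<in> lp p \<mu>" "z \<in> lp p \<mu>"
  shows "nrm (u - z) \<le> nrm (u - v) + nrm (v - z)"
  using lp_add(2)[OF lp_diff(1)[OF assms(1,2)] lp_diff(1)[OF assms(2,3)]] by simp

lemma lp_norm_triangle_diff:
  assumes "u \<in> lp p \<mu>" "v \<in> lp p \<mu>"
  shows "\<bar>nrm u - nrm v\<bar> \<le> nrm (u - v)"
  using lp_triangle[of u v 0] lp_triangle[of v u 0] assms by (simp add: lp_norm_commute)

lemma lp_norm_eq_0: "u \<in> lp p \<mu> \<Longrightarrow> nrm u = 0 \<Longrightarrow> u = 0"
  using lp_coord[of u] by (auto simp: fun_eq_iff)

lemma lp_fatou:
  assumes "\<And>n. u n \<in> lp p \<mu>" and "\<And>x. (\<lambda>n. u n x) \<longlonglongrightarrow> v x"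
    and "\<forall>\<^sub>F n in sequentially. nrm (u n) \<le> C" and C: "0 \<le> C"
  shows "v \<in> lp p \<mu>" and "nrm v \<le> C"
proof -
  have "(\<Sum>x\<in>F. \<psi> x * \<bar>v x\<bar>) \<le> C" if \<psi>: "norming F \<psi>" for F \<psi>
  proof (rule tendsto_upperbound)
    show "(\<lambda>n. \<Sum>x\<in>F. \<psi> x * \<bar>u n x\<bar>) \<longlonglongrightarrow> (\<Sum>x\<in>F. \<psi> x * \<bar>v x\<bar>)"
      by (intro tendsto_intros assms(2))
    show "\<forall>\<^sub>F n in sequentially. (\<Sum>x\<in>F. \<psi> x * \<bar>u n x\<bar>) \<le> C"
      using assms(3) by eventually_elim (use norming_le[OF \<psi> assms(1)] in \<open>auto intro: order_trans\<close>)
  qed simp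
  then show "v \<in> lp p \<mu>" "nrm v \<le> C" using lp_leI_dual[OF C] by auto
qed

lemma lp_tendsto_coord:
  assumes "\<forall>\<^sub>F n in G. u n \<in> lp p \<mu>" "v \<in> lp p \<mu>" and "((\<lambda>n. nrm (u n - v)) \<longlongrightarrow> 0) G"
  shows "((\<lambda>n. u n x) \<longlongrightarrow> v x) G"
proof -
  have "((\<lambda>n. \<mu> x powr (- 1 / p) * nrm (u n - v)) \<longlongrightarrow> 0) G"
    using tendsto_mult_right_zero[OF assms(3)] by simp
  moreover have "\<forall>\<^sub>F n in G. norm (u n x - v x) \<le> \<mu> x powr (- 1 / p) * nrm (u n - v)"
    using assms(1)
  proof eventually_elim
    case (elim n)
    then show ?case using lp_coord[OF lp_diff(1)[OF _ assms(2)], of "u n" x] by simp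
  qed
  ultimately have "((\<lambda>n. u n x - v x) \<longlongrightarrow> 0) G"
    by (rule Lim_null_comparison[rotated])
  then show ?thesis by (simp add: LIM_zero_iff)
qed

text \<open>
  Completeness, in the form in which fixed points of iterations with contraction factor
  \<open>1 / 2\<close> are found: the limit is the pointwise one, and Fatou's lemma turns the Cauchy estimate
  into the estimate for the limit.
\<close>

lemma lp_geometric_limit:
  assumes u: "\<And>n. u n \<in> lp p \<mu>" and C: "0 \<le> C"
    and step: "\<And>n. nrm (u (Suc n) - u n) \<le> C * (1/2)^n"
  shows "(\<lambda>x. lim (\<lambda>n. u n x)) \<in> lp p \<mu>"
    and "\<And>n. nrm ((\<lambda>x. lim (\<lambda>n. u n x)) - u n) \<le> 2 * C * (1/2)^n"
proof -
  define v where "v = (\<lambda>x. lim (\<lambda>n. u n x))"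
  \<comment> \<open>The geometric sum is kept in closed form so that the induction on \<open>k\<close> goes through.\<close>
  have far: "nrm (u (n + k) - u n) \<le> 2 * C * (1/2)^n * (1 - (1/2)^k)" for n k
  proof (induction k)
    case (Suc k)
    have "nrm (u (n + Suc k) - u n) \<le> nrm (u (Suc (n + k)) - u (n + k)) + nrm (u (n + k) - u n)"
      using lp_triangle[OF u u u] by simp
    also have "\<dots> \<le> C * (1/2)^(n + k) + 2 * C * (1/2)^n * (1 - (1/2)^k)"
      by (intro add_mono step Suc)
    also have "\<dots> = 2 * C * (1/2)^n * (1 - (1/2)^Suc k)"
      by (simp add: power_add algebra_simps)
    finally show ?case .
  qed simp
  have far': "nrm (u m - u n) \<le> 2 * C * (1/2)^n" if "n \<le> m" for m n
  proof -
    have "nrm (u (n + (m - n)) - u n) \<le> 2 * C * (1/2)^n * (1 - (1/2)^(m - n))" by (rule far)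
    also have "\<dots> \<le> 2 * C * (1/2)^n * 1"
      using C by (intro mult_left_mono) auto
    finally show ?thesis using that by simp
  qed
  have lim: "(\<lambda>n. u n x) \<longlonglongrightarrow> v x" for x
  proof -
    have "Cauchy (\<lambda>n. u n x)"
    proof (rule metric_CauchyI)
      fix e :: real assume e: "0 < e"
      let ?c = "\<mu> x powr (- 1 / p) * (2 * C)"
      have "(\<lambda>n. ?c * (1/2)^n) \<longlonglongrightarrow> ?c * 0"
        by (intro tendsto_mult tendsto_const LIMSEQ_realpow_zero) auto
      then have "\<forall>\<^sub>F n in sequentially. ?c * (1/2)^n < e / 2"
        using e by (intro order_tendstoD(2)) auto
      then obtain M where M: "?c * (1/2)^M < e / 2" by (auto simp: eventually_sequentially)
      have b: "\<bar>u m x - u M x\<bar> < e / 2" if "M \<le> m" for m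
      proof -
        have "\<bar>(u m - u M) x\<bar> \<le> \<mu> x powr (- 1 / p) * nrm (u m - u M)"
          by (intro lp_coord lp_diff u)
        also have "\<dots> \<le> \<mu> x powr (- 1 / p) * (2 * C * (1/2)^M)"
          by (intro mult_left_mono far' that) auto
        finally show ?thesis using M by (simp add: mult_ac)
      qed
      show "\<exists>M. \<forall>m\<ge>M. \<forall>n\<ge>M. dist (u m x) (u n x) < e"
      proof (intro exI[of _ M] allI impI)
        fix m n assume "M \<le> m" "M \<le> n"
        then show "dist (u m x) (u n x) < e"
          using b[of m] b[of n] unfolding dist_real_def by linarith
      qed
    qed
    then show ?thesis by (simp add: v_def Cauchy_convergent_iff convergent_LIMSEQ_iff)
  qed
  have *: "v - u n \<in> lp p \<mu> \<and> nrm (v - u n) \<le> 2 * C * (1/2)^n" for n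
  proof -
    have l: "(\<lambda>m. (u m - u n) x) \<longlonglongrightarrow> (v - u n) x" for x
      using tendsto_diff[OF lim tendsto_const] by simp
    have ev: "\<forall>\<^sub>F m in sequentially. nrm (u m - u n) \<le> 2 * C * (1/2)^n"
      using far' by (auto simp: eventually_sequentially)
    show ?thesis
      using lp_fatou[of "\<lambda>m. u m - u n" "v - u n", OF lp_diff(1)[OF u u] l ev] C by auto
  qed
  show "nrm ((\<lambda>x. lim (\<lambda>n. u n x)) - u n) \<le> 2 * C * (1/2)^n" for n using * unfolding v_def by blast
  show "(\<lambda>x. lim (\<lambda>n. u n x)) \<in> lp p \<mu>" using lp_add(1)[OF conjunct1[OF *[of 0]] u[of 0]] by (simp add: v_def)
qed

lemma lp_nn_integral:
  assumes "u \<in> lp p \<mu>"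
  shows "(\<integral>\<^sup>+x. ennreal (\<bar>u x\<bar> powr p * \<mu> x) \<partial>count_space UNIV) = ennreal (nrm u powr p)"
proof -
  let ?g = "\<lambda>x. \<bar>u x\<bar> powr p * \<mu> x"
  have nn: "0 \<le> ?g x" for x by (simp add: less_imp_le mu_pos)
  have s: "Infinite_Set_Sum.abs_summable_on ?g UNIV"
    using assms nn by (simp add: lp_def abs_summable_equivalent[symmetric])
  then have "integrable (count_space UNIV) ?g" by (simp add: abs_summable_on_def)
  then have "(\<integral>\<^sup>+x. ennreal (?g x) \<partial>count_space UNIV) = ennreal (infsetsum ?g UNIV)"
    unfolding infsetsum_def using nn by (intro nn_integral_eq_integral) auto
  then show ?thesis unfolding lp_norm_powr infsetsum_infsum[OF s] .
qed

lemma lp_dominated_convergence: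
  assumes v: "v \<in> lp p \<mu>" and dom: "\<And>n x. \<bar>u n x\<bar> \<le> c * \<bar>v x\<bar>" and c: "0 \<le> c"
    and lim: "\<And>x. (\<lambda>n. u n x) \<longlonglongrightarrow> 0"
  shows "(\<lambda>n. nrm (u n)) \<longlonglongrightarrow> 0"
proof -
  have u: "u n \<in> lp p \<mu>" for n using lp_dominated(1)[OF v c dom] .
  let ?g = "\<lambda>x. c powr p * (\<bar>v x\<bar> powr p * \<mu> x)"
  have "(\<lambda>n. \<integral>\<^sup>+x. ennreal (\<bar>u n x\<bar> powr p * \<mu> x) \<partial>count_space UNIV)
      \<longlonglongrightarrow> (\<integral>\<^sup>+x. 0 \<partial>count_space (UNIV :: 'a set))"
  proof (rule nn_integral_dominated_convergence[where w = "\<lambda>x. ennreal (?g x)"])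
    have "(\<integral>\<^sup>+x. ennreal (?g x) \<partial>count_space UNIV) = c powr p * ennreal (nrm v powr p)"
      unfolding lp_nn_integral[OF v, symmetric] using c
      by (subst nn_integral_cmult[symmetric]) (auto simp: ennreal_mult' less_imp_le mu_pos)
    then show "(\<integral>\<^sup>+x. ennreal (?g x) \<partial>count_space UNIV) < \<infinity>"
      by (simp add: ennreal_mult_less_top)
    show "AE x in count_space UNIV. ennreal (\<bar>u n x\<bar> powr p * \<mu> x) \<le> ennreal (?g x)" for n
    proof (rule AE_I2)
      fix x
      have "\<bar>u n x\<bar> powr p \<le> (c * \<bar>v x\<bar>) powr p"
        using dom p_pos by (intro powr_mono2) auto
      then have "\<bar>u n x\<bar> powr p * \<mu> x \<le> (c * \<bar>v x\<bar>) powr p * \<mu> x"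
        using mu_pos[of x] by (intro mult_right_mono) auto
      then show "ennreal (\<bar>u n x\<bar> powr p * \<mu> x) \<le> ennreal (?g x)"
        using c by (intro ennreal_leI) (simp add: powr_mult mult_ac)
    qed
    show "AE x in count_space UNIV. (\<lambda>n. ennreal (\<bar>u n x\<bar> powr p * \<mu> x)) \<longlonglongrightarrow> 0"
    proof (rule AE_I2)
      fix x
      have "(\<lambda>n. \<bar>u n x\<bar> powr p * \<mu> x) \<longlonglongrightarrow> \<bar>0\<bar> powr p * \<mu> x"
        using p_pos by (intro tendsto_intros tendsto_powr' lim) auto
      then show "(\<lambda>n. ennreal (\<bar>u n x\<bar> powr p * \<mu> x)) \<longlonglongrightarrow> 0"
        using p_pos by (simp add: tendsto_ennreal_iff[of _ _ 0, simplified] less_imp_le mu_pos)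
    qed
  qed auto
  then have "(\<lambda>n. ennreal (nrm (u n) powr p)) \<longlonglongrightarrow> ennreal 0"
    by (simp add: lp_nn_integral[OF u])
  then have "(\<lambda>n. nrm (u n) powr p) \<longlonglongrightarrow> 0"
    by (subst (asm) tendsto_ennreal_iff) auto
  then have "(\<lambda>n. (nrm (u n) powr p) powr (1 / p)) \<longlonglongrightarrow> 0 powr (1 / p)"
    using p_pos by (intro tendsto_powr' tendsto_const) auto
  then show ?thesis using p_pos by (simp add: powr_powr)
qed

text \<open>
  Since \<open>X\<close> is countable, the norm is built from the coordinates by a series.
\<close>

lemma lp_norm_measurable:
  assumes m: "\<And>x. (\<lambda>t. g t x) \<in> borel_measurable M" and g: "\<And>t. t \<in> space M \<Longrightarrow> g t \<in> lp p \<mu>"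
  shows "(\<lambda>t. nrm (g t)) \<in> borel_measurable M"
proof -
  have "(\<lambda>t. \<integral>\<^sup>+x. ennreal (\<bar>g t x\<bar> powr p * \<mu> x) \<partial>count_space UNIV) \<in> borel_measurable M"
    (is "?I \<in> _")
  proof -
    have "?I = (\<lambda>t. \<Sum>n. if n \<in> range (to_nat :: 'a \<Rightarrow> nat)
        then ennreal (\<bar>g t (from_nat n)\<bar> powr p * \<mu> (from_nat n)) else 0)"
    proof
      fix t
      let ?f = "\<lambda>n. ennreal (\<bar>g t (from_nat n)\<bar> powr p * \<mu> (from_nat n :: 'a))"
      have "?I t = (\<integral>\<^sup>+n. ?f n \<partial>count_space (range (to_nat :: 'a \<Rightarrow> nat)))"
        by (subst nn_integral_bij_count_space[of to_nat UNIV "range to_nat", symmetric])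
          (auto simp: bij_betw_def)
      also have "\<dots> = (\<integral>\<^sup>+n. (if n \<in> range (to_nat :: 'a \<Rightarrow> nat) then ?f n else 0) \<partial>count_space UNIV)"
        by (subst nn_integral_count_space_indicator)
          (auto intro!: nn_integral_cong split: split_indicator)
      finally show "?I t = (\<Sum>n. if n \<in> range (to_nat :: 'a \<Rightarrow> nat) then ?f n else 0)"
        by (simp only: nn_integral_count_space_nat)
    qed
    moreover have "(\<lambda>t. \<Sum>n. if n \<in> range (to_nat :: 'a \<Rightarrow> nat)
        then ennreal (\<bar>g t (from_nat n)\<bar> powr p * \<mu> (from_nat n)) else 0) \<in> borel_measurable M"
    proof (intro borel_measurable_suminf_order)
      fix n
      show "(\<lambda>t. if n \<in> range (to_nat :: 'a \<Rightarrow> nat)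
        then ennreal (\<bar>g t (from_nat n)\<bar> powr p * \<mu> (from_nat n)) else 0) \<in> borel_measurable M"
        using m by (cases "n \<in> range (to_nat :: 'a \<Rightarrow> nat)") (simp_all, measurable)
    qed
    ultimately show ?thesis by simp
  qed
  then have "(\<lambda>t. enn2real (?I t) powr (1 / p)) \<in> borel_measurable M"
    by measurable
  moreover have "enn2real (?I t) powr (1 / p) = nrm (g t)" if "t \<in> space M" for t
    using g[OF that] p_pos by (simp add: lp_nn_integral powr_powr)
  ultimately show ?thesis by (simp cong: measurable_cong)
qed

end


section \<open>Bochner integrals in coordinates\<close>

lemma sum_fun_apply: "(\<Sum>i\<in>A. f i) x = (\<Sum>i\<in>A. f i x)"
  by (induction A rule: infinite_finite_induct) auto

lemma simple_bochner_integral_apply: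
  fixes s :: "'b \<Rightarrow> 'a \<Rightarrow> real"
  assumes "Bochner_Integration.simple_bochner_integrable M s"
  shows "Bochner_Integration.simple_bochner_integral M s x = (\<integral>t. s t x \<partial>M)"
    and "integrable M (\<lambda>t. s t x)"
proof -
  have lin: "linear (\<lambda>u :: 'a \<Rightarrow> real. u x)" by (rule linearI) auto
  have "Bochner_Integration.simple_bochner_integrable M (\<lambda>t. s t x)"
    using simple_bochner_integrable_compose2[where p = "\<lambda>u v. u x", OF _ assms assms] by simp
  then have "has_bochner_integral M (\<lambda>t. s t x) (Bochner_Integration.simple_bochner_integral M (\<lambda>t. s t x))"
    by (rule has_bochner_integral_simple_bochner_integrable)
  then have "integrable M (\<lambda>t. s t x)" "(\<integral>t. s t x \<partial>M) = Bochner_Integration.simple_bochner_integral M (\<lambda>t. s t x)"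
    by (auto simp: has_bochner_integral_iff)
  then show "Bochner_Integration.simple_bochner_integral M s x = (\<integral>t. s t x \<partial>M)" "integrable M (\<lambda>t. s t x)"
    using simple_bochner_integral_linear[OF lin assms] by auto
qed

lemma simple_bochner_integrable_finite_measure:
  fixes s :: "'b \<Rightarrow> 'c::real_vector"
  assumes "finite_measure M" "simple_function M s"
  shows "Bochner_Integration.simple_bochner_integrable M s"
proof -
  interpret finite_measure M by fact
  show ?thesis by (rule simple_bochner_integrable.intros[OF assms(2)]) simp
qed

lemma complete_measure_lebesgue_on:
  assumes "S \<in> sets lebesgue"
  shows "complete_measure (lebesgue_on S)"
proof
  fix A B assume AB: "B \<subseteq> A" "A \<in> null_sets (lebesgue_on S)"
  then have "A \<in> null_sets lebesgue" "A \<subseteq> S"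
    using assms by (auto simp: null_sets_restrict_space)
  then have "B \<in> null_sets lebesgue" using completion.complete2 AB(1) by blast
  then show "B \<in> sets (lebesgue_on S)"
    using AB(1) \<open>A \<subseteq> S\<close> assms by (auto simp: sets_restrict_space_iff)
qed

text \<open>
  Strong measurability gives convergence of simple functions only almost everywhere, so
  completeness of the measure is what makes the limit measurable.
\<close>

lemma (in complete_measure) measurable_AE_limit:
  fixes f :: "nat \<Rightarrow> 'a \<Rightarrow> real"
  assumes m: "\<And>n. f n \<in> borel_measurable M" and lim: "AE t in M. (\<lambda>n. f n t) \<longlonglongrightarrow> g t"
  shows "g \<in> borel_measurable M"
proof (rule measurableI)
  fix A :: "real set" assume "A \<in> sets borel"
  moreover have "(\<lambda>t. lim (\<lambda>n. f n t)) \<in> borel_measurable M"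
    by (rule borel_measurable_lim_metric) (rule m)
  ultimately have 1: "(\<lambda>t. lim (\<lambda>n. f n t)) -` A \<inter> space M \<in> sets M" by measurable
  show "g -` A \<inter> space M \<in> sets M"
  proof (rule in_sets_AE[OF _ 1])
    show "AE t in M. (t \<in> (\<lambda>t. lim (\<lambda>n. f n t)) -` A \<inter> space M) = (t \<in> g -` A \<inter> space M)"
      using lim by eventually_elim (simp add: limI)
  qed auto
qed auto

context weighted_lp
begin

text \<open>
  Bochner integrability in terms of real functions only: measurability of each coordinate and a
  finite integral of the norm. The equivalence is \<open>lp_integrable_iff\<close>.
\<close>

definition lp_L1 :: "'b measure \<Rightarrow> ('b \<Rightarrow> 'a \<Rightarrow> real) \<Rightarrow> bool" where
  "lp_L1 M g \<longleftrightarrow> (\<forall>t\<in>space M. g t \<in> lp p \<mu>) \<and> (\<forall>x. (\<lambda>t. g t x) \<in> borel_measurable M) \<and>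
     (\<integral>\<^sup>+t. ennreal (nrm (g t)) \<partial>M) < \<infinity>"

lemma lp_L1_norm:
  assumes "lp_L1 M g"
  shows "integrable M (\<lambda>t. nrm (g t))" "(\<integral>\<^sup>+t. ennreal (nrm (g t)) \<partial>M) = ennreal (\<integral>t. nrm (g t) \<partial>M)"
proof -
  have "(\<lambda>t. nrm (g t)) \<in> borel_measurable M"
    using assms by (intro lp_norm_measurable) (auto simp: lp_L1_def)
  then show i: "integrable M (\<lambda>t. nrm (g t))"
    using assms by (intro integrableI_bounded) (auto simp: lp_L1_def)
  show "(\<integral>\<^sup>+t. ennreal (nrm (g t)) \<partial>M) = ennreal (\<integral>t. nrm (g t) \<partial>M)"
    by (intro nn_integral_eq_integral i) auto
qed

lemma lp_L1_coord:
  assumes "lp_L1 M g"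
  shows "integrable M (\<lambda>t. g t x)"
proof (rule Bochner_Integration.integrable_bound)
  show "integrable M (\<lambda>t. \<mu> x powr (- 1 / p) * nrm (g t))"
    by (intro integrable_mult_right lp_L1_norm(1) assms)
  show "AE t in M. norm (g t x) \<le> norm (\<mu> x powr (- 1 / p) * nrm (g t))"
    using assms lp_coord[of "g _" x] by (intro AE_I2) (auto simp: lp_L1_def)
qed (use assms in \<open>auto simp: lp_L1_def\<close>)

lemma lp_minkowski_integral:
  assumes "lp_L1 M g"
  shows "(\<lambda>x. \<integral>t. g t x \<partial>M) \<in> lp p \<mu>" and "nrm (\<lambda>x. \<integral>t. g t x \<partial>M) \<le> (\<integral>t. nrm (g t) \<partial>M)"
proof -
  have "(\<Sum>x\<in>F. \<psi> x * \<bar>\<integral>t. g t x \<partial>M\<bar>) \<le> (\<integral>t. nrm (g t) \<partial>M)" if \<psi>: "norming F \<psi>" for F \<psi>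
  proof -
    have "(\<Sum>x\<in>F. \<psi> x * \<bar>\<integral>t. g t x \<partial>M\<bar>) \<le> (\<Sum>x\<in>F. \<psi> x * (\<integral>t. \<bar>g t x\<bar> \<partial>M))"
      using \<psi> by (intro sum_mono mult_left_mono integral_abs_bound) (auto simp: norming_def)
    also have "\<dots> = (\<integral>t. (\<Sum>x\<in>F. \<psi> x * \<bar>g t x\<bar>) \<partial>M)"
      using lp_L1_coord[OF assms] by (subst Bochner_Integration.integral_sum) auto
    also have "\<dots> \<le> (\<integral>t. nrm (g t) \<partial>M)"
      using assms norming_le[OF \<psi>] lp_L1_coord[OF assms] lp_L1_norm(1)[OF assms]
      by (intro integral_mono) (auto simp: lp_L1_def)
    finally show ?thesis .
  qed
  then show "(\<lambda>x. \<integral>t. g t x \<partial>M) \<in> lp p \<mu>" "nrm (\<lambda>x. \<integral>t. g t x \<partial>M) \<le> (\<integral>t. nrm (g t) \<partial>M)"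
    using lp_leI_dual[of "\<integral>t. nrm (g t) \<partial>M" "\<lambda>x. \<integral>t. g t x \<partial>M"] by auto
qed

lemma lp_L1_dominated:
  assumes "lp_L1 M g" "\<And>t. t \<in> space M \<Longrightarrow> f t \<in> lp p \<mu>" "\<And>x. (\<lambda>t. f t x) \<in> borel_measurable M"
    and "\<And>t. t \<in> space M \<Longrightarrow> nrm (f t) \<le> c * nrm (g t)"
  shows "lp_L1 M f"
proof -
  have "(\<integral>\<^sup>+t. ennreal (nrm (f t)) \<partial>M) \<le> (\<integral>\<^sup>+t. ennreal (norm (c * nrm (g t))) \<partial>M)"
    using assms(4) by (intro nn_integral_mono ennreal_leI) (auto intro: order_trans[OF _ abs_ge_self])
  also have "\<dots> < \<infinity>"
    using integrable_mult_right[OF lp_L1_norm(1)[OF assms(1)], of c]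
    by (simp only: integrable_iff_bounded)
  finally show ?thesis using assms by (simp add: lp_L1_def)
qed

lemma
  assumes "lp_L1 M f" "lp_L1 M g"
  shows lp_L1_add: "lp_L1 M (\<lambda>t. f t + g t)" and lp_L1_diff: "lp_L1 M (\<lambda>t. f t - g t)"
proof -
  have fin: "(\<integral>\<^sup>+t. ennreal (nrm (f t) + nrm (g t)) \<partial>M) < \<infinity>"
    using Bochner_Integration.integrable_add[OF lp_L1_norm(1)[OF assms(1)] lp_L1_norm(1)[OF assms(2)]]
    by (simp add: integrable_iff_bounded del: ennreal_plus)
  have "(\<integral>\<^sup>+t. ennreal (nrm (f t + g t)) \<partial>M) \<le> (\<integral>\<^sup>+t. ennreal (nrm (f t) + nrm (g t)) \<partial>M)"
    "(\<integral>\<^sup>+t. ennreal (nrm (f t - g t)) \<partial>M) \<le> (\<integral>\<^sup>+t. ennreal (nrm (f t) + nrm (g t)) \<partial>M)"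
    using assms
    by (auto intro!: nn_integral_mono ennreal_leI lp_add(2) lp_diff(2) simp: lp_L1_def simp del: ennreal_plus)
  with fin show "lp_L1 M (\<lambda>t. f t + g t)" "lp_L1 M (\<lambda>t. f t - g t)"
    using assms by (auto simp: lp_L1_def intro!: lp_add(1) lp_diff(1) borel_measurable_add borel_measurable_diff elim: le_less_trans)
qed

text \<open>
  Each coordinate is approximated by real simple functions bounded by twice its modulus, and at stage
  \<open>i\<close> only the nodes with number below \<open>i\<close> are kept. Dominated convergence over \<open>X\<close>, with
  dominating function \<open>3 \<bar>g t\<bar>\<close>, gives convergence in norm.
\<close>

lemma lp_simple_approximation:
  fixes M :: "'b measure"
  assumes g: "\<And>t. t \<in> space M \<Longrightarrow> g t \<in> lp p \<mu>" and m: "\<And>x. (\<lambda>t. g t x) \<in> borel_measurable M"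
  obtains s :: "nat \<Rightarrow> 'b \<Rightarrow> 'a \<Rightarrow> real" where
    "\<And>i. simple_function M (s i)" "\<And>i t. t \<in> space M \<Longrightarrow> s i t \<in> lp p \<mu>"
    "\<And>t. t \<in> space M \<Longrightarrow> (\<lambda>i. nrm (s i t - g t)) \<longlonglongrightarrow> 0"
    "\<And>i t. t \<in> space M \<Longrightarrow> nrm (s i t - g t) \<le> 3 * nrm (g t)"
proof -
  have "\<exists>r. (\<forall>i. simple_function M (r i)) \<and> (\<forall>t\<in>space M. (\<lambda>i. r i t) \<longlonglongrightarrow> g t x) \<and>
    (\<forall>i. \<forall>t\<in>space M. \<bar>r i t\<bar> \<le> 2 * \<bar>g t x\<bar>)" for x
    using borel_measurable_implies_sequence_metric[OF m[of x], where z = 0] by simp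
  then obtain r where r: "\<And>x i. simple_function M (r x i)"
    "\<And>x t. t \<in> space M \<Longrightarrow> (\<lambda>i. r x i t) \<longlonglongrightarrow> g t x"
    "\<And>x i t. t \<in> space M \<Longrightarrow> \<bar>r x i t\<bar> \<le> 2 * \<bar>g t x\<bar>" by metis
  \<comment> \<open>The truncation to finitely many nodes makes \<open>s i\<close> a finite sum of simple functions.\<close>
  define F where "F i = {x :: 'a. to_nat x < i}" for i :: nat
  have F: "finite (F i)" for i
    unfolding F_def by (rule finite_imageD[of to_nat]) (auto intro: finite_subset[of _ "{..<i}"] inj_on_subset[OF inj_to_nat])
  define s where "s i t = (\<Sum>x\<in>F i. r x i t *\<^sub>R (indicator {x} :: 'a \<Rightarrow> real))" for i t
  have s: "s i t y = (if to_nat y < i then r y i t else 0)" for i t y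
  proof -
    have "s i t y = (\<Sum>x\<in>F i. if x = y then r x i t else 0)"
      unfolding s_def sum_fun_apply by (intro sum.cong) (auto simp: indicator_def)
    then show ?thesis using F[of i] by (simp add: F_def)
  qed
  have sle: "\<bar>s i t y\<bar> \<le> 2 * \<bar>g t y\<bar>" if "t \<in> space M" for i t y
    using r(3)[OF that] by (simp add: s)
  have sgle: "\<bar>(s i t - g t) y\<bar> \<le> 3 * \<bar>g t y\<bar>" if "t \<in> space M" for i t y
    using sle[OF that, of i y] by simp
  have slim: "(\<lambda>i. (s i t - g t) y) \<longlonglongrightarrow> 0" if "t \<in> space M" for t y
  proof -
    have "(\<lambda>i. s i t y) \<longlonglongrightarrow> g t y"
      by (rule Lim_transform_eventually[OF r(2)[OF that]])
        (use eventually_gt_at_top[of "to_nat y"] in eventually_elim, simp add: s)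
    then show ?thesis by (simp add: LIM_zero_iff)
  qed
  show thesis
  proof (rule that)
    show "simple_function M (s i)" for i
      unfolding s_def by (intro simple_function_sum simple_function_compose1[OF r(1)])
    show "s i t \<in> lp p \<mu>" if "t \<in> space M" for i t
      by (rule lp_dominated(1)[OF g[OF that] _ sle[OF that]]) simp
    show "(\<lambda>i. nrm (s i t - g t)) \<longlonglongrightarrow> 0" if "t \<in> space M" for t
      by (rule lp_dominated_convergence[OF g[OF that] sgle[OF that] _ slim[OF that]]) simp
    show "nrm (s i t - g t) \<le> 3 * nrm (g t)" if "t \<in> space M" for i t
      by (rule lp_dominated(2)[OF g[OF that] _ sgle[OF that]]) simp
  qed
qed

text \<open>
  The simple approximations converge in norm for every \<open>t\<close> and stay below three times the norm of
  \<open>g\<close>, so they converge in mean; Minkowski's inequality then makes their integrals converge to the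
  coordinatewise integral.
\<close>

lemma lp_L1_imp_has_integral:
  fixes M :: "real measure"
  assumes fin: "finite_measure M" and g: "lp_L1 M g"
  shows "lp_has_integral p \<mu> M g (\<lambda>x. \<integral>t. g t x \<partial>M)"
proof -
  let ?I = "\<lambda>x. \<integral>t. g t x \<partial>M"
  have glp: "\<And>t. t \<in> space M \<Longrightarrow> g t \<in> lp p \<mu>" and gm: "\<And>x. (\<lambda>t. g t x) \<in> borel_measurable M"
    using g by (auto simp: lp_L1_def)
  obtain s :: "nat \<Rightarrow> real \<Rightarrow> 'a \<Rightarrow> real" where s:
    "\<And>i. simple_function M (s i)" "\<And>i t. t \<in> space M \<Longrightarrow> s i t \<in> lp p \<mu>"
    "\<And>t. t \<in> space M \<Longrightarrow> (\<lambda>i. nrm (s i t - g t)) \<longlonglongrightarrow> 0"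
    "\<And>i t. t \<in> space M \<Longrightarrow> nrm (s i t - g t) \<le> 3 * nrm (g t)"
    using lp_simple_approximation[OF glp gm] by blast
  have sb: "Bochner_Integration.simple_bochner_integrable M (s i)" for i
    by (rule simple_bochner_integrable_finite_measure[OF fin s(1)])
  have sm: "(\<lambda>t. s i t x) \<in> borel_measurable M" for i x
    by (rule borel_measurable_simple_function[OF simple_function_compose1[OF s(1)]])
  have dL1: "lp_L1 M (\<lambda>t. s i t - g t)" for i
    by (rule lp_L1_dominated[OF g _ _ s(4)]) (auto intro!: lp_diff s(2) glp borel_measurable_diff sm gm)
  have n0: "(\<lambda>i. \<integral>\<^sup>+t. ennreal (nrm (s i t - g t)) \<partial>M) \<longlonglongrightarrow> (\<integral>\<^sup>+t. 0 \<partial>M)"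
  proof (rule nn_integral_dominated_convergence[where w = "\<lambda>t. ennreal (3 * nrm (g t))"])
    have gn: "(\<lambda>t. nrm (g t)) \<in> borel_measurable M"
      using lp_L1_norm(1)[OF g] by auto
    then show "(\<lambda>t. ennreal (3 * nrm (g t))) \<in> borel_measurable M" by measurable
    have "(\<lambda>t. nrm (s i t - g t)) \<in> borel_measurable M" for i
      using lp_L1_norm(1)[OF dL1] by auto
    then show "(\<lambda>t. ennreal (nrm (s i t - g t))) \<in> borel_measurable M" for i by measurable
    show "(\<integral>\<^sup>+t. ennreal (3 * nrm (g t)) \<partial>M) < \<infinity>"
      using integrable_mult_right[OF lp_L1_norm(1)[OF g], of 3] unfolding integrable_iff_bounded
      by (simp only: real_norm_def abs_mult abs_numeral abs_of_nonneg[OF lp_norm_nonneg])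
    show "AE t in M. (\<lambda>i. ennreal (nrm (s i t - g t))) \<longlonglongrightarrow> 0"
      using s(3) by (intro AE_I2) (simp add: tendsto_ennreal_iff[of _ _ 0, simplified])
  qed (use s(4) in \<open>auto intro!: AE_I2 ennreal_leI\<close>)
  have n1: "(\<lambda>i. \<integral>t. nrm (s i t - g t) \<partial>M) \<longlonglongrightarrow> 0"
    using n0 unfolding lp_L1_norm(2)[OF dL1]
    by (simp add: tendsto_ennreal_iff[of _ _ 0, simplified])
  show ?thesis
    unfolding lp_has_integral_def lp_strongly_measurable_def
  proof (intro conjI exI[of _ s] allI ballI)
    show "?I \<in> lp p \<mu>" by (rule lp_minkowski_integral(1)[OF g])
    show "(\<lambda>i. \<integral>\<^sup>+t. ennreal (nrm (g t - s i t)) \<partial>M) \<longlonglongrightarrow> 0"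
      using n0 by (simp add: lp_norm_commute[of "g _"])
    show "(\<lambda>i. nrm (Bochner_Integration.simple_bochner_integral M (s i) - ?I)) \<longlonglongrightarrow> 0"
    proof (rule tendsto_sandwich[OF _ _ tendsto_const n1])
      have "Bochner_Integration.simple_bochner_integral M (s i) - ?I = (\<lambda>x. \<integral>t. (s i t - g t) x \<partial>M)" for i
        using simple_bochner_integral_apply[OF sb] lp_L1_coord[OF g]
        by (auto simp: fun_eq_iff)
      then show "\<forall>\<^sub>F i in sequentially. nrm (Bochner_Integration.simple_bochner_integral M (s i) - ?I) \<le> (\<integral>t. nrm (s i t - g t) \<partial>M)"
        using lp_minkowski_integral(2)[OF dL1] by simp
    qed simp
  qed (use s glp sb in auto)
qed

lemma lp_L1_simple:
  assumes s: "Bochner_Integration.simple_bochner_integrable M s" and lp: "s ` space M \<subseteq> lp p \<mu>"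
  shows "lp_L1 M s"
proof -
  have sf: "simple_function M s" using s by (simp add: simple_bochner_integrable.simps)
  have "(\<lambda>t. s t x) \<in> borel_measurable M" for x
    by (rule borel_measurable_simple_function[OF simple_function_compose1[OF sf]])
  moreover have "Bochner_Integration.simple_bochner_integrable M (\<lambda>t. nrm (s t))"
    using simple_bochner_integrable_compose2[where p = "\<lambda>u v. nrm u", OF _ s s] by simp
  then have "(\<integral>\<^sup>+t. ennreal (nrm (s t)) \<partial>M) < \<infinity>"
    using has_bochner_integral_simple_bochner_integrable[of M "\<lambda>t. nrm (s t)"]
    by (simp add: has_bochner_integral_iff integrable_iff_bounded)
  ultimately show ?thesis using lp by (auto simp: lp_L1_def)
qed

text \<open>
  The coordinates are almost everywhere limits of simple functions, and \<open>g\<close> differs from an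
  integrable simple function by something of finite integral.
\<close>

lemma lp_has_integral_imp_L1:
  fixes M :: "real measure"
  assumes comp: "complete_measure M" and g: "lp_has_integral p \<mu> M g I"
  shows "lp_L1 M g"
proof -
  interpret complete_measure M by fact
  from g have glp: "\<And>t. t \<in> space M \<Longrightarrow> g t \<in> lp p \<mu>"
    by (auto simp: lp_has_integral_def lp_strongly_measurable_def)
  have "\<exists>s. (\<forall>i::nat. simple_function M (s i) \<and> s i ` space M \<subseteq> lp p \<mu>) \<and>
      (AE t in M. (\<lambda>i. nrm (s i t - g t)) \<longlonglongrightarrow> 0)"
    using g unfolding lp_has_integral_def lp_strongly_measurable_def by (elim conjE)
  then obtain r where r': "\<forall>i::nat. simple_function M (r i) \<and> r i ` space M \<subseteq> lp p \<mu>"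
    and r_lim: "AE t in M. (\<lambda>i. nrm (r i t - g t)) \<longlonglongrightarrow> 0"
    by (elim exE conjE)
  have r: "simple_function M (r i)" "r i ` space M \<subseteq> lp p \<mu>" for i using r' by auto
  have gm: "(\<lambda>t. g t x) \<in> borel_measurable M" for x
  proof (rule measurable_AE_limit)
    show "(\<lambda>t. r i t x) \<in> borel_measurable M" for i
      by (rule borel_measurable_simple_function[OF simple_function_compose1[OF r(1)]])
    show "AE t in M. (\<lambda>i. r i t x) \<longlonglongrightarrow> g t x"
      using r_lim AE_space
    proof eventually_elim
      case (elim t)
      have "\<forall>\<^sub>F i in sequentially. r i t \<in> lp p \<mu>" using r(2) elim(2) by (simp add: image_subset_iff)
      then show ?case using elim glp by (rule_tac lp_tendsto_coord[where u = "\<lambda>i. r i t"]) auto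
    qed
  qed
  have "\<exists>s. (\<forall>i::nat. Bochner_Integration.simple_bochner_integrable M (s i) \<and> s i ` space M \<subseteq> lp p \<mu>) \<and>
      (\<lambda>i. \<integral>\<^sup>+t. ennreal (nrm (g t - s i t)) \<partial>M) \<longlonglongrightarrow> 0 \<and>
      (\<lambda>i. nrm (Bochner_Integration.simple_bochner_integral M (s i) - I)) \<longlonglongrightarrow> 0"
    using g unfolding lp_has_integral_def by (elim conjE)
  then obtain s where s': "\<forall>i::nat. Bochner_Integration.simple_bochner_integrable M (s i) \<and> s i ` space M \<subseteq> lp p \<mu>"
    and s_lim: "(\<lambda>i. \<integral>\<^sup>+t. ennreal (nrm (g t - s i t)) \<partial>M) \<longlonglongrightarrow> 0"
      "(\<lambda>i. nrm (Bochner_Integration.simple_bochner_integral M (s i) - I)) \<longlonglongrightarrow> 0"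
    by (elim exE conjE)
  have s: "Bochner_Integration.simple_bochner_integrable M (s i)" "s i ` space M \<subseteq> lp p \<mu>" for i using s' by auto
  have "\<forall>\<^sub>F i in sequentially. (\<integral>\<^sup>+t. ennreal (nrm (g t - s i t)) \<partial>M) < 1"
    by (rule order_tendstoD(2)[OF s_lim(1)]) simp
  then obtain i where i: "(\<integral>\<^sup>+t. ennreal (nrm (g t - s i t)) \<partial>M) < 1"
    by (auto simp: eventually_sequentially)
  have sf: "simple_function M (s i)" using s(1) simple_bochner_integrable.cases by blast
  have sm: "(\<lambda>t. s i t x) \<in> borel_measurable M" for x
    by (rule borel_measurable_simple_function[OF simple_function_compose1[OF sf]])
  have sL1: "lp_L1 M (s i)" by (rule lp_L1_simple[OF s])
  have dL1: "lp_L1 M (\<lambda>t. g t - s i t)"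
    using less_trans[OF i, of \<infinity>] sm gm s(2)[of i] glp
    by (simp add: lp_L1_def lp_diff image_subset_iff borel_measurable_diff)
  show ?thesis using lp_L1_add[OF dL1 sL1] by simp
qed

text \<open>
  Point evaluation maps the approximating sequence in the definition of \<^const>\<open>lp_has_integral\<close> to
  one for the real Bochner integral of the coordinate. In particular the integral is unique.
\<close>

lemma lp_has_integral_coord:
  fixes M :: "real measure"
  assumes comp: "complete_measure M" and g: "lp_has_integral p \<mu> M g I"
  shows "I = (\<lambda>x. \<integral>t. g t x \<partial>M)"
proof
  fix x
  have L1: "lp_L1 M g" by (rule lp_has_integral_imp_L1[OF assms])
  have "\<exists>s. (\<forall>i::nat. Bochner_Integration.simple_bochner_integrable M (s i) \<and> s i ` space M \<subseteq> lp p \<mu>) \<and>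
      (\<lambda>i. \<integral>\<^sup>+t. ennreal (nrm (g t - s i t)) \<partial>M) \<longlonglongrightarrow> 0 \<and>
      (\<lambda>i. nrm (Bochner_Integration.simple_bochner_integral M (s i) - I)) \<longlonglongrightarrow> 0"
    using g unfolding lp_has_integral_def by (elim conjE)
  then obtain s where s': "\<forall>i::nat. Bochner_Integration.simple_bochner_integrable M (s i) \<and> s i ` space M \<subseteq> lp p \<mu>"
    and s_lim: "(\<lambda>i. \<integral>\<^sup>+t. ennreal (nrm (g t - s i t)) \<partial>M) \<longlonglongrightarrow> 0"
      "(\<lambda>i. nrm (Bochner_Integration.simple_bochner_integral M (s i) - I)) \<longlonglongrightarrow> 0"
    by (elim exE conjE)
  have s: "Bochner_Integration.simple_bochner_integrable M (s i)" "s i ` space M \<subseteq> lp p \<mu>" for i using s' by auto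
  have I: "I \<in> lp p \<mu>" using g by (simp add: lp_has_integral_def)
  have sI: "Bochner_Integration.simple_bochner_integral M (s i) \<in> lp p \<mu>" for i
    unfolding simple_bochner_integral_def using s(1,2)
    by (intro lp_sum(1) lp_scaleR) (auto simp: simple_bochner_integrable.simps simple_function_def image_subset_iff)
  have "(\<lambda>i. Bochner_Integration.simple_bochner_integral M (s i) x) \<longlonglongrightarrow> I x"
    by (rule lp_tendsto_coord[OF always_eventually I s_lim(2)]) (simp add: sI)
  moreover have "has_bochner_integral M (\<lambda>t. g t x) (I x)"
  proof (rule has_bochner_integral.intros[where s = "\<lambda>i t. s i t x"])
    show "(\<lambda>t. g t x) \<in> borel_measurable M" using L1 by (simp add: lp_L1_def)
    show sx: "Bochner_Integration.simple_bochner_integrable M (\<lambda>t. s i t x)" for i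
      using simple_bochner_integrable_compose2[where p = "\<lambda>u v. u x", OF _ s(1) s(1)] by simp
    have e: "Bochner_Integration.simple_bochner_integral M (\<lambda>t. s i t x) = Bochner_Integration.simple_bochner_integral M (s i) x" for i
      using simple_bochner_integral_apply(1)[OF s(1)]
        has_bochner_integral_simple_bochner_integrable[OF sx] by (simp add: has_bochner_integral_iff)
    then show "(\<lambda>i. Bochner_Integration.simple_bochner_integral M (\<lambda>t. s i t x)) \<longlonglongrightarrow> I x"
      using \<open>(\<lambda>i. Bochner_Integration.simple_bochner_integral M (s i) x) \<longlonglongrightarrow> I x\<close> by simp
    let ?c = "\<mu> x powr (- 1 / p)"
    show "(\<lambda>i. \<integral>\<^sup>+t. ennreal (norm (g t x - s i t x)) \<partial>M) \<longlonglongrightarrow> 0"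
    proof (rule tendsto_sandwich[OF _ _ tendsto_const])
      have "(\<lambda>i. ennreal ?c * (\<integral>\<^sup>+t. ennreal (nrm (g t - s i t)) \<partial>M)) \<longlonglongrightarrow> ennreal ?c * 0"
        by (intro ennreal_tendsto_cmult s_lim(1)) auto
      then show "(\<lambda>i. ennreal ?c * (\<integral>\<^sup>+t. ennreal (nrm (g t - s i t)) \<partial>M)) \<longlonglongrightarrow> 0" by simp
      have "(\<integral>\<^sup>+t. ennreal (norm (g t x - s i t x)) \<partial>M)
          \<le> ennreal ?c * (\<integral>\<^sup>+t. ennreal (nrm (g t - s i t)) \<partial>M)" for i
      proof -
        have gs: "g t - s i t \<in> lp p \<mu>" if "t \<in> space M" for t
          using L1 s(2)[of i] that by (simp add: lp_L1_def lp_diff image_subset_iff)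
        have sf: "simple_function M (s i)" using s(1) simple_bochner_integrable.cases by blast
        have "(\<lambda>t. s i t y) \<in> borel_measurable M" for y
          by (rule borel_measurable_simple_function[OF simple_function_compose1[OF sf]])
        moreover have "(\<lambda>t. g t y) \<in> borel_measurable M" for y using L1 by (simp add: lp_L1_def)
        ultimately have mm: "(\<lambda>t. nrm (g t - s i t)) \<in> borel_measurable M"
          using gs by (intro lp_norm_measurable) (simp_all add: borel_measurable_diff)
        have "(\<integral>\<^sup>+t. ennreal (norm (g t x - s i t x)) \<partial>M) \<le> (\<integral>\<^sup>+t. ennreal ?c * ennreal (nrm (g t - s i t)) \<partial>M)"
          using lp_coord[OF gs, of _ x]
          by (intro nn_integral_mono) (simp add: ennreal_mult[symmetric] ennreal_leI)
        also have "\<dots> = ennreal ?c * (\<integral>\<^sup>+t. ennreal (nrm (g t - s i t)) \<partial>M)"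
          using mm by (intro nn_integral_cmult) measurable
        finally show ?thesis .
      qed
      then show "\<forall>\<^sub>F i in sequentially. (\<integral>\<^sup>+t. ennreal (norm (g t x - s i t x)) \<partial>M)
          \<le> ennreal ?c * (\<integral>\<^sup>+t. ennreal (nrm (g t - s i t)) \<partial>M)" by simp
    qed simp
  qed
  ultimately show "I x = (\<integral>t. g t x \<partial>M)" by (simp add: has_bochner_integral_iff)
qed

lemma lp_integrable_iff:
  fixes M :: "real measure"
  assumes "finite_measure M" "complete_measure M"
  shows "lp_integrable p \<mu> M g \<longleftrightarrow> lp_L1 M g"
  unfolding lp_integrable_def
  using lp_L1_imp_has_integral[OF assms(1)] lp_has_integral_imp_L1[OF assms(2)] by blast

lemma lp_integral_coord:
  fixes M :: "real measure"
  assumes "finite_measure M" "complete_measure M" "lp_L1 M g"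
  shows "lp_integral p \<mu> M g = (\<lambda>x. \<integral>t. g t x \<partial>M)"
proof -
  have "(THE I. lp_has_integral p \<mu> M g I) = (\<lambda>x. \<integral>t. g t x \<partial>M)"
    using lp_L1_imp_has_integral[OF assms(1,3)] lp_has_integral_coord[OF assms(2)] by (rule the_equality)
  then show ?thesis using assms lp_integrable_iff by (simp add: lp_integral_def)
qed

end


section \<open>The operator on a graph of bounded weighted degree\<close>

lemma infsum_diff_real:
  fixes a b :: "'b \<Rightarrow> real"
  assumes "a summable_on A" "b summable_on A"
  shows "(\<Sum>\<^sub>\<infinity>x\<in>A. a x - b x) = infsum a A - infsum b A"
  using infsum_add[OF assms(1), of "\<lambda>x. - b x"] assms(2)
  by (simp add: infsum_uminus summable_on_uminus)

text \<open>
  \<open>D\<close> bounds the weighted degree including the killing term, so that both parts of the Laplacian,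
  multiplication by this degree and averaging over neighbours, have norm at most \<open>D\<close>.
\<close>

locale bounded_graph = weighted_lp p \<mu> for p :: real and \<mu> :: "'a::countable \<Rightarrow> real" +
  fixes w :: "'a \<Rightarrow> 'a \<Rightarrow> real" and \<kappa> :: "'a \<Rightarrow> real" and f :: "real \<Rightarrow> real" and D L :: real
  assumes graph: "weighted_graph w \<kappa> \<mu>"
    and degree: "\<And>x. ((\<Sum>\<^sub>\<infinity>y. w x y) + \<kappa> x) / \<mu> x \<le> D"
    and lipschitz: "L-lipschitz_on UNIV f" and f_zero: "f 0 = 0"
begin

lemma w_nonneg: "0 \<le> w x y" and w_sym: "w x y = w y x" and w_summable: "(\<lambda>y. w x y) summable_on UNIV"
  and kappa_nonneg: "0 \<le> \<kappa> x"
  using graph by (auto simp: weighted_graph_def)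

lemma D_nonneg: "0 \<le> D"
proof -
  have "0 \<le> ((\<Sum>\<^sub>\<infinity>y. w undefined y) + \<kappa> undefined) / \<mu> undefined"
    using mu_pos[of undefined] by (intro divide_nonneg_pos add_nonneg_nonneg infsum_nonneg w_nonneg kappa_nonneg)
  then show ?thesis using degree order_trans by blast
qed

lemma L_nonneg: "0 \<le> L" using lipschitz by (rule lipschitz_on_nonneg)

lemma finite_degree:
  assumes "finite G"
  shows "(\<Sum>y\<in>G. w x y) \<le> D * \<mu> x"
proof -
  have "(\<Sum>y\<in>G. w x y) \<le> (\<Sum>\<^sub>\<infinity>y. w x y)"
    using assms w_summable w_nonneg by (intro finite_sum_le_infsum) auto
  also have "\<dots> \<le> D * \<mu> x"
    using degree[of x] mu_pos[of x] kappa_nonneg[of x] by (simp add: field_simps)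
  finally show ?thesis .
qed

definition average :: "('a \<Rightarrow> real) \<Rightarrow> 'a \<Rightarrow> real" where
  "average u x = (\<Sum>\<^sub>\<infinity>y. w x y * u y) / \<mu> x"

text \<open>
  Jensen's inequality in \<open>y\<close> moves the power inside the average. Summing over \<open>x\<close> first, symmetry
  of \<open>w\<close> turns \<open>\<Sum>\<^sub>x w x y\<close> into the degree of \<open>y\<close>, at most \<open>D \<mu> y\<close>; this supplies the weight
  \<open>\<mu> y\<close> of the norm of \<open>u\<close>. Both sums are finite here because convergence of the inner one is itself
  a consequence of the bound.
\<close>

lemma finite_average_bound:
  assumes u: "u \<in> lp p \<mu>" and F: "finite F" and G: "finite G"
  shows "(\<Sum>x\<in>F. ((\<Sum>y\<in>G. w x y * \<bar>u y\<bar>) / \<mu> x) powr p * \<mu> x) \<le> (D * nrm u) powr p"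
proof -
  have DD: "D powr (p - 1) * D = D powr p"
    using powr_mult_base[OF D_nonneg, of "p - 1"] by (simp add: mult.commute)
  have one: "((\<Sum>y\<in>G. w x y * \<bar>u y\<bar>) / \<mu> x) powr p * \<mu> x
      \<le> D powr (p - 1) * (\<Sum>y\<in>G. w x y * \<bar>u y\<bar> powr p)" for x
  proof -
    have "(\<Sum>y\<in>G. w x y / \<mu> x * \<bar>u y\<bar>) powr p
        \<le> D powr (p - 1) * (\<Sum>y\<in>G. w x y / \<mu> x * \<bar>u y\<bar> powr p)"
      using finite_degree[OF G, of x] mu_pos[of x] w_nonneg G p_ge_1
      by (intro jensen_finite_sum_powr) (auto simp: less_imp_le field_simps simp flip: sum_divide_distrib)
    moreover have "(\<Sum>y\<in>G. w x y / \<mu> x * c y) = (\<Sum>y\<in>G. w x y * c y) / \<mu> x" for c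
      by (simp add: sum_divide_distrib)
    ultimately have "((\<Sum>y\<in>G. w x y * \<bar>u y\<bar>) / \<mu> x) powr p
        \<le> D powr (p - 1) * ((\<Sum>y\<in>G. w x y * \<bar>u y\<bar> powr p) / \<mu> x)" by simp
    then show ?thesis using mu_pos[of x] by (simp add: field_simps)
  qed
  have "(\<Sum>x\<in>F. ((\<Sum>y\<in>G. w x y * \<bar>u y\<bar>) / \<mu> x) powr p * \<mu> x)
      \<le> (\<Sum>x\<in>F. D powr (p - 1) * (\<Sum>y\<in>G. w x y * \<bar>u y\<bar> powr p))"
    by (intro sum_mono one)
  also have "\<dots> = D powr (p - 1) * (\<Sum>y\<in>G. \<bar>u y\<bar> powr p * (\<Sum>x\<in>F. w y x))"
  proof -
    have "(\<Sum>x\<in>F. \<Sum>y\<in>G. w x y * \<bar>u y\<bar> powr p) = (\<Sum>y\<in>G. \<bar>u y\<bar> powr p * (\<Sum>x\<in>F. w y x))"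
      by (subst sum.swap) (simp add: sum_distrib_left sum_distrib_right w_sym[of _ "_ :: 'a"] mult.commute)
    then show ?thesis by (simp flip: sum_distrib_left)
  qed
  also have "\<dots> \<le> D powr (p - 1) * (\<Sum>y\<in>G. \<bar>u y\<bar> powr p * (D * \<mu> y))"
    by (intro mult_left_mono sum_mono finite_degree F) auto
  also have "\<dots> = D powr p * (\<Sum>y\<in>G. \<bar>u y\<bar> powr p * \<mu> y)"
    unfolding DD[symmetric] by (simp add: sum_distrib_left mult_ac)
  also have "\<dots> \<le> D powr p * nrm u powr p"
    by (intro mult_left_mono lp_finite_sum_le u G) auto
  finally show ?thesis using D_nonneg by (simp add: powr_mult)
qed

lemma weighted_summable:
  assumes u: "u \<in> lp p \<mu>"
  shows "(\<lambda>y. w x y * \<bar>u y\<bar>) summable_on UNIV" "(\<lambda>y. w x y * u y) summable_on UNIV"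
proof -
  define B where "B = ((D * nrm u) powr p / \<mu> x) powr (1 / p) * \<mu> x"
  have "(\<Sum>y\<in>G. w x y * \<bar>u y\<bar>) \<le> B" if G: "finite G" for G
  proof -
    let ?S = "(\<Sum>y\<in>G. w x y * \<bar>u y\<bar>) / \<mu> x"
    have S0: "0 \<le> ?S" using mu_pos[of x] w_nonneg by (intro divide_nonneg_pos sum_nonneg) auto
    have "?S powr p \<le> (D * nrm u) powr p / \<mu> x"
      using finite_average_bound[OF u _ G, of "{x}"] mu_pos[of x] by (simp add: field_simps)
    then have "(?S powr p) powr (1 / p) \<le> ((D * nrm u) powr p / \<mu> x) powr (1 / p)"
      using p_pos by (intro powr_mono2) auto
    moreover have "(?S powr p) powr (1 / p) = ?S" using powr_powr[of ?S p "1 / p"] powr_one[OF S0] p_pos by simp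
    ultimately have "?S \<le> B / \<mu> x" using mu_pos[of x] by (simp add: B_def)
    then show ?thesis using mu_pos[of x] by (simp add: divide_le_cancel)
  qed
  then show s: "(\<lambda>y. w x y * \<bar>u y\<bar>) summable_on UNIV"
    using w_nonneg by (intro nonneg_bdd_above_summable_on) (auto intro!: bdd_aboveI2[where M = B])
  show "(\<lambda>y. w x y * u y) summable_on UNIV"
    by (rule abs_summable_summable) (use s w_nonneg in \<open>simp add: abs_mult\<close>)
qed

lemma average_lp:
  assumes u: "u \<in> lp p \<mu>"
  shows "average u \<in> lp p \<mu>" and "nrm (average u) \<le> D * nrm u"
proof -
  have "(\<Sum>x\<in>F. \<bar>average u x\<bar> powr p * \<mu> x) \<le> (D * nrm u) powr p" if F: "finite F" for F
  proof -
    let ?a = "\<lambda>x. (\<Sum>\<^sub>\<infinity>y. w x y * \<bar>u y\<bar>)"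
    have "(\<Sum>x\<in>F. (?a x / \<mu> x) powr p * \<mu> x) \<le> (D * nrm u) powr p"
    proof (rule tendsto_upperbound)
      have "((\<lambda>G. \<Sum>y\<in>G. w x y * \<bar>u y\<bar>) \<longlongrightarrow> ?a x) (finite_subsets_at_top UNIV)" for x
        using has_sum_infsum[OF weighted_summable(1)[OF u]] by (simp add: has_sum_def)
      then have "((\<lambda>G. ((\<Sum>y\<in>G. w x y * \<bar>u y\<bar>) / \<mu> x) powr p) \<longlongrightarrow> (?a x / \<mu> x) powr p) (finite_subsets_at_top UNIV)" for x
        using p_pos mu_pos[of x] w_nonneg
        by (intro tendsto_powr' tendsto_divide tendsto_const)
          (simp_all add: always_eventually sum_nonneg divide_nonneg_pos)
      then show "((\<lambda>G. \<Sum>x\<in>F. ((\<Sum>y\<in>G. w x y * \<bar>u y\<bar>) / \<mu> x) powr p * \<mu> x) \<longlongrightarrow>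
          (\<Sum>x\<in>F. (?a x / \<mu> x) powr p * \<mu> x)) (finite_subsets_at_top UNIV)"
        by (intro tendsto_sum tendsto_mult_right)
      show "\<forall>\<^sub>F G in finite_subsets_at_top UNIV.
          (\<Sum>x\<in>F. ((\<Sum>y\<in>G. w x y * \<bar>u y\<bar>) / \<mu> x) powr p * \<mu> x) \<le> (D * nrm u) powr p"
        using finite_average_bound[OF u F] by (intro eventually_finite_subsets_at_top_weakI) auto
    qed simp
    moreover have "(\<Sum>x\<in>F. \<bar>average u x\<bar> powr p * \<mu> x) \<le> (\<Sum>x\<in>F. (?a x / \<mu> x) powr p * \<mu> x)"
    proof (rule sum_mono)
      fix x
      show "\<bar>average u x\<bar> powr p * \<mu> x \<le> (?a x / \<mu> x) powr p * \<mu> x"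
      proof -
        have "\<bar>\<Sum>\<^sub>\<infinity>y. w x y * u y\<bar> \<le> (\<Sum>\<^sub>\<infinity>y. w x y * \<bar>u y\<bar>)"
          using norm_infsum_bound[of "\<lambda>y. w x y * u y" UNIV] weighted_summable(1)[OF u] w_nonneg
          by (simp add: abs_mult)
        then have "\<bar>average u x\<bar> \<le> ?a x / \<mu> x"
          using mu_pos[of x] by (simp add: average_def divide_right_mono less_imp_le)
        then show ?thesis using p_pos mu_pos[of x] by (intro mult_right_mono powr_mono2) auto
      qed
    qed
    ultimately show ?thesis by (rule order_trans[rotated])
  qed
  then show "average u \<in> lp p \<mu>" "nrm (average u) \<le> D * nrm u"
    using lp_leI[of "D * nrm u" "average u"] D_nonneg by auto
qed

lemma laplacian_eq:
  assumes u: "u \<in> lp p \<mu>"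
  shows "laplacian w \<kappa> \<mu> u = (\<lambda>x. ((\<Sum>\<^sub>\<infinity>y. w x y) + \<kappa> x) / \<mu> x * u x) - average u"
proof
  fix x
  have "(\<Sum>\<^sub>\<infinity>y. w x y * (u x - u y)) = (\<Sum>\<^sub>\<infinity>y. w x y * u x - w x y * u y)"
    by (simp add: right_diff_distrib)
  also have "\<dots> = (\<Sum>\<^sub>\<infinity>y. w x y * u x) - (\<Sum>\<^sub>\<infinity>y. w x y * u y)"
    by (intro infsum_diff_real summable_on_cmult_left w_summable weighted_summable(2) u)
  also have "(\<Sum>\<^sub>\<infinity>y. w x y * u x) = (\<Sum>\<^sub>\<infinity>y. w x y) * u x"
    by (intro infsum_cmult_left w_summable)
  finally have e: "(\<Sum>\<^sub>\<infinity>y. w x y * (u x - u y)) = (\<Sum>\<^sub>\<infinity>y. w x y) * u x - (\<Sum>\<^sub>\<infinity>y. w x y * u y)" .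
  show "laplacian w \<kappa> \<mu> u x = ((\<lambda>x. ((\<Sum>\<^sub>\<infinity>y. w x y) + \<kappa> x) / \<mu> x * u x) - average u) x"
    unfolding laplacian_def average_def fun_diff_def e
    by (simp add: add_divide_distrib diff_divide_distrib distrib_right)
qed

lemma laplacian_bounded:
  assumes u: "u \<in> lp p \<mu>"
  shows "laplacian w \<kappa> \<mu> u \<in> lp p \<mu>" and "nrm (laplacian w \<kappa> \<mu> u) \<le> 2 * D * nrm u"
proof -
  let ?d = "\<lambda>x. ((\<Sum>\<^sub>\<infinity>y. w x y) + \<kappa> x) / \<mu> x * u x"
  have "\<bar>?d x\<bar> \<le> D * \<bar>u x\<bar>" for x
  proof -
    have "0 \<le> ((\<Sum>\<^sub>\<infinity>y. w x y) + \<kappa> x) / \<mu> x"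
      using mu_pos[of x] by (intro divide_nonneg_pos add_nonneg_nonneg infsum_nonneg w_nonneg kappa_nonneg)
    then show ?thesis unfolding abs_mult using degree[of x] by (intro mult_right_mono) auto
  qed
  then have d: "?d \<in> lp p \<mu>" "nrm ?d \<le> D * nrm u"
    using lp_dominated[OF u D_nonneg, of ?d] by auto
  show "laplacian w \<kappa> \<mu> u \<in> lp p \<mu>"
    unfolding laplacian_eq[OF u] by (intro lp_diff d average_lp u)
  have "nrm (?d - average u) \<le> nrm ?d + nrm (average u)"
    by (intro lp_diff d average_lp u)
  also have "\<dots> \<le> 2 * D * nrm u" using d average_lp[OF u] by simp
  finally show "nrm (laplacian w \<kappa> \<mu> u) \<le> 2 * D * nrm u"
    unfolding laplacian_eq[OF u] .
qed

lemma laplacian_diff: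
  assumes "u \<in> lp p \<mu>" "v \<in> lp p \<mu>"
  shows "laplacian w \<kappa> \<mu> (u - v) = laplacian w \<kappa> \<mu> u - laplacian w \<kappa> \<mu> v"
proof -
  have "average (u - v) = average u - average v"
    using infsum_diff_real[OF weighted_summable(2)[OF assms(1)] weighted_summable(2)[OF assms(2)]]
    by (simp add: average_def fun_eq_iff right_diff_distrib diff_divide_distrib)
  then show ?thesis
    using assms lp_diff(1)[OF assms] by (simp add: laplacian_eq fun_eq_iff algebra_simps diff_divide_distrib add_divide_distrib)
qed

abbreviation "\<A> \<equiv> op_A f w \<kappa> \<mu>"

text \<open>
  The reaction term contributes \<open>L\<close> to the Lipschitz constant of the operator and the Laplacian
  \<open>2 D\<close>.
\<close>

definition K :: real where "K = L + 2 * D"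

lemma K_nonneg: "0 \<le> K" using L_nonneg D_nonneg by (simp add: K_def)

lemma
  assumes "u \<in> lp p \<mu>" "v \<in> lp p \<mu>"
  shows op_A_diff_lp: "\<A> u - \<A> v \<in> lp p \<mu>"
    and op_A_lipschitz: "nrm (\<A> u - \<A> v) \<le> K * nrm (u - v)"
proof -
  let ?F = "\<lambda>x. - (f (u x) - f (v x))"
  note uv = lp_diff(1)[OF assms]
  have "\<bar>?F x\<bar> \<le> L * \<bar>(u - v) x\<bar>" for x
    using lipschitz_onD[OF lipschitz, of "u x" "v x"] by (simp add: dist_real_def)
  then have F: "?F \<in> lp p \<mu>" "nrm ?F \<le> L * nrm (u - v)"
    using lp_dominated[OF uv L_nonneg, of ?F] by auto
  have eq: "\<A> u - \<A> v = ?F + laplacian w \<kappa> \<mu> (u - v)"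
    unfolding laplacian_diff[OF assms] by (simp add: op_A_def fun_eq_iff)
  show "\<A> u - \<A> v \<in> lp p \<mu>" unfolding eq by (intro lp_add F laplacian_bounded uv)
  have "nrm (?F + laplacian w \<kappa> \<mu> (u - v)) \<le> nrm ?F + nrm (laplacian w \<kappa> \<mu> (u - v))"
    by (intro lp_add F laplacian_bounded uv)
  also have "\<dots> \<le> K * nrm (u - v)"
    using F(2) laplacian_bounded(2)[OF uv] by (simp add: K_def algebra_simps)
  finally show "nrm (\<A> u - \<A> v) \<le> K * nrm (u - v)" unfolding eq .
qed

lemma op_A_zero: "\<A> 0 = 0"
  by (simp add: op_A_def laplacian_def f_zero fun_eq_iff)

lemma op_A_lp: "u \<in> lp p \<mu> \<Longrightarrow> \<A> u \<in> lp p \<mu>"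
  using op_A_diff_lp[of u 0] by (simp add: op_A_zero)

lemma dom_A_eq: "dom_A p f w \<kappa> \<mu> = lp p \<mu>"
  using op_A_lp weighted_summable(1) by (auto simp: dom_A_def dom_laplacian_def)

end


section \<open>Continuous and integrable functions on an interval\<close>

text \<open>
  Lebesgue measurable functions are almost everywhere limits of continuous ones; truncating
  to \<open>[0, 1]\<close> makes dominated convergence applicable.
\<close>

lemma indicator_approx_continuous:
  fixes A :: "real set" and a b e :: real
  assumes A: "A \<in> sets lebesgue" and e: "0 < e"
  obtains c :: "real \<Rightarrow> real" where "continuous_on UNIV c"
    "(\<integral>t. \<bar>indicator A t - c t\<bar> \<partial>lebesgue_on {a..b}) < e"
proof -
  have "(indicator A :: real \<Rightarrow> real) measurable_on UNIV"
    using A by (intro lebesgue_measurable_imp_measurable_on_real borel_measurable_indicator) auto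
  then obtain N g where N: "negligible N" and g: "\<And>n. continuous_on UNIV (g n)"
    and lim: "\<And>x. x \<notin> N \<Longrightarrow> (\<lambda>n. g n x) \<longlonglongrightarrow> (indicator A x :: real)"
    by (auto simp: measurable_on_def)
  define c where "c n x = max 0 (min 1 (g n x))" for n :: nat and x
  have cc: "continuous_on UNIV (c n)" for n
    unfolding c_def by (intro continuous_intros g)
  have clim: "(\<lambda>n. c n x) \<longlonglongrightarrow> indicator A x" if "x \<notin> N" for x
  proof -
    have "(\<lambda>n. c n x) \<longlonglongrightarrow> max 0 (min 1 (indicator A x))"
      unfolding c_def by (intro tendsto_intros lim that)
    then show ?thesis by (simp add: indicator_def split: if_splits)
  qed
  have ae: "AE x in lebesgue_on {a..b}. x \<notin> N"
    using N by (simp add: AE_restrict_space_iff negligible_iff_null_sets) (metis (mono_tags, lifting) AE_not_in eventually_mono)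
  have cm: "c n \<in> borel_measurable (lebesgue_on {a..b})" for n
    by (intro continuous_imp_measurable_on_sets_lebesgue continuous_on_subset[OF cc]) auto
  have Am: "(indicator A :: real \<Rightarrow> real) \<in> borel_measurable (lebesgue_on {a..b})"
    using A by (intro measurable_restrict_space1 borel_measurable_indicator)
  have "(\<lambda>n. \<integral>t. \<bar>indicator A t - c n t\<bar> \<partial>lebesgue_on {a..b}) \<longlonglongrightarrow> (\<integral>t. 0 \<partial>lebesgue_on {a..b})"
  proof (rule integral_dominated_convergence[where w = "\<lambda>_. 1"])
    show "AE x in lebesgue_on {a..b}. (\<lambda>n. \<bar>indicator A x - c n x\<bar>) \<longlonglongrightarrow> 0"
      using ae
    proof eventually_elim
      case (elim x)
      have "(\<lambda>n. \<bar>indicator A x - c n x\<bar>) \<longlonglongrightarrow> \<bar>indicator A x - indicator A x\<bar>"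
        by (intro tendsto_intros clim elim)
      then show ?case by simp
    qed
    show "AE x in lebesgue_on {a..b}. norm \<bar>indicator A x - c n x\<bar> \<le> 1" for n
      by (intro AE_I2) (auto simp: c_def indicator_def)
  qed (use cm Am in auto)
  then have "\<forall>\<^sub>F n in sequentially. (\<integral>t. \<bar>indicator A t - c n t\<bar> \<partial>lebesgue_on {a..b}) < e"
    using e by (intro order_tendstoD(2)) auto
  then obtain n where "(\<integral>t. \<bar>indicator A t - c n t\<bar> \<partial>lebesgue_on {a..b}) < e"
    by (auto simp: eventually_sequentially)
  with cc show thesis using that by blast
qed

lemma integral_singleton_lebesgue: "(\<integral>t. g t \<partial>lebesgue_on {a..a::real}) = (0::real)"
proof (cases "integrable (lebesgue_on {a..a}) g")
  case True
  then show ?thesis using integral_refl[of a g] by (simp add: lebesgue_integral_eq_integral)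
qed (simp add: not_integrable_integral_eq)

lemma integral_open_interval_lebesgue:
  fixes g :: "real \<Rightarrow> real"
  assumes "integrable (lebesgue_on {a..b}) g"
  shows "(\<integral>t. g t \<partial>lebesgue_on {a<..<b}) = (\<integral>t. g t \<partial>lebesgue_on {a..b})"
proof -
  have "integrable (lebesgue_on {a<..<b}) g"
    using assms set_integrable_subset[of lebesgue "{a..b}" g "{a<..<b}"]
    by (simp add: set_integrable_def integrable_restrict_space greaterThanLessThan_subseteq_atLeastAtMost_iff)
  then show ?thesis
    using assms by (simp add: lebesgue_integral_eq_integral integral_open_interval_real)
qed

lemma complete_lebesgue_ivl: "complete_measure (lebesgue_on {a..b::real})"
  by (intro complete_measure_lebesgue_on) auto

lemma finite_lebesgue_ivl: "finite_measure (lebesgue_on {a..b::real})"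
  by (intro finite_measure_lebesgue_on) auto

context weighted_lp
begin

lemma lp_cont_lp: "lp_continuous_on p \<mu> S u \<Longrightarrow> t \<in> S \<Longrightarrow> u t \<in> lp p \<mu>"
  by (simp add: lp_continuous_on_def)

lemma lp_continuous_on_subset: "lp_continuous_on p \<mu> S u \<Longrightarrow> A \<subseteq> S \<Longrightarrow> lp_continuous_on p \<mu> A u"
  unfolding lp_continuous_on_def by (blast intro: tendsto_within_subset)

lemma lp_continuous_lipschitz:
  assumes u: "lp_continuous_on p \<mu> S u" and v: "\<And>t. t \<in> S \<Longrightarrow> v t \<in> lp p \<mu>"
    and le: "\<And>s t. s \<in> S \<Longrightarrow> t \<in> S \<Longrightarrow> nrm (v s - v t) \<le> C * nrm (u s - u t)"
  shows "lp_continuous_on p \<mu> S v"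
  unfolding lp_continuous_on_def
proof (intro conjI ballI v)
  fix t assume t: "t \<in> S"
  show "((\<lambda>s. nrm (v s - v t)) \<longlongrightarrow> 0) (at t within S)"
  proof (rule tendsto_sandwich[OF _ _ tendsto_const])
    show "((\<lambda>s. C * nrm (u s - u t)) \<longlongrightarrow> 0) (at t within S)"
      using u t by (intro tendsto_mult_right_zero) (simp add: lp_continuous_on_def)
    show "\<forall>\<^sub>F s in at t within S. nrm (v s - v t) \<le> C * nrm (u s - u t)"
      using le t by (auto simp: eventually_at_filter)
  qed simp
qed

lemma
  assumes u: "lp_continuous_on p \<mu> S u" and v: "lp_continuous_on p \<mu> S v"
  shows lp_continuous_add: "lp_continuous_on p \<mu> S (\<lambda>t. u t + v t)"
    and lp_continuous_diff: "lp_continuous_on p \<mu> S (\<lambda>t. u t - v t)"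
proof -
  note ul = lp_cont_lp[OF u] and vl = lp_cont_lp[OF v]
  have lim: "((\<lambda>s. nrm (u s - u t) + nrm (v s - v t)) \<longlongrightarrow> 0) (at t within S)" if "t \<in> S" for t
    using tendsto_add_zero u v that unfolding lp_continuous_on_def by blast
  have "nrm ((u s + v s) - (u t + v t)) \<le> nrm (u s - u t) + nrm (v s - v t)"
    "nrm ((u s - v s) - (u t - v t)) \<le> nrm (u s - u t) + nrm (v s - v t)" if "s \<in> S" "t \<in> S" for s t
    using lp_add(2)[of "u s - u t" "v s - v t"] lp_diff(2)[of "u s - u t" "v s - v t"] lp_diff(1) ul vl that
    by (simp_all add: algebra_simps)
  then have le: "\<forall>\<^sub>F s in at t within S. nrm ((u s + v s) - (u t + v t)) \<le> nrm (u s - u t) + nrm (v s - v t)"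
    "\<forall>\<^sub>F s in at t within S. nrm ((u s - v s) - (u t - v t)) \<le> nrm (u s - u t) + nrm (v s - v t)"
    if "t \<in> S" for t using that by (auto simp: eventually_at_filter)
  show "lp_continuous_on p \<mu> S (\<lambda>t. u t + v t)"
    unfolding lp_continuous_on_def
    using tendsto_sandwich[OF always_eventually le(1) tendsto_const lim] lp_add(1) ul vl by simp
  show "lp_continuous_on p \<mu> S (\<lambda>t. u t - v t)"
    unfolding lp_continuous_on_def
    using tendsto_sandwich[OF always_eventually le(2) tendsto_const lim] lp_diff(1) ul vl by simp
qed

lemma lp_continuous_const: "c \<in> lp p \<mu> \<Longrightarrow> lp_continuous_on p \<mu> S (\<lambda>_. c)"
  by (simp add: lp_continuous_on_def)

lemma lp_continuous_scaleR_const: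
  assumes c: "continuous_on S c" and v: "v \<in> lp p \<mu>"
  shows "lp_continuous_on p \<mu> S (\<lambda>t. c t *\<^sub>R v)"
  unfolding lp_continuous_on_def
proof (intro conjI ballI lp_scaleR v)
  fix t assume t: "t \<in> S"
  have "((\<lambda>s. \<bar>c s - c t\<bar> * nrm v) \<longlongrightarrow> \<bar>c t - c t\<bar> * nrm v) (at t within S)"
    using c t by (intro tendsto_intros) (simp add: continuous_on_def)
  moreover have "nrm (c s *\<^sub>R v - c t *\<^sub>R v) = \<bar>c s - c t\<bar> * nrm v" for s
    using lp_norm_scaleR[OF v, of "c s - c t"] by (simp add: scaleR_left_diff_distrib)
  ultimately show "((\<lambda>s. nrm (c s *\<^sub>R v - c t *\<^sub>R v)) \<longlongrightarrow> 0) (at t within S)" by simp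
qed

lemma lp_continuous_sum:
  assumes "finite A" "\<And>i. i \<in> A \<Longrightarrow> lp_continuous_on p \<mu> S (u i)"
  shows "lp_continuous_on p \<mu> S (\<lambda>t. \<Sum>i\<in>A. u i t)"
  using assms
proof (induction A rule: finite_induct)
  case empty
  show ?case using lp_continuous_const[OF lp_zero(1)] by (simp add: zero_fun_def)
next
  case (insert i A)
  then have "lp_continuous_on p \<mu> S (\<lambda>t. u i t + (\<Sum>i\<in>A. u i t))"
    by (intro lp_continuous_add) auto
  then show ?case unfolding sum.insert[OF insert.hyps(1,2)] .
qed

lemma lp_continuous_coord:
  assumes u: "lp_continuous_on p \<mu> S u"
  shows "continuous_on S (\<lambda>t. u t x)"
  unfolding continuous_on_def
proof
  fix t assume t: "t \<in> S"
  show "((\<lambda>t. u t x) \<longlongrightarrow> u t x) (at t within S)"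
  proof (rule lp_tendsto_coord)
    show "\<forall>\<^sub>F n in at t within S. u n \<in> lp p \<mu>"
      using lp_cont_lp[OF u] by (auto simp: eventually_at_filter)
    show "((\<lambda>s. nrm (u s - u t)) \<longlongrightarrow> 0) (at t within S)" using u t by (simp add: lp_continuous_on_def)
  qed (rule lp_cont_lp[OF u t])
qed

lemma lp_continuous_norm:
  assumes u: "lp_continuous_on p \<mu> S u"
  shows "continuous_on S (\<lambda>t. nrm (u t))"
  unfolding continuous_on_def
proof
  fix t assume t: "t \<in> S"
  have "((\<lambda>s. nrm (u s) - nrm (u t)) \<longlongrightarrow> 0) (at t within S)"
  proof (rule Lim_null_comparison)
    show "((\<lambda>s. nrm (u s - u t)) \<longlongrightarrow> 0) (at t within S)" using u t by (simp add: lp_continuous_on_def)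
    show "\<forall>\<^sub>F s in at t within S. norm (nrm (u s) - nrm (u t)) \<le> nrm (u s - u t)"
      using lp_norm_triangle_diff[OF lp_cont_lp[OF u] lp_cont_lp[OF u t]] by (auto simp: eventually_at_filter)
  qed
  then show "((\<lambda>t. nrm (u t)) \<longlongrightarrow> nrm (u t)) (at t within S)" by (simp add: LIM_zero_iff)
qed

text \<open>
  The Heine--Cantor theorem is applied to the real function \<open>(s, t) \<mapsto> \<parallel>u s - u t\<parallel>\<close> on the
  square, which vanishes on the diagonal.
\<close>

lemma lp_uniformly_continuous:
  assumes u: "lp_continuous_on p \<mu> {a..b} u" and e: "0 < e"
  obtains d where "0 < d" "\<And>s t. s \<in> {a..b} \<Longrightarrow> t \<in> {a..b} \<Longrightarrow> \<bar>s - t\<bar> < d \<Longrightarrow> nrm (u s - u t) < e"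
proof -
  let ?\<phi> = "\<lambda>z. nrm (u (fst z) - u (snd z))"
  have "continuous_on ({a..b} \<times> {a..b}) ?\<phi>"
    unfolding continuous_on_def
  proof
    fix z assume z: "z \<in> {a..b} \<times> {a..b}"
    let ?F = "at z within {a..b} \<times> {a..b}"
    have c: "((\<lambda>z'. nrm (u (g z') - u (g z))) \<longlongrightarrow> 0) ?F"
      if g: "continuous_on ({a..b} \<times> {a..b}) g" "g ` ({a..b} \<times> {a..b}) \<subseteq> {a..b}" for g
    proof -
      have gz: "g z \<in> {a..b}" using g z by blast
      have "lp_continuous_on p \<mu> {a..b} (\<lambda>s. u s - u (g z))"
        by (intro lp_continuous_diff u lp_continuous_const lp_cont_lp[OF u] gz)
      then have "continuous_on ({a..b} \<times> {a..b}) (\<lambda>z'. nrm (u (g z') - u (g z)))"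
        using continuous_on_compose2[OF lp_continuous_norm g] by blast
      then have "((\<lambda>z'. nrm (u (g z') - u (g z))) \<longlongrightarrow> nrm (u (g z) - u (g z))) ?F"
        using z unfolding continuous_on_def by blast
      then show ?thesis by simp
    qed
    have "((\<lambda>z'. ?\<phi> z' - ?\<phi> z) \<longlongrightarrow> 0) ?F"
    proof (rule Lim_null_comparison)
      show "((\<lambda>z'. nrm (u (fst z') - u (fst z)) + nrm (u (snd z') - u (snd z))) \<longlongrightarrow> 0) ?F"
        by (rule tendsto_add_zero; rule c) (auto intro!: continuous_intros)
      have "norm (?\<phi> z' - ?\<phi> z) \<le> nrm (u (fst z') - u (fst z)) + nrm (u (snd z') - u (snd z))"
        if "z' \<in> {a..b} \<times> {a..b}" for z'
      proof -
        have l: "u (fst z') \<in> lp p \<mu>" "u (snd z') \<in> lp p \<mu>" "u (fst z) \<in> lp p \<mu>" "u (snd z) \<in> lp p \<mu>"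
          using lp_cont_lp[OF u] z that by auto
        have "norm (?\<phi> z' - ?\<phi> z) \<le> nrm ((u (fst z') - u (snd z')) - (u (fst z) - u (snd z)))"
          using lp_norm_triangle_diff[OF lp_diff(1)[OF l(1,2)] lp_diff(1)[OF l(3,4)]] by simp
        also have "\<dots> = nrm ((u (fst z') - u (fst z)) - (u (snd z') - u (snd z)))"
          by (simp add: algebra_simps)
        also have "\<dots> \<le> nrm (u (fst z') - u (fst z)) + nrm (u (snd z') - u (snd z))"
          by (intro lp_diff l)
        finally show ?thesis .
      qed
      then show "\<forall>\<^sub>F z' in ?F. norm (?\<phi> z' - ?\<phi> z) \<le> nrm (u (fst z') - u (fst z)) + nrm (u (snd z') - u (snd z))"
        by (auto simp: eventually_at_filter)
    qed
    then show "(?\<phi> \<longlongrightarrow> ?\<phi> z) ?F" by (simp add: LIM_zero_iff)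
  qed
  then have "uniformly_continuous_on ({a..b} \<times> {a..b}) ?\<phi>"
    by (intro compact_uniformly_continuous compact_Times) auto
  then obtain d where d: "0 < d" "\<And>z z'. z \<in> {a..b} \<times> {a..b} \<Longrightarrow> z' \<in> {a..b} \<times> {a..b} \<Longrightarrow>
      dist z' z < d \<Longrightarrow> dist (?\<phi> z') (?\<phi> z) < e"
    using e unfolding uniformly_continuous_on_def by meson
  show thesis
  proof (rule that[OF d(1)])
    fix s t assume "s \<in> {a..b}" "t \<in> {a..b}" "\<bar>s - t\<bar> < d"
    then show "nrm (u s - u t) < e"
      using d(2)[of "(t, t)" "(s, t)"] by (simp add: dist_Pair_Pair dist_real_def)
  qed
qed

lemma lp_L1_subset:
  assumes g: "lp_L1 (lebesgue_on S) g" and A: "A \<subseteq> S" "A \<in> sets lebesgue" and S: "S \<in> sets lebesgue"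
  shows "lp_L1 (lebesgue_on A) g"
proof -
  have "(\<integral>\<^sup>+t. ennreal (nrm (g t)) \<partial>lebesgue_on A) \<le> (\<integral>\<^sup>+t. ennreal (nrm (g t)) \<partial>lebesgue_on S)"
    using A S by (simp add: nn_integral_restrict_space) (intro nn_integral_mono, auto split: split_indicator)
  also have "\<dots> < \<infinity>" using g by (simp add: lp_L1_def)
  finally show ?thesis
    using g A by (auto simp: lp_L1_def intro: measurable_restrict_mono)
qed

lemma lp_L1_subinterval:
  "lp_L1 (lebesgue_on {a..b}) g \<Longrightarrow> {c..d} \<subseteq> {a..b} \<Longrightarrow> lp_L1 (lebesgue_on {c..d :: real}) g"
  by (rule lp_L1_subset) auto

lemma lp_continuous_imp_L1:
  assumes u: "lp_continuous_on p \<mu> {a..b} u"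
  shows "lp_L1 (lebesgue_on {a..b}) u"
proof -
  have "integrable (lebesgue_on {a..b}) (\<lambda>t. nrm (u t))"
    by (intro continuous_imp_integrable_real lp_continuous_norm u)
  then have "(\<integral>\<^sup>+t. ennreal (nrm (u t)) \<partial>lebesgue_on {a..b}) < \<infinity>"
    by (simp add: integrable_iff_bounded)
  then show ?thesis
    using lp_cont_lp[OF u] lp_continuous_coord[OF u]
    by (auto simp: lp_L1_def intro!: continuous_imp_measurable_on_sets_lebesgue)
qed

text \<open>
  The Bochner integral over an interval, by \<open>lp_integral_eq_coord_integral\<close>.
\<close>

definition coord_integral :: "real \<Rightarrow> real \<Rightarrow> (real \<Rightarrow> 'a \<Rightarrow> real) \<Rightarrow> 'a \<Rightarrow> real" where
  "coord_integral a b g = (\<lambda>x. \<integral>t. g t x \<partial>lebesgue_on {a..b})"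

lemma coord_integral_lp:
  assumes "lp_L1 (lebesgue_on {a..b}) g"
  shows "coord_integral a b g \<in> lp p \<mu>" and "nrm (coord_integral a b g) \<le> (\<integral>t. nrm (g t) \<partial>lebesgue_on {a..b})"
  unfolding coord_integral_def using lp_minkowski_integral[OF assms] by auto

lemma lp_integral_eq_coord_integral:
  "lp_L1 (lebesgue_on {a..b}) g \<Longrightarrow> lp_integral p \<mu> (lebesgue_on {a..b}) g = coord_integral a b g"
  unfolding coord_integral_def by (intro lp_integral_coord finite_lebesgue_ivl complete_lebesgue_ivl)

lemma lp_integrable_ivl: "lp_integrable p \<mu> (lebesgue_on {a..b}) g \<longleftrightarrow> lp_L1 (lebesgue_on {a..b}) g"
  by (intro lp_integrable_iff finite_lebesgue_ivl complete_lebesgue_ivl)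

lemma coord_integral_combine:
  assumes "lp_L1 (lebesgue_on {a..c}) g" "a \<le> b" "b \<le> c"
  shows "coord_integral a c g = coord_integral a b g + coord_integral b c g"
  using Equivalence_Measurable_On_Borel.integral_combine[OF lp_L1_coord[OF assms(1)] assms(2,3)]
  by (simp add: coord_integral_def fun_eq_iff)

lemma coord_integral_diff:
  assumes "lp_L1 (lebesgue_on {a..b}) f" "lp_L1 (lebesgue_on {a..b}) g"
  shows "coord_integral a b (\<lambda>t. f t - g t) = coord_integral a b f - coord_integral a b g"
  using lp_L1_coord[OF assms(1)] lp_L1_coord[OF assms(2)] by (simp add: coord_integral_def fun_eq_iff)

lemma coord_integral_const: "a \<le> b \<Longrightarrow> coord_integral a b (\<lambda>_. c) = (b - a) *\<^sub>R c"
  by (simp add: coord_integral_def fun_eq_iff measure_restrict_space)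

lemma lp_L1_const: "c \<in> lp p \<mu> \<Longrightarrow> lp_L1 (lebesgue_on {a..b::real}) (\<lambda>_. c)"
  by (intro lp_continuous_imp_L1 lp_continuous_const)

lemma coord_integral_empty [simp]: "coord_integral a a g = 0"
  by (simp add: coord_integral_def fun_eq_iff integral_singleton_lebesgue del: atLeastAtMost_singleton)

lemma lp_continuous_coord_integral:
  assumes g: "lp_L1 (lebesgue_on {a..b}) g"
  shows "lp_continuous_on p \<mu> {a..b} (\<lambda>t. coord_integral a t g)"
proof -
  let ?N = "\<lambda>t. \<integral>s. nrm (g s) \<partial>lebesgue_on {a..t}"
  have le: "nrm (coord_integral a t g - coord_integral a s g) \<le> \<bar>?N t - ?N s\<bar>" if st: "a \<le> s" "s \<le> t" "t \<le> b" for s t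
  proof -
    have at: "lp_L1 (lebesgue_on {a..t}) g" and stL: "lp_L1 (lebesgue_on {s..t}) g"
      using st by (auto intro!: lp_L1_subinterval[OF g])
    have "coord_integral a t g - coord_integral a s g = coord_integral s t g" using coord_integral_combine[OF at st(1,2)] by simp
    moreover have "?N t = ?N s + (\<integral>r. nrm (g r) \<partial>lebesgue_on {s..t})"
      by (rule Equivalence_Measurable_On_Borel.integral_combine[OF lp_L1_norm(1)[OF at] st(1,2)])
    ultimately show ?thesis using coord_integral_lp(2)[OF stL] by simp
  qed
  have le': "nrm (coord_integral a t g - coord_integral a s g) \<le> \<bar>?N t - ?N s\<bar>" if "s \<in> {a..b}" "t \<in> {a..b}" for s t
    using le[of s t] le[of t s] that by (cases "s \<le> t") (auto simp: lp_norm_commute abs_minus_commute)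
  have cont: "continuous_on {a..b} ?N"
    by (intro indefinite_integral_continuous_real lp_L1_norm(1) g)
  show ?thesis
    unfolding lp_continuous_on_def
  proof (intro conjI ballI)
    show "coord_integral a t g \<in> lp p \<mu>" if "t \<in> {a..b}" for t
      using that by (intro coord_integral_lp(1) lp_L1_subinterval[OF g]) auto
    fix t assume t: "t \<in> {a..b}"
    show "((\<lambda>s. nrm (coord_integral a s g - coord_integral a t g)) \<longlongrightarrow> 0) (at t within {a..b})"
    proof (rule tendsto_sandwich[OF _ _ tendsto_const])
      have "((\<lambda>s. \<bar>?N s - ?N t\<bar>) \<longlongrightarrow> \<bar>?N t - ?N t\<bar>) (at t within {a..b})"
        using cont t by (intro tendsto_intros) (simp add: continuous_on_def)
      then show "((\<lambda>s. \<bar>?N s - ?N t\<bar>) \<longlongrightarrow> 0) (at t within {a..b})" by simp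
      show "\<forall>\<^sub>F s in at t within {a..b}. nrm (coord_integral a s g - coord_integral a t g) \<le> \<bar>?N s - ?N t\<bar>"
        using le'[OF t] by (auto simp: eventually_at_filter)
    qed simp
  qed
qed

lemma lp_continuous_uniform_limit:
  assumes un: "\<And>n::nat. lp_continuous_on p \<mu> S (un n)" and u: "\<And>t. t \<in> S \<Longrightarrow> u t \<in> lp p \<mu>"
    and lim: "\<And>n t. t \<in> S \<Longrightarrow> nrm (u t - un n t) \<le> B n" and B: "B \<longlonglongrightarrow> 0"
  shows "lp_continuous_on p \<mu> S u"
  unfolding lp_continuous_on_def
proof (intro conjI ballI u)
  fix t assume t: "t \<in> S"
  show "((\<lambda>s. nrm (u s - u t)) \<longlongrightarrow> 0) (at t within S)"
  proof (rule tendstoI)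
    fix e :: real assume e: "0 < e"
    then have "\<forall>\<^sub>F n in sequentially. B n < e / 3" by (intro order_tendstoD(2)[OF B]) auto
    then obtain n where n: "B n < e / 3" by (auto simp: eventually_sequentially)
    have "((\<lambda>s. nrm (un n s - un n t)) \<longlongrightarrow> 0) (at t within S)"
      using un t by (simp add: lp_continuous_on_def)
    then have "\<forall>\<^sub>F s in at t within S. nrm (un n s - un n t) < e / 3"
      using e by (intro order_tendstoD(2)) auto
    moreover have "\<forall>\<^sub>F s in at t within S. s \<in> S" by (auto simp: eventually_at_filter)
    ultimately show "\<forall>\<^sub>F s in at t within S. dist (nrm (u s - u t)) 0 < e"
    proof eventually_elim
      case (elim s)
      have "nrm (u s - u t) \<le> nrm (u s - un n s) + nrm (un n s - u t)"
        by (intro lp_triangle u lp_cont_lp[OF un] elim t)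
      moreover have "nrm (un n s - u t) \<le> nrm (un n s - un n t) + nrm (un n t - u t)"
        by (intro lp_triangle u lp_cont_lp[OF un] elim t)
      moreover have "nrm (un n t - u t) \<le> B n" using lim[OF t, of n] lp_norm_commute by metis
      ultimately have "nrm (u s - u t) < e" using lim[OF elim(2), of n] n elim(1) by linarith
      then show ?case by simp
    qed
  qed
qed

lemma lp_L1_scaleR:
  assumes g: "lp_L1 (lebesgue_on {a..b}) g" and \<phi>: "continuous_on {a..b} (\<phi> :: real \<Rightarrow> real)"
  shows "lp_L1 (lebesgue_on {a..b}) (\<lambda>t. \<phi> t *\<^sub>R g t)"
proof -
  obtain B where "\<forall>y\<in>\<phi> ` {a..b}. norm y \<le> B"
    using compact_imp_bounded[OF compact_continuous_image[OF \<phi> compact_Icc]]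
    unfolding bounded_iff by blast
  then have B: "\<bar>\<phi> t\<bar> \<le> B" if "t \<in> {a..b}" for t using that by auto
  have gl: "g t \<in> lp p \<mu>" if "t \<in> {a..b}" for t using g that by (simp add: lp_L1_def)
  have \<phi>m: "\<phi> \<in> borel_measurable (lebesgue_on {a..b})"
    by (intro continuous_imp_measurable_on_sets_lebesgue \<phi>) auto
  show ?thesis
  proof (rule lp_L1_dominated[OF g, where c = B])
    show "(\<lambda>t. (\<phi> t *\<^sub>R g t) x) \<in> borel_measurable (lebesgue_on {a..b})" for x
      using g \<phi>m by (auto simp: lp_L1_def intro!: borel_measurable_times)
    show "nrm (\<phi> t *\<^sub>R g t) \<le> B * nrm (g t)" if "t \<in> space (lebesgue_on {a..b})" for t
      using B[of t] gl[of t] that by (simp add: lp_norm_scaleR mult_right_mono)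
  qed (simp_all add: lp_scaleR gl)
qed

text \<open>
  The mean value estimate behind differentiability of primitives.
\<close>

lemma average_close:
  assumes ab: "a < b" and g: "lp_L1 (lebesgue_on {a..b}) g" and c: "c \<in> lp p \<mu>"
    and le: "\<And>r. r \<in> {a..b} \<Longrightarrow> nrm (g r - c) \<le> e"
  shows "nrm ((1 / (b - a)) *\<^sub>R coord_integral a b g - c) \<le> e"
proof -
  have L1: "lp_L1 (lebesgue_on {a..b}) (\<lambda>r. g r - c)" by (intro lp_L1_diff g lp_L1_const c)
  have "coord_integral a b (\<lambda>r. g r - c) = coord_integral a b g - (b - a) *\<^sub>R c"
    using ab by (simp add: coord_integral_diff[OF g lp_L1_const[OF c]] coord_integral_const)
  then have eq: "(1 / (b - a)) *\<^sub>R coord_integral a b g - c = (1 / (b - a)) *\<^sub>R coord_integral a b (\<lambda>r. g r - c)"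
    using ab by (simp add: scaleR_diff_right)
  have "nrm (coord_integral a b (\<lambda>r. g r - c)) \<le> (\<integral>r. nrm (g r - c) \<partial>lebesgue_on {a..b})" by (rule coord_integral_lp(2)[OF L1])
  also have "\<dots> \<le> (\<integral>r. e \<partial>lebesgue_on {a..b})"
    using le by (intro integral_mono lp_L1_norm(1) L1) auto
  also have "\<dots> = (b - a) * e" using ab by (simp add: measure_restrict_space)
  finally have "nrm (coord_integral a b (\<lambda>r. g r - c)) \<le> (b - a) * e" .
  then show ?thesis
    unfolding eq lp_norm_scaleR[OF coord_integral_lp(1)[OF L1]] using ab by (simp add: field_simps)
qed

text \<open>
  A simple function close to \<open>g\<close> in mean has finitely many values; the indicator function of the set
  where it takes the value \<open>v\<close> is replaced by a continuous function within \<open>\<eta> v\<close>.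
\<close>

lemma continuous_dense_L1:
  assumes g: "lp_L1 (lebesgue_on {a..b}) g" and e: "0 < e"
  obtains c where "lp_continuous_on p \<mu> {a..b} c" "(\<integral>t. nrm (g t - c t) \<partial>lebesgue_on {a..b}) < e"
proof -
  let ?M = "lebesgue_on {a..b}"
  have "\<exists>s. (\<forall>i::nat. Bochner_Integration.simple_bochner_integrable ?M (s i) \<and> s i ` space ?M \<subseteq> lp p \<mu>) \<and>
      (\<lambda>i. \<integral>\<^sup>+t. ennreal (nrm (g t - s i t)) \<partial>?M) \<longlonglongrightarrow> 0 \<and>
      (\<lambda>i. nrm (Bochner_Integration.simple_bochner_integral ?M (s i) - (\<lambda>x. \<integral>t. g t x \<partial>?M))) \<longlonglongrightarrow> 0"
    using lp_L1_imp_has_integral[OF finite_lebesgue_ivl g] unfolding lp_has_integral_def by (elim conjE)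
  then obtain si where si': "\<forall>i::nat. Bochner_Integration.simple_bochner_integrable ?M (si i) \<and> si i ` space ?M \<subseteq> lp p \<mu>"
    and si_lim: "(\<lambda>i. \<integral>\<^sup>+t. ennreal (nrm (g t - si i t)) \<partial>?M) \<longlonglongrightarrow> 0" by (elim exE conjE)
  have "\<forall>\<^sub>F i in sequentially. (\<integral>\<^sup>+t. ennreal (nrm (g t - si i t)) \<partial>?M) < ennreal (e / 2)"
    using e by (intro order_tendstoD(2)[OF si_lim]) auto
  then obtain i where i: "(\<integral>\<^sup>+t. ennreal (nrm (g t - si i t)) \<partial>?M) < ennreal (e / 2)"
    by (auto simp: eventually_sequentially)
  define s where "s = si i"
  have sb: "Bochner_Integration.simple_bochner_integrable ?M s" and sl: "s ` {a..b} \<subseteq> lp p \<mu>"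
    using si' by (auto simp: s_def)
  have sf: "simple_function ?M s" using sb by (simp add: simple_bochner_integrable.simps)
  have fin: "finite (s ` {a..b})" using sf by (simp add: simple_function_def)
  have sL1: "lp_L1 ?M s" using sl by (intro lp_L1_simple sb) simp
  let ?V = "s ` {a..b}"
  define A where "A v = s -` {v} \<inter> {a..b}" for v
  have A: "A v \<in> sets lebesgue" for v
  proof -
    have "s -` {v} \<inter> space ?M \<in> sets ?M" by (rule simple_functionD(2)[OF sf])
    then show ?thesis by (simp add: A_def sets_restrict_space_iff)
  qed
  \<comment> \<open>The errors \<open>\<eta> v * nrm v\<close> add up to at most \<open>e / 2\<close>; adding one keeps the factors nonzero.\<close>
  define \<eta> where "\<eta> v = e / (2 * (1 + real (card ?V)) * (1 + nrm v))" for v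
  have \<eta>: "0 < \<eta> v" for v
    unfolding \<eta>_def using e lp_norm_nonneg[of v] by (intro divide_pos_pos mult_pos_pos) linarith+
  have "\<exists>c. continuous_on UNIV c \<and> (\<integral>t. \<bar>indicator (A v) t - c t\<bar> \<partial>?M) < \<eta> v" for v
    using indicator_approx_continuous[OF A \<eta>] by metis
  then obtain c where c: "\<And>v. continuous_on UNIV (c v)"
    "\<And>v. (\<integral>t. \<bar>indicator (A v) t - c v t\<bar> \<partial>?M) < \<eta> v" by metis
  define C where "C t = (\<Sum>v\<in>?V. c v t *\<^sub>R v)" for t
  have C: "lp_continuous_on p \<mu> {a..b} C"
    unfolding C_def using sl
    by (intro lp_continuous_sum fin lp_continuous_scaleR_const continuous_on_subset[OF c(1)]) auto
  have CL1: "lp_L1 ?M C" by (rule lp_continuous_imp_L1[OF C])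
  have int: "integrable ?M (\<lambda>t. \<bar>indicator (A v) t - c v t\<bar>)" for v
  proof (intro integrable_abs Bochner_Integration.integrable_diff)
    show "integrable ?M (c v)" by (intro continuous_imp_integrable_real continuous_on_subset[OF c(1)]) auto
    interpret finite_measure ?M by (rule finite_lebesgue_ivl)
    show "integrable ?M (indicator (A v) :: real \<Rightarrow> real)"
    proof (rule integrable_const_bound[where B = 1])
      show "(indicator (A v) :: real \<Rightarrow> real) \<in> borel_measurable ?M"
        using A by (intro measurable_restrict_space1 borel_measurable_indicator)
    qed (auto simp: indicator_def)
  qed
  have pt: "nrm (s t - C t) \<le> (\<Sum>v\<in>?V. \<bar>indicator (A v) t - c v t\<bar> * nrm v)" if t: "t \<in> {a..b}" for t
  proof -
    have "(\<Sum>v\<in>?V. indicator (A v) t *\<^sub>R v) = (\<Sum>v\<in>?V. if v = s t then v else 0)"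
      using t by (intro sum.cong) (auto simp: A_def indicator_def)
    also have "\<dots> = s t" using fin t by simp
    finally have eq: "s t - C t = (\<Sum>v\<in>?V. (indicator (A v) t - c v t) *\<^sub>R v)"
      by (simp add: C_def scaleR_left_diff_distrib sum_subtractf)
    have "nrm (s t - C t) \<le> (\<Sum>v\<in>?V. nrm ((indicator (A v) t - c v t) *\<^sub>R v))"
      unfolding eq using sl by (intro lp_sum fin lp_scaleR) auto
    also have "\<dots> = (\<Sum>v\<in>?V. \<bar>indicator (A v) t - c v t\<bar> * nrm v)"
      using sl by (intro sum.cong lp_norm_scaleR) auto
    finally show ?thesis .
  qed
  have "(\<integral>t. nrm (s t - C t) \<partial>?M) \<le> (\<integral>t. (\<Sum>v\<in>?V. \<bar>indicator (A v) t - c v t\<bar> * nrm v) \<partial>?M)"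
    using pt by (intro integral_mono lp_L1_norm(1) lp_L1_diff sL1 CL1
      Bochner_Integration.integrable_sum integrable_mult_left int) auto
  also have "\<dots> = (\<Sum>v\<in>?V. (\<integral>t. \<bar>indicator (A v) t - c v t\<bar> \<partial>?M) * nrm v)"
    using int by (subst Bochner_Integration.integral_sum) auto
  also have "\<dots> \<le> (\<Sum>v\<in>?V. e / (2 * (1 + real (card ?V))))"
  proof (rule sum_mono)
    fix v assume "v \<in> ?V"
    have "(\<integral>t. \<bar>indicator (A v) t - c v t\<bar> \<partial>?M) * nrm v \<le> \<eta> v * (1 + nrm v)"
      using c(2)[of v] \<eta>[of v] by (intro mult_mono) auto
    also have "\<dots> = e / (2 * (1 + real (card ?V)))"
      using lp_norm_nonneg[of v] unfolding \<eta>_def by (simp add: add_nonneg_eq_0_iff)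
    finally show "(\<integral>t. \<bar>indicator (A v) t - c v t\<bar> \<partial>?M) * nrm v \<le> e / (2 * (1 + real (card ?V)))" .
  qed
  also have "\<dots> \<le> e / 2" using e by (simp add: field_simps)
  finally have sC: "(\<integral>t. nrm (s t - C t) \<partial>?M) \<le> e / 2" .
  have "ennreal (\<integral>t. nrm (g t - s t) \<partial>?M) < ennreal (e / 2)"
    using i lp_L1_norm(2)[OF lp_L1_diff[OF g sL1]] by (simp add: s_def)
  then have gs: "(\<integral>t. nrm (g t - s t) \<partial>?M) < e / 2"
    by (subst (asm) ennreal_less_iff) auto
  have "(\<integral>t. nrm (g t - C t) \<partial>?M) \<le> (\<integral>t. nrm (g t - s t) + nrm (s t - C t) \<partial>?M)"
    using g sL1 CL1
    by (intro integral_mono Bochner_Integration.integrable_add lp_L1_norm(1) lp_L1_diff lp_triangle)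
      (auto simp: lp_L1_def)
  also have "\<dots> = (\<integral>t. nrm (g t - s t) \<partial>?M) + (\<integral>t. nrm (s t - C t) \<partial>?M)"
    by (intro Bochner_Integration.integral_add lp_L1_norm(1) lp_L1_diff g sL1 CL1)
  also have "\<dots> < e" using gs sC by simp
  finally show thesis using that C by blast
qed

end


section \<open>Integration by parts\<close>

text \<open>
  \<open>U\<close> is a primitive of a merely integrable \<open>V\<close>, hence differentiable only almost everywhere. The
  identity is therefore obtained from Fubini's theorem for \<open>\<phi>'(t) V(s)\<close> on the triangle \<open>s \<le> t\<close>:
  integrating in \<open>s\<close> first produces \<open>U\<close>, integrating in \<open>t\<close> first produces
  \<open>\<phi>(b) - \<phi>(s) = - \<phi>(s)\<close>.
\<close>

lemma integration_by_parts_test_function: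
  fixes V :: "real \<Rightarrow> real" and a b c :: real
  assumes V: "integrable (lebesgue_on {a..b}) V" and \<phi>: "test_function a b \<phi>" and ab: "a \<le> b"
    and U: "\<And>t. t \<in> {a..b} \<Longrightarrow> U t = c + (\<integral>s. V s \<partial>lebesgue_on {a..t})"
  shows "(\<integral>t. deriv \<phi> t * U t \<partial>lebesgue_on {a..b}) = - (\<integral>t. \<phi> t * V t \<partial>lebesgue_on {a..b})"
proof -
  let ?M = "lebesgue_on {a..b}"
  interpret M: finite_measure ?M by (rule finite_lebesgue_ivl)
  interpret pair_sigma_finite ?M ?M ..
  have diff: "((deriv ^^ k) \<phi>) differentiable (at t)" for k t using \<phi> by (simp add: test_function_def)
  have der: "(\<phi> has_real_derivative deriv \<phi> t) (at t)" for t
    using diff[of 0 t] by (simp add: DERIV_deriv_iff_real_differentiable)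
  have dcont: "continuous_on S (deriv \<phi>)" for S
    using diff[of 1] by (intro continuous_at_imp_continuous_on) (auto intro: differentiable_imp_continuous_within)
  have zero: "\<phi> a = 0" "\<phi> b = 0"
    using \<phi> closure_subset[of "{t. \<phi> t \<noteq> 0}"] by (auto simp: test_function_def)
  have dint: "integrable (lebesgue_on {s..t}) (deriv \<phi>)" for s t
    by (intro continuous_imp_integrable_real dcont)
  have ftc: "(\<integral>t. deriv \<phi> t \<partial>lebesgue_on {s..b}) = \<phi> b - \<phi> s" if "s \<le> b" for s
  proof -
    have "(deriv \<phi> has_integral (\<phi> b - \<phi> s)) {s..b}"
      using der that by (intro fundamental_theorem_of_calculus)
        (auto simp: has_real_derivative_iff_has_vector_derivative[symmetric] intro: has_field_derivative_at_within)
    then show ?thesis by (simp add: lebesgue_integral_eq_integral[OF dint] integral_unique)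
  qed
  define F where "F s t = (if s \<le> t then deriv \<phi> t * V s else 0)" for s t
  obtain B where "\<forall>y\<in>deriv \<phi> ` {a..b}. norm y \<le> B"
    using compact_imp_bounded[OF compact_continuous_image[OF dcont compact_Icc]]
    unfolding bounded_iff by blast
  then have B: "\<bar>deriv \<phi> t\<bar> \<le> B" if "t \<in> {a..b}" for t using that by auto
  have Vm: "V \<in> borel_measurable ?M" using V by auto
  have dm: "deriv \<phi> \<in> borel_measurable ?M"
    by (intro continuous_imp_measurable_on_sets_lebesgue dcont) auto
  have idm: "(\<lambda>x. x) \<in> borel_measurable ?M"
    by (intro continuous_imp_measurable_on_sets_lebesgue continuous_on_id) auto
  have m1 [measurable]: "(\<lambda>z. V (fst z)) \<in> borel_measurable (?M \<Otimes>\<^sub>M ?M)"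
    "(\<lambda>z. fst z) \<in> borel_measurable (?M \<Otimes>\<^sub>M ?M)"
    using measurable_compose[OF measurable_fst Vm] measurable_compose[OF measurable_fst idm] by auto
  have m2 [measurable]: "(\<lambda>z. deriv \<phi> (snd z)) \<in> borel_measurable (?M \<Otimes>\<^sub>M ?M)"
    "(\<lambda>z. snd z) \<in> borel_measurable (?M \<Otimes>\<^sub>M ?M)"
    using measurable_compose[OF measurable_snd dm] measurable_compose[OF measurable_snd idm] by auto
  have "integrable (?M \<Otimes>\<^sub>M ?M) (\<lambda>z. B * V (fst z))"
    by (rule Fubini_integrable) (use V in \<open>auto simp: M.emeasure_eq_measure\<close>)
  then have Fint: "integrable (?M \<Otimes>\<^sub>M ?M) (case_prod F)"
  proof (rule Bochner_Integration.integrable_bound)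
    have "(\<lambda>z. if fst z \<le> snd z then deriv \<phi> (snd z) * V (fst z) else 0) \<in> borel_measurable (?M \<Otimes>\<^sub>M ?M)"
      by measurable
    then show "case_prod F \<in> borel_measurable (?M \<Otimes>\<^sub>M ?M)"
      by (simp add: F_def case_prod_unfold)
    have "\<bar>deriv \<phi> t\<bar> * \<bar>V s\<bar> \<le> \<bar>B\<bar> * \<bar>V s\<bar>" if "t \<in> {a..b}" for s t
      using B[OF that] by (intro mult_right_mono) auto
    then show "AE z in ?M \<Otimes>\<^sub>M ?M. norm (case_prod F z) \<le> norm (B * V (fst z))"
      by (intro AE_I2) (auto simp: F_def space_pair_measure abs_mult)
  qed
  \<comment> \<open>Integration over horizontal and vertical sections of the triangle.\<close>
  have in1: "(\<integral>s. F s t \<partial>?M) = deriv \<phi> t * (\<integral>s. V s \<partial>lebesgue_on {a..t})" if "t \<in> {a..b}" for t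
  proof -
    have "(\<integral>s. F s t \<partial>?M) = (\<integral>s. (if s \<in> {a..t} then deriv \<phi> t * V s else 0) \<partial>?M)"
      by (intro Bochner_Integration.integral_cong) (auto simp: F_def)
    also have "\<dots> = (\<integral>s. deriv \<phi> t * V s \<partial>lebesgue_on ({a..t} \<inter> {a..b}))"
      by (rule Lebesgue_Measure.integral_restrict_Int) auto
    also have "{a..t} \<inter> {a..b} = {a..t}" using that by auto
    finally show ?thesis by simp
  qed
  have in2: "(\<integral>t. F s t \<partial>?M) = - (\<phi> s * V s)" if "s \<in> {a..b}" for s
  proof -
    have "(\<integral>t. F s t \<partial>?M) = (\<integral>t. (if t \<in> {s..b} then deriv \<phi> t * V s else 0) \<partial>?M)"
      by (intro Bochner_Integration.integral_cong) (auto simp: F_def)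
    also have "\<dots> = (\<integral>t. deriv \<phi> t * V s \<partial>lebesgue_on ({s..b} \<inter> {a..b}))"
      by (rule Lebesgue_Measure.integral_restrict_Int) auto
    also have "{s..b} \<inter> {a..b} = {s..b}" using that by auto
    finally show ?thesis using ftc[of s] that zero by simp
  qed
  have Vi: "integrable ?M (\<lambda>t. deriv \<phi> t * (\<integral>s. V s \<partial>lebesgue_on {a..t}))"
    by (intro continuous_imp_integrable_real continuous_intros dcont indefinite_integral_continuous_real V)
  have "(\<integral>t. deriv \<phi> t * U t \<partial>?M)
      = (\<integral>t. deriv \<phi> t * c + deriv \<phi> t * (\<integral>s. V s \<partial>lebesgue_on {a..t}) \<partial>?M)"
    by (intro Bochner_Integration.integral_cong) (auto simp: U distrib_left)
  also have "\<dots> = (\<phi> b - \<phi> a) * c + (\<integral>t. deriv \<phi> t * (\<integral>s. V s \<partial>lebesgue_on {a..t}) \<partial>?M)"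
    using ftc[OF ab] dint Vi by (subst Bochner_Integration.integral_add) auto
  also have "\<dots> = (\<integral>t. (\<integral>s. F s t \<partial>?M) \<partial>?M)"
    using zero by (auto intro!: Bochner_Integration.integral_cong simp: in1)
  also have "\<dots> = (\<integral>s. (\<integral>t. F s t \<partial>?M) \<partial>?M)" by (rule Fubini_integral[OF Fint])
  also have "\<dots> = (\<integral>s. - (\<phi> s * V s) \<partial>?M)"
    by (intro Bochner_Integration.integral_cong) (auto simp: in2)
  finally show ?thesis by simp
qed

section \<open>Resolvents and the integral equation\<close>

context bounded_graph
begin

lemma op_A_continuous: "lp_continuous_on p \<mu> S u \<Longrightarrow> lp_continuous_on p \<mu> S (\<lambda>t. \<A> (u t))"
  by (rule lp_continuous_lipschitz[where C = K]) (auto intro: op_A_lp op_A_lipschitz lp_cont_lp)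

text \<open>
  For small \<open>l\<close> the map \<open>z \<mapsto> y - l \<A> z\<close> is a contraction with factor \<open>1 / 2\<close>, whose fixed point solves one
  step of the implicit Euler scheme.
\<close>

lemma resolvent_exists:
  assumes y: "y \<in> lp p \<mu>" and l: "0 \<le> l" "K * l \<le> 1/2"
  obtains z where "z \<in> lp p \<mu>" "z + l *\<^sub>R \<A> z = y"
proof -
  define G where "G z = y - l *\<^sub>R \<A> z" for z
  have G: "G z \<in> lp p \<mu>" if "z \<in> lp p \<mu>" for z
    unfolding G_def by (intro lp_diff lp_scaleR op_A_lp y that)
  have contr: "nrm (G z - G z') \<le> 1/2 * nrm (z - z')" if "z \<in> lp p \<mu>" "z' \<in> lp p \<mu>" for z z'
  proof -
    have e: "G z - G z' = l *\<^sub>R (\<A> z' - \<A> z)" by (simp add: G_def scaleR_diff_right)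
    have "nrm (G z - G z') = l * nrm (\<A> z' - \<A> z)"
      unfolding e using lp_norm_scaleR[OF op_A_diff_lp[OF that(2,1)]] l by simp
    also have "\<dots> \<le> l * (K * nrm (z' - z))"
      using l by (intro mult_left_mono op_A_lipschitz that)
    also have "\<dots> = (K * l) * nrm (z - z')" by (simp add: lp_norm_commute)
    also have "\<dots> \<le> 1/2 * nrm (z - z')" using l by (intro mult_right_mono) auto
    finally show ?thesis .
  qed
  define zn where "zn n = (G ^^ n) 0" for n
  have znS: "zn (Suc n) = G (zn n)" for n by (simp add: zn_def)
  have zn: "zn n \<in> lp p \<mu>" for n by (induction n) (auto simp: zn_def intro: G)
  have step: "nrm (zn (Suc n) - zn n) \<le> nrm (zn 1 - zn 0) * (1/2)^n" for n
  proof (induction n)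
    case (Suc n)
    have "nrm (zn (Suc (Suc n)) - zn (Suc n)) \<le> 1/2 * nrm (zn (Suc n) - zn n)"
      unfolding znS[of "Suc n"] znS[of n] using contr[OF G[OF zn] zn] .
    then show ?case using Suc by (simp add: fun_diff_def)
  qed simp
  define z where "z = (\<lambda>x. lim (\<lambda>n. zn n x))"
  define C where "C = nrm (zn 1 - zn 0)"
  have z: "z \<in> lp p \<mu>" "\<And>n. nrm (z - zn n) \<le> 2 * C * (1/2)^n"
    unfolding z_def C_def using lp_geometric_limit[OF zn lp_norm_nonneg step] by (simp_all add: fun_diff_def)
  have "nrm (z - G z) \<le> 2 * C * (1/2)^n" for n
  proof -
    have "nrm (z - G z) \<le> nrm (z - zn (Suc n)) + nrm (zn (Suc n) - G z)"
      by (intro lp_triangle z zn G)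
    moreover have "nrm (zn (Suc n) - G z) \<le> 1/2 * nrm (zn n - z)"
      unfolding znS by (intro contr zn z)
    ultimately show ?thesis using z(2)[of "Suc n"] z(2)[of n] lp_norm_commute[of z "zn n"] by simp
  qed
  moreover have "(\<lambda>n. 2 * C * (1/2)^n) \<longlonglongrightarrow> 2 * C * 0"
    by (intro tendsto_mult tendsto_const LIMSEQ_realpow_zero) auto
  ultimately have "nrm (z - G z) \<le> 0"
    by (intro LIMSEQ_le_const) auto
  then have "z - G z = 0"
    using lp_norm_eq_0[OF lp_diff(1)[OF z(1) G[OF z(1)]]] lp_norm_nonneg[of "z - G z"] by linarith
  then have "z + l *\<^sub>R \<A> z = y" by (simp add: G_def algebra_simps)
  then show thesis using that z(1) by blast
qed

end

locale evolution = bounded_graph p \<mu> w \<kappa> f D L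
  for p :: real and \<mu> :: "'a::countable \<Rightarrow> real" and w \<kappa> f D L +
  fixes T :: real and u0 :: "'a \<Rightarrow> real" and h :: "real \<Rightarrow> 'a \<Rightarrow> real"
  assumes T_pos: "0 < T" and u0_lp: "u0 \<in> lp p \<mu>" and h_L1: "lp_L1 (lebesgue_on {0..T}) h"
begin

lemma h_lp: "t \<in> {0..T} \<Longrightarrow> h t \<in> lp p \<mu>"
  using h_L1 by (simp add: lp_L1_def)

lemma rate_L1:
  assumes "lp_continuous_on p \<mu> {0..T} u"
  shows "lp_L1 (lebesgue_on {0..T}) (\<lambda>s. h s - \<A> (u s))"
  by (intro lp_L1_diff h_L1 lp_continuous_imp_L1 op_A_continuous assms)

definition picard :: "(real \<Rightarrow> 'a \<Rightarrow> real) \<Rightarrow> real \<Rightarrow> 'a \<Rightarrow> real" where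
  "picard u t = u0 + coord_integral 0 t (\<lambda>s. h s - \<A> (u s))"

lemma picard_continuous:
  assumes "lp_continuous_on p \<mu> {0..T} u"
  shows "lp_continuous_on p \<mu> {0..T} (picard u)"
proof -
  have "lp_continuous_on p \<mu> {0..T} (\<lambda>t. u0 + coord_integral 0 t (\<lambda>s. h s - \<A> (u s)))"
    by (intro lp_continuous_add lp_continuous_const u0_lp lp_continuous_coord_integral rate_L1 assms)
  then show ?thesis by (simp add: picard_def[abs_def])
qed

text \<open>
  Measured with the weight \<open>e\<^sup>-\<^sup>2\<^sup>K\<^sup>t\<close>, the Picard map halves distances on the whole interval, so the
  iteration need not be restarted on short intervals: the factor \<open>K\<close> from the Lipschitz bound is
  absorbed by \<open>\<integral>\<^sub>0\<^sup>t K e\<^sup>2\<^sup>K\<^sup>s ds \<le> e\<^sup>2\<^sup>K\<^sup>t / 2\<close>.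
\<close>

lemma picard_contraction:
  assumes u: "lp_continuous_on p \<mu> {0..T} u" and v: "lp_continuous_on p \<mu> {0..T} v"
    and B: "0 \<le> B" and le: "\<And>s. s \<in> {0..T} \<Longrightarrow> nrm (u s - v s) \<le> B * exp (2 * K * s)"
    and t: "t \<in> {0..T}"
  shows "nrm (picard u t - picard v t) \<le> B / 2 * exp (2 * K * t)"
proof -
  let ?d = "\<lambda>s. (h s - \<A> (u s)) - (h s - \<A> (v s))"
  have sub: "{0..t} \<subseteq> {0..T}" using t by auto
  have L1: "lp_L1 (lebesgue_on {0..t}) (\<lambda>s. h s - \<A> (u s))" "lp_L1 (lebesgue_on {0..t}) (\<lambda>s. h s - \<A> (v s))"
    by (intro lp_L1_subinterval[OF rate_L1 sub] u v)+
  have dL1: "lp_L1 (lebesgue_on {0..t}) ?d" by (rule lp_L1_diff[OF L1])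
  have "picard u t - picard v t = coord_integral 0 t ?d"
    unfolding coord_integral_diff[OF L1] by (simp add: picard_def)
  then have "nrm (picard u t - picard v t) \<le> (\<integral>s. nrm (?d s) \<partial>lebesgue_on {0..t})"
    using coord_integral_lp(2)[OF dL1] by simp
  also have "\<dots> \<le> (\<integral>s. B * (K * exp (2 * K * s)) \<partial>lebesgue_on {0..t})"
  proof (rule integral_mono)
    show "integrable (lebesgue_on {0..t}) (\<lambda>s. B * (K * exp (2 * K * s)))"
      by (intro continuous_imp_integrable_real continuous_intros)
    fix s assume "s \<in> space (lebesgue_on {0..t})"
    then have s: "s \<in> {0..T}" using sub by auto
    have e: "?d s = \<A> (v s) - \<A> (u s)" by simp
    have "nrm (?d s) \<le> K * nrm (v s - u s)"
      unfolding e by (intro op_A_lipschitz lp_cont_lp[OF u] lp_cont_lp[OF v] s)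
    also have "\<dots> \<le> K * (B * exp (2 * K * s))"
      using le[OF s] K_nonneg by (intro mult_left_mono) (simp_all add: lp_norm_commute)
    finally show "nrm (?d s) \<le> B * (K * exp (2 * K * s))" by (simp add: mult_ac)
  qed (rule lp_L1_norm(1)[OF dL1])
  also have "\<dots> = B * (exp (2 * K * t) / 2 - exp (2 * K * 0) / 2)"
  proof -
    have "((\<lambda>s. K * exp (2 * K * s)) has_integral (exp (2 * K * t) / 2 - exp (2 * K * 0) / 2)) {0..t}"
      using t by (intro fundamental_theorem_of_calculus)
        (auto simp: has_real_derivative_iff_has_vector_derivative[symmetric] intro!: derivative_eq_intros)
    moreover have "integrable (lebesgue_on {0..t}) (\<lambda>s. K * exp (2 * K * s))"
      by (intro continuous_imp_integrable_real continuous_intros)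
    then have "(\<integral>s. K * exp (2 * K * s) \<partial>lebesgue_on {0..t}) = integral {0..t} (\<lambda>s. K * exp (2 * K * s))"
      by (rule lebesgue_integral_eq_integral) auto
    ultimately show ?thesis by (simp only: integral_unique integral_mult_right_zero)
  qed
  also have "\<dots> \<le> B / 2 * exp (2 * K * t)" using B by (simp add: algebra_simps)
  finally show ?thesis .
qed

definition integral_solution :: "(real \<Rightarrow> 'a \<Rightarrow> real) \<Rightarrow> bool" where
  "integral_solution u \<longleftrightarrow> lp_continuous_on p \<mu> {0..T} u \<and> (\<forall>t\<in>{0..T}. u t = picard u t)"

text \<open>
  The distance of consecutive Picard iterates halves in the weighted norm, so they converge uniformly on
  \<open>[0, T]\<close>; the limit is continuous and, again by the contraction estimate, a fixed point.
\<close>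

lemma integral_solution_exists: "\<exists>u. integral_solution u"
proof -
  define un where "un n = (picard ^^ n) (\<lambda>_. u0)" for n
  have unS: "un (Suc n) = picard (un n)" for n by (simp add: un_def)
  have un: "lp_continuous_on p \<mu> {0..T} (un n)" for n
    by (induction n) (auto simp: un_def intro: picard_continuous lp_continuous_const u0_lp)
  have unlp: "un n t \<in> lp p \<mu>" if "t \<in> {0..T}" for n t by (rule lp_cont_lp[OF un that])
  have "continuous_on {0..T} (\<lambda>t. nrm (un 1 t - un 0 t))"
    by (intro lp_continuous_norm lp_continuous_diff un)
  from compact_imp_bounded[OF compact_continuous_image[OF this compact_Icc]]
  obtain C0 where "\<forall>y\<in>(\<lambda>t. nrm (un 1 t - un 0 t)) ` {0..T}. norm y \<le> C0"
    unfolding bounded_iff by blast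
  then have C0: "nrm (un 1 t - un 0 t) \<le> C0" if "t \<in> {0..T}" for t using that by auto
  have C0n: "0 \<le> C0" by (rule order_trans[OF lp_norm_nonneg C0[of 0]]) (use T_pos in auto)
  have step: "nrm (un (Suc n) t - un n t) \<le> C0 * (1/2)^n * exp (2 * K * t)" if "t \<in> {0..T}" for n t
    using that
  proof (induction n arbitrary: t)
    case 0
    have "C0 * 1 \<le> C0 * exp (2 * K * t)"
      using C0n K_nonneg 0 by (intro mult_left_mono) auto
    then show ?case using C0[OF 0] by (simp add: fun_diff_def)
  next
    case (Suc n)
    have "nrm (picard (un (Suc n)) t - picard (un n) t) \<le> (C0 * (1/2)^n) / 2 * exp (2 * K * t)"
      by (rule picard_contraction[OF un un _ Suc.IH Suc.prems]) (use C0n in auto)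
    then show ?case by (simp add: unS fun_diff_def)
  qed
  \<comment> \<open>Dropping the weight at the end of the interval makes the estimate uniform in \<open>t\<close>.\<close>
  define C where "C = C0 * exp (2 * K * T)"
  have C: "0 \<le> C" using C0n by (simp add: C_def)
  have step': "nrm (un (Suc n) t - un n t) \<le> C * (1/2)^n" if t: "t \<in> {0..T}" for n t
  proof -
    have "C0 * (1/2)^n * exp (2 * K * t) \<le> C0 * (1/2)^n * exp (2 * K * T)"
      using C0n t K_nonneg by (intro mult_left_mono) (auto intro!: mult_left_mono)
    then show ?thesis using step[OF t, of n] by (simp add: C_def mult_ac)
  qed
  define u where "u t = (\<lambda>x. lim (\<lambda>n. un n t x))" for t
  have u: "u t \<in> lp p \<mu>" "\<And>n. nrm (u t - un n t) \<le> 2 * C * (1/2)^n" if t: "t \<in> {0..T}" for t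
    unfolding u_def using lp_geometric_limit[OF unlp[OF t] C step'[OF t]] by auto
  have lim0: "(\<lambda>n. c * (1/2)^n) \<longlonglongrightarrow> 0" for c :: real
    by (intro tendsto_mult_right_zero LIMSEQ_realpow_zero) auto
  have ucont: "lp_continuous_on p \<mu> {0..T} u"
    by (rule lp_continuous_uniform_limit[OF un u lim0])
  have "u t = picard u t" if t: "t \<in> {0..T}" for t
  proof -
    have plp: "picard u t \<in> lp p \<mu>" by (rule lp_cont_lp[OF picard_continuous[OF ucont] t])
    let ?c = "C + C * exp (2 * K * t)"
    have "nrm (u t - picard u t) \<le> ?c * (1/2)^n" for n
    proof -
      have "nrm (u t - picard u t) \<le> nrm (u t - un (Suc n) t) + nrm (un (Suc n) t - picard u t)"
        by (intro lp_triangle u unlp t plp)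
      moreover have "nrm (un (Suc n) t - picard u t) \<le> (2 * C * (1/2)^n) / 2 * exp (2 * K * t)"
        unfolding unS
      proof (rule picard_contraction[OF un ucont _ _ t])
        fix s assume s: "s \<in> {0..T}"
        have "2 * C * (1/2)^n * 1 \<le> 2 * C * (1/2)^n * exp (2 * K * s)"
          using C K_nonneg s by (intro mult_left_mono) auto
        then show "nrm (un n s - u s) \<le> 2 * C * (1/2)^n * exp (2 * K * s)"
          using u(2)[OF s, of n] lp_norm_commute[of "u s" "un n s"] by linarith
      qed (use C in auto)
      ultimately show ?thesis using u(2)[OF t, of "Suc n"] by (simp add: algebra_simps)
    qed
    then have "nrm (u t - picard u t) \<le> 0"
      by (intro LIMSEQ_le_const[OF lim0]) auto
    then show ?thesis
      using lp_norm_eq_0[OF lp_diff(1)[OF u(1)[OF t] plp]] lp_norm_nonneg[of "u t - picard u t"] by force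
  qed
  then show ?thesis using ucont by (auto simp: integral_solution_def)
qed

end


section \<open>The implicit Euler scheme\<close>

lemma partition_mono:
  fixes ts :: "nat \<Rightarrow> real"
  assumes "\<forall>k\<in>{1..N}. ts (k - 1) < ts k" "i \<le> j" "j \<le> N"
  shows "ts i \<le> ts j"
  using assms(2,3)
proof (induction j rule: dec_induct)
  case (step n)
  then have "ts (Suc n - 1) < ts (Suc n)" using assms(1) by (intro assms(1)[rule_format]) auto
  then show ?case using step by simp
qed simp

lemma partition_cover:
  fixes ts :: "nat \<Rightarrow> real"
  assumes "ts 0 < t" "t \<le> ts N"
  obtains k where "k \<in> {1..N}" "ts (k - 1) < t" "t \<le> ts k"
proof -
  define k where "k = (LEAST k. t \<le> ts k)"
  have k: "t \<le> ts k" unfolding k_def using assms(2) by (rule LeastI)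
  have kN: "k \<le> N" unfolding k_def using assms(2) by (rule Least_le)
  have "k \<noteq> 0" using k assms(1) by (metis not_less)
  then have "\<not> t \<le> ts (k - 1)" using not_less_Least[of "k - 1" "\<lambda>k. t \<le> ts k"] by (simp add: k_def)
  then show thesis using that[of k] k kN \<open>k \<noteq> 0\<close> by auto
qed

lemma sum_integral_partition:
  fixes g :: "real \<Rightarrow> real" and ts :: "nat \<Rightarrow> real"
  assumes g: "integrable (lebesgue_on {ts 0..ts N}) g" and ts: "\<forall>k\<in>{1..N}. ts (k - 1) < ts k" and m: "m \<le> N"
  shows "(\<Sum>k=1..m. \<integral>t. g t \<partial>lebesgue_on {ts (k - 1)..ts k}) = (\<integral>t. g t \<partial>lebesgue_on {ts 0..ts m})"
  using m
proof (induction m)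
  case 0
  then show ?case using integral_singleton_lebesgue[of "ts 0" g] by simp
next
  case (Suc m)
  have "ts 0 \<le> ts m" "ts m \<le> ts (Suc m)" "ts (Suc m) \<le> ts N"
    using Suc.prems by (auto intro: partition_mono[OF ts])
  moreover from this have "integrable (lebesgue_on {ts 0..ts (Suc m)}) g"
    by (intro integrable_subinterval[OF g]) auto
  ultimately have "(\<integral>t. g t \<partial>lebesgue_on {ts 0..ts (Suc m)})
      = (\<integral>t. g t \<partial>lebesgue_on {ts 0..ts m}) + (\<integral>t. g t \<partial>lebesgue_on {ts m..ts (Suc m)})"
    by (intro Equivalence_Measurable_On_Borel.integral_combine)
  then show ?case using Suc by simp
qed

lemma eps_discretization_mono:
  assumes "eps_discretization p \<mu> T h \<epsilon> N ts hs" "\<epsilon> \<le> \<epsilon>'"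
  shows "eps_discretization p \<mu> T h \<epsilon>' N ts hs"
proof -
  have "ennreal \<epsilon> \<le> ennreal \<epsilon>'" using assms(2) by (rule ennreal_leI)
  then show ?thesis using assms unfolding eps_discretization_def by (meson order_trans)
qed

text \<open>
  One implicit Euler step amplifies errors by at most \<open>1 / (1 - x)\<close> with \<open>x = K \<lambda>\<close>; this
  bounds the amplification by \<open>e\<^sup>2\<^sup>x\<close>, and the exponentials of consecutive steps multiply up.
\<close>

lemma exp_growth_le:
  fixes x :: real
  assumes "0 \<le> x" "x \<le> 1/2"
  shows "1 \<le> exp (2 * x) * (1 - x)"
proof -
  have "1 + x * (1 - 2 * x) \<ge> 1" using assms by (simp add: mult_nonneg_nonneg)
  then have "1 \<le> (1 + 2 * x) * (1 - x)" by (simp add: algebra_simps)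
  also have "\<dots> \<le> exp (2 * x) * (1 - x)"
    using assms exp_ge_add_one_self[of "2 * x"] by (intro mult_right_mono) auto
  finally show ?thesis .
qed

context evolution
begin

lemma solution_at_0:
  assumes u: "integral_solution u"
  shows "u 0 = u0"
  using u T_pos by (simp add: integral_solution_def picard_def)

lemma solution_increment:
  assumes u: "integral_solution u" and st: "0 \<le> s" "s \<le> t" "t \<le> T"
  shows "u t - u s = coord_integral s t (\<lambda>r. h r - \<A> (u r))"
proof -
  have "lp_L1 (lebesgue_on {0..t}) (\<lambda>r. h r - \<A> (u r))"
    using u st by (intro lp_L1_subinterval[OF rate_L1]) (auto simp: integral_solution_def)
  from coord_integral_combine[OF this st(1,2)] show ?thesis
    using u st by (simp add: integral_solution_def picard_def)
qed

text \<open>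
  A discrete Gronwall argument. Over one step of length \<open>l\<close> the exact solution changes by the integral
  of \<open>h - \<A> u\<close> and the scheme by the integral of the constant \<open>h\<^sub>k - \<A> u\<^sub>k\<close>. The difference of
  the integrands is at most \<open>\<parallel>h - h\<^sub>k\<parallel> + K (\<omega> + E)\<close>, where \<open>E\<close> is the error at the end of the
  step and \<open>\<omega>\<close> the oscillation of \<open>u\<close> on the scale of the mesh. For \<open>K l \<le> 1 / 2\<close> the
  resulting implicit inequality for \<open>E\<close> can be solved.
\<close>

lemma euler_error:
  fixes ts :: "nat \<Rightarrow> real"
  assumes u: "integral_solution u"
    and ts0: "ts 0 = 0" and inc: "\<forall>k\<in>{1..N}. ts (k - 1) < ts k" and tsN: "ts N \<le> T"
    and mesh: "\<forall>k\<in>{1..N}. ts k - ts (k - 1) \<le> \<epsilon>" and K\<epsilon>: "K * \<epsilon> \<le> 1/2"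
    and hs: "\<forall>k\<in>{1..N}. hs k \<in> lp p \<mu>"
    and us0: "us 0 = u0" and us: "\<forall>k\<in>{1..N}. us k \<in> lp p \<mu>"
    and eq: "\<forall>k\<in>{1..N}. us k + (ts k - ts (k - 1)) *\<^sub>R \<A> (us k) = us (k - 1) + (ts k - ts (k - 1)) *\<^sub>R hs k"
    and \<omega>: "\<And>s t. s \<in> {0..T} \<Longrightarrow> t \<in> {0..T} \<Longrightarrow> \<bar>s - t\<bar> \<le> \<epsilon> \<Longrightarrow> nrm (u s - u t) \<le> \<omega>"
    and k: "k \<le> N"
  shows "nrm (u (ts k) - us k) \<le> exp (2 * K * ts k) *
    ((\<Sum>j=1..k. \<integral>t. nrm (h t - hs j) \<partial>lebesgue_on {ts (j - 1)..ts j}) + K * \<omega> * ts k)"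
  using k
proof (induction k)
  case 0
  then show ?case by (simp add: ts0 us0 solution_at_0[OF u])
next
  case (Suc k)
  define a b l where "a = ts k" and "b = ts (Suc k)" and "l = b - a"
  define E where "E = nrm (u b - us (Suc k))"
  define E' where "E' = nrm (u a - us k)"
  define \<delta> where "\<delta> = (\<integral>t. nrm (h t - hs (Suc k)) \<partial>lebesgue_on {a..b})"
  define S where "S = (\<Sum>j=1..k. \<integral>t. nrm (h t - hs j) \<partial>lebesgue_on {ts (j - 1)..ts j})"
  have Sk: "Suc k \<in> {1..N}" using Suc.prems by auto
  have kk: "us k \<in> lp p \<mu>" using us us0 u0_lp Suc.prems by (cases "k = 0") auto
  have a0: "0 \<le> a" unfolding a_def ts0[symmetric] using Suc.prems by (intro partition_mono[OF inc]) auto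
  have ab: "a < b" using inc[rule_format, OF Sk] by (simp add: a_def b_def)
  have bT: "b \<le> T" unfolding b_def by (rule order_trans[OF partition_mono[OF inc Suc.prems order_refl] tsN])
  have l: "0 < l" "l \<le> \<epsilon>" using ab mesh[rule_format, OF Sk] by (auto simp: l_def a_def b_def)
  have hk: "hs (Suc k) \<in> lp p \<mu>" and uk: "us (Suc k) \<in> lp p \<mu>"
    using hs us Sk by auto
  have ucont: "lp_continuous_on p \<mu> {0..T} u" using u by (simp add: integral_solution_def)
  have ulp: "u s \<in> lp p \<mu>" if "s \<in> {0..T}" for s by (rule lp_cont_lp[OF ucont that])
  have sub: "{a..b} \<subseteq> {0..T}" using a0 bT by auto
  let ?c = "hs (Suc k) - \<A> (us (Suc k))"
  let ?g = "\<lambda>s. (h s - \<A> (u s)) - ?c"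
  have c: "?c \<in> lp p \<mu>" by (intro lp_diff hk op_A_lp uk)
  have rL1: "lp_L1 (lebesgue_on {a..b}) (\<lambda>s. h s - \<A> (u s))"
    by (rule lp_L1_subinterval[OF rate_L1[OF ucont] sub])
  have gL1: "lp_L1 (lebesgue_on {a..b}) ?g" by (intro lp_L1_diff rL1 lp_L1_const c)
  have hL1: "lp_L1 (lebesgue_on {a..b}) (\<lambda>s. h s - hs (Suc k))"
    by (intro lp_L1_diff lp_L1_const hk lp_L1_subinterval[OF h_L1 sub])
  \<comment> \<open>One step of the scheme, written as an integral over the same interval as the increment of \<open>u\<close>.\<close>
  have "us (Suc k) + l *\<^sub>R \<A> (us (Suc k)) = us k + l *\<^sub>R hs (Suc k)"
    using eq[rule_format, OF Sk] by (simp add: l_def a_def b_def)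
  then have "us (Suc k) - us k = l *\<^sub>R ?c"
    by (simp add: scaleR_diff_right algebra_simps)
  also have "\<dots> = coord_integral a b (\<lambda>_. ?c)" using ab by (simp add: coord_integral_const l_def)
  finally have inc_us: "us (Suc k) - us k = coord_integral a b (\<lambda>_. ?c)" .
  have inc_u: "u b - u a = coord_integral a b (\<lambda>s. h s - \<A> (u s))"
    by (rule solution_increment[OF u]) (use a0 ab bT in auto)
  have "(u b - us (Suc k)) - (u a - us k) = (u b - u a) - (us (Suc k) - us k)" by (simp add: algebra_simps)
  also have "\<dots> = coord_integral a b ?g"
    unfolding inc_us inc_u by (rule coord_integral_diff[OF rL1 lp_L1_const[OF c], symmetric])
  finally have "u b - us (Suc k) = (u a - us k) + coord_integral a b ?g" by (simp add: algebra_simps)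
  then have "E \<le> E' + nrm (coord_integral a b ?g)"
    unfolding E_def E'_def using a0 ab bT
    by (simp only:) (intro lp_add lp_diff ulp kk coord_integral_lp(1)[OF gL1], auto)
  also have "nrm (coord_integral a b ?g) \<le> (\<integral>s. nrm (?g s) \<partial>lebesgue_on {a..b})" by (rule coord_integral_lp(2)[OF gL1])
  also have "\<dots> \<le> (\<integral>s. nrm (h s - hs (Suc k)) + K * (\<omega> + E) \<partial>lebesgue_on {a..b})"
  proof (rule integral_mono[OF lp_L1_norm(1)[OF gL1]])
    show "integrable (lebesgue_on {a..b}) (\<lambda>s. nrm (h s - hs (Suc k)) + K * (\<omega> + E))"
      by (rule Bochner_Integration.integrable_add[OF lp_L1_norm(1)[OF hL1]]) simp
    fix s assume "s \<in> space (lebesgue_on {a..b})"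
    then have s: "s \<in> {a..b}" "s \<in> {0..T}" using sub by auto
    have bI: "b \<in> {0..T}" using a0 ab bT by auto
    have e: "?g s = (h s - hs (Suc k)) - (\<A> (u s) - \<A> (us (Suc k)))" by (simp add: algebra_simps)
    have "nrm (?g s) \<le> nrm (h s - hs (Suc k)) + nrm (\<A> (u s) - \<A> (us (Suc k)))"
      unfolding e by (intro lp_diff h_lp s hk op_A_lp ulp uk)
    moreover have "nrm (\<A> (u s) - \<A> (us (Suc k))) \<le> K * nrm (u s - us (Suc k))"
      by (intro op_A_lipschitz ulp s uk)
    moreover have "nrm (u s - us (Suc k)) \<le> nrm (u s - u b) + E"
      unfolding E_def by (intro lp_triangle ulp s bI uk)
    moreover have "nrm (u s - u b) \<le> \<omega>"
      by (rule \<omega>[OF s(2) bI]) (use s(1) l in \<open>auto simp: l_def\<close>)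
    ultimately show "nrm (?g s) \<le> nrm (h s - hs (Suc k)) + K * (\<omega> + E)"
      using K_nonneg by (smt (verit) mult_left_mono)
  qed
  also have "\<dots> = \<delta> + K * (\<omega> + E) * l"
    unfolding \<delta>_def using ab lp_L1_norm(1)[OF hL1]
    by (subst Bochner_Integration.integral_add) (auto simp: measure_restrict_space l_def)
  finally have E: "E \<le> E' + (\<delta> + K * (\<omega> + E) * l)" by simp
  have \<omega>0: "0 \<le> \<omega>" using \<omega>[of 0 0] T_pos l lp_norm_nonneg[of "u 0 - u 0"] by simp
  have \<delta>0: "0 \<le> \<delta>" unfolding \<delta>_def by (intro Bochner_Integration.integral_nonneg) simp
  define x where "x = K * l"
  have x: "0 \<le> x" "x \<le> 1/2"
    using K_nonneg l mult_left_mono[OF l(2) K_nonneg] K\<epsilon> by (auto simp: x_def)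
  have E0: "0 \<le> E" by (simp add: E_def)
  have IH: "E' \<le> exp (2 * K * a) * (S + K * \<omega> * a)"
    using Suc by (simp add: E'_def S_def a_def fun_diff_def)
  \<comment> \<open>Solve the implicit inequality for \<open>E\<close>, then absorb the step into the exponential.\<close>
  have "E * 1 \<le> E * (exp (2 * x) * (1 - x))" by (intro mult_left_mono exp_growth_le x E0)
  also have "\<dots> = exp (2 * x) * (E * (1 - x))" by simp
  also have "\<dots> \<le> exp (2 * x) * (E' + (\<delta> + x * \<omega>))"
    using E by (intro mult_left_mono) (simp_all add: x_def algebra_simps)
  also have "\<dots> \<le> exp (2 * x) * (exp (2 * K * a) * (S + K * \<omega> * a) + exp (2 * K * a) * (\<delta> + x * \<omega>))"
  proof (intro mult_left_mono add_mono IH)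
    have "1 \<le> exp (2 * K * a)" using K_nonneg a0 by simp
    moreover have "0 \<le> \<delta> + x * \<omega>" using \<delta>0 x \<omega>0 by simp
    ultimately show "\<delta> + x * \<omega> \<le> exp (2 * K * a) * (\<delta> + x * \<omega>)"
      by (metis mult_right_mono mult_1)
  qed simp
  also have "\<dots> = exp (2 * K * b) * ((S + \<delta>) + K * \<omega> * b)"
  proof -
    have "b = a + l" by (simp add: l_def)
    then show ?thesis by (simp add: x_def algebra_simps exp_add)
  qed
  finally show ?case by (simp add: E_def b_def S_def \<delta>_def a_def fun_diff_def)
qed

lemma discretization_error_sum:
  assumes d: "eps_discretization p \<mu> T h \<epsilon> N ts hs" and \<epsilon>: "0 \<le> \<epsilon>" and k: "k \<le> N"
  shows "(\<Sum>j=1..k. \<integral>t. nrm (h t - hs j) \<partial>lebesgue_on {ts (j - 1)..ts j}) \<le> \<epsilon>"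
proof -
  have inc: "\<forall>k\<in>{1..N}. ts (k - 1) < ts k" and ts: "ts 0 = 0" "ts N \<le> T"
    and hs: "\<forall>k\<in>{1..N}. hs k \<in> lp p \<mu>"
    and sum: "(\<Sum>k=1..N. \<integral>\<^sup>+t\<in>{ts (k - 1)..ts k}. ennreal (nrm (h t - hs k)) \<partial>lebesgue) \<le> ennreal \<epsilon>"
    using d by (auto simp: eps_discretization_def)
  have "(\<integral>\<^sup>+t\<in>{ts (j - 1)..ts j}. ennreal (nrm (h t - hs j)) \<partial>lebesgue)
      = ennreal (\<integral>t. nrm (h t - hs j) \<partial>lebesgue_on {ts (j - 1)..ts j})" if "j \<in> {1..N}" for j
  proof -
    have "0 \<le> ts (j - 1)" using partition_mono[OF inc, of 0 "j - 1"] that by (cases j) (auto simp: ts)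
    moreover have "ts j \<le> T" using partition_mono[OF inc, of j N] that ts by simp
    ultimately have "lp_L1 (lebesgue_on {ts (j - 1)..ts j}) (\<lambda>t. h t - hs j)"
      using that hs by (intro lp_L1_diff lp_L1_const lp_L1_subinterval[OF h_L1]) auto
    from lp_L1_norm(2)[OF this] show ?thesis by (simp add: nn_integral_restrict_space)
  qed
  then have "(\<Sum>j=1..N. ennreal (\<integral>t. nrm (h t - hs j) \<partial>lebesgue_on {ts (j - 1)..ts j})) \<le> ennreal \<epsilon>"
    using sum by simp
  then have "(\<Sum>j=1..N. \<integral>t. nrm (h t - hs j) \<partial>lebesgue_on {ts (j - 1)..ts j}) \<le> \<epsilon>"
    using \<epsilon> by (subst (asm) sum_ennreal) (auto intro: Bochner_Integration.integral_nonneg)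
  moreover have "(\<Sum>j=1..k. \<integral>t. nrm (h t - hs j) \<partial>lebesgue_on {ts (j - 1)..ts j})
      \<le> (\<Sum>j=1..N. \<integral>t. nrm (h t - hs j) \<partial>lebesgue_on {ts (j - 1)..ts j})"
    using k by (intro sum_mono2) (auto intro: Bochner_Integration.integral_nonneg)
  ultimately show ?thesis by simp
qed

text \<open>
  The estimate holds for every \<open>\<epsilon>\<close>-approximate solution, whatever the discretization, so it serves
  both to show that the solution of the integral equation is mild and to identify an arbitrary mild
  solution with it.
\<close>

lemma euler_converges:
  assumes u: "integral_solution u" and \<eta>: "0 < \<eta>"
  shows "\<exists>\<epsilon>0>0. K * \<epsilon>0 \<le> 1/2 \<and> (\<forall>\<epsilon> N ts hs ue. 0 < \<epsilon> \<longrightarrow> \<epsilon> \<le> \<epsilon>0 \<longrightarrow>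
    eps_discretization p \<mu> T h \<epsilon> N ts hs \<longrightarrow> eps_approx_solution p f w \<kappa> \<mu> u0 N ts hs ue \<longrightarrow>
    (\<forall>t\<in>{0..ts N}. ue t \<in> lp p \<mu> \<and> nrm (u t - ue t) < \<eta>))"
proof -
  define M where "M = exp (2 * K * T)"
  have M: "1 \<le> M" using K_nonneg T_pos by (simp add: M_def)
  \<comment> \<open>The final error is at most \<open>M \<epsilon> + M K \<omega> T + \<omega>\<close>: this \<open>\<omega>\<close> makes the last two terms
    \<open>\<eta> / 2\<close>, and \<open>\<epsilon>0\<close> will make the first at most \<open>\<eta> / 4\<close>.\<close>
  define \<omega> where "\<omega> = \<eta> / (2 * (M * K * T + 1))"
  have den: "0 < M * K * T + 1" using M K_nonneg T_pos by (intro add_nonneg_pos mult_nonneg_nonneg) auto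
  have "\<eta> / (2 * y) * y = \<eta> / 2" if "0 < y" for y :: real using that by simp
  from this[OF den] have "\<omega> * (M * K * T + 1) = \<eta> / 2" by (simp only: \<omega>_def)
  then have \<omega>: "0 < \<omega>" "M * (K * \<omega> * T) + \<omega> = \<eta> / 2"
    using den \<eta> by (simp add: \<omega>_def, simp add: algebra_simps)
  have ucont: "lp_continuous_on p \<mu> {0..T} u" using u by (simp add: integral_solution_def)
  obtain d where d: "0 < d" "\<And>s t. s \<in> {0..T} \<Longrightarrow> t \<in> {0..T} \<Longrightarrow> \<bar>s - t\<bar> < d \<Longrightarrow> nrm (u s - u t) < \<omega>"
    using lp_uniformly_continuous[OF ucont \<omega>(1)] by blast
  define \<epsilon>0 where "\<epsilon>0 = min (d / 2) (min (\<eta> / (4 * M)) (1 / (2 * (K + 1))))"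
  have e0: "0 < \<epsilon>0" "\<epsilon>0 < d" "\<epsilon>0 \<le> \<eta> / (4 * M)" "\<epsilon>0 \<le> 1 / (2 * (K + 1))"
    using d \<eta> M K_nonneg by (auto simp: \<epsilon>0_def)
  have "K * \<epsilon>0 \<le> K * (1 / (2 * (K + 1)))" using e0 K_nonneg by (intro mult_left_mono)
  also have "\<dots> \<le> 1/2" using K_nonneg by (simp add: field_simps)
  finally have Ke0: "K * \<epsilon>0 \<le> 1/2" .
  show ?thesis
  proof (intro exI[of _ \<epsilon>0] conjI e0(1) Ke0 allI impI ballI)
    fix \<epsilon> N ts hs ue t
    assume \<epsilon>: "0 < \<epsilon>" "\<epsilon> \<le> \<epsilon>0" and disc: "eps_discretization p \<mu> T h \<epsilon> N ts hs"
      and approx: "eps_approx_solution p f w \<kappa> \<mu> u0 N ts hs ue" and t: "t \<in> {0..ts N}"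
    from disc have ts: "ts 0 = 0" "\<forall>k\<in>{1..N}. ts (k - 1) < ts k" "ts N \<le> T"
      "\<forall>k\<in>{1..N}. ts k - ts (k - 1) \<le> \<epsilon>" "\<forall>k\<in>{1..N}. hs k \<in> lp p \<mu>"
      by (auto simp: eps_discretization_def)
    from approx obtain us where us: "us 0 = u0" "\<forall>k\<in>{1..N}. us k \<in> lp p \<mu>"
      "\<forall>k\<in>{1..N}. us k + (ts k - ts (k - 1)) *\<^sub>R \<A> (us k) = us (k - 1) + (ts k - ts (k - 1)) *\<^sub>R hs k"
      and ue: "ue 0 = u0" "\<forall>k\<in>{1..N}. \<forall>t\<in>{ts (k - 1)<..ts k}. ue t = us k"
      unfolding eps_approx_solution_def dom_A_eq by blast
    have "ue t \<in> lp p \<mu> \<and> nrm (u t - ue t) < \<eta>"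
    proof (cases "t = 0")
      case True
      then show ?thesis using ue(1) solution_at_0[OF u] u0_lp \<eta> by simp
    next
      case False
      then obtain k where k: "k \<in> {1..N}" "ts (k - 1) < t" "t \<le> ts k"
        using partition_cover[of ts t N] t ts(1) by auto
      then have uet: "ue t = us k" using ue(2) by auto
      have usk: "us k \<in> lp p \<mu>" using us k by blast
      have tk: "ts k \<in> {0..T}"
        using partition_mono[OF ts(2), of 0 k] partition_mono[OF ts(2), of k N] ts k by auto
      have tT: "t \<in> {0..T}" using t ts(3) by auto
      have "\<bar>t - ts k\<bar> < d" using k ts(4) \<epsilon> e0 by fastforce
      then have w1: "nrm (u t - u (ts k)) \<le> \<omega>" using d(2)[OF tT tk] by simp
      have "nrm (u (ts k) - us k) \<le> exp (2 * K * ts k) *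
          ((\<Sum>j=1..k. \<integral>t. nrm (h t - hs j) \<partial>lebesgue_on {ts (j - 1)..ts j}) + K * \<omega> * ts k)"
      proof (rule euler_error[OF u ts(1,2,3,4) _ ts(5) us])
        show "K * \<epsilon> \<le> 1/2" using mult_left_mono[OF \<epsilon>(2) K_nonneg] Ke0 by linarith
        show "nrm (u s - u t) \<le> \<omega>" if "s \<in> {0..T}" "t \<in> {0..T}" "\<bar>s - t\<bar> \<le> \<epsilon>" for s t
          using d(2)[of s t] that \<epsilon> e0 by fastforce
      qed (use k in auto)
      also have "\<dots> \<le> M * (\<epsilon> + K * \<omega> * T)"
      proof (intro mult_mono add_mono)
        show "exp (2 * K * ts k) \<le> M" unfolding M_def using tk K_nonneg by (simp add: mult_left_mono)
        show "(\<Sum>j=1..k. \<integral>t. nrm (h t - hs j) \<partial>lebesgue_on {ts (j - 1)..ts j}) \<le> \<epsilon>"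
          using discretization_error_sum[OF disc] \<epsilon> k by simp
        show "0 \<le> (\<Sum>j=1..k. \<integral>t. nrm (h t - hs j) \<partial>lebesgue_on {ts (j - 1)..ts j}) + K * \<omega> * ts k"
          using tk K_nonneg \<omega>(1)
          by (intro add_nonneg_nonneg sum_nonneg mult_nonneg_nonneg Bochner_Integration.integral_nonneg) auto
      qed (use tk K_nonneg \<omega>(1) M in \<open>auto intro: mult_left_mono\<close>)
      finally have w2: "nrm (u (ts k) - us k) \<le> M * \<epsilon> + M * (K * \<omega> * T)" by (simp add: distrib_left)
      have "M * \<epsilon> \<le> M * (\<eta> / (4 * M))" using \<epsilon> e0 M by (intro mult_left_mono) auto
      also have "\<dots> = \<eta> / 4" using M by simp
      finally have "M * \<epsilon> \<le> \<eta> / 4" .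
      moreover have "nrm (u t - us k) \<le> nrm (u t - u (ts k)) + nrm (u (ts k) - us k)"
        by (intro lp_triangle usk lp_cont_lp[OF ucont] tT tk)
      ultimately have "nrm (u t - us k) < \<eta>" using w1 w2 \<omega>(2) \<eta> by linarith
      then show ?thesis using uet usk by simp
    qed
    then show "ue t \<in> lp p \<mu>" "nrm (u t - ue t) < \<eta>" by auto
  qed
qed

text \<open>
  The source \<open>h\<close> is only integrable, so its own values need not represent it. The elements \<open>h\<^sub>k\<close> are
  samples of a continuous function close to \<open>h\<close> in mean, on a uniform partition fine enough for
  its modulus of continuity.
\<close>

lemma discretization_exists:
  assumes \<epsilon>: "0 < \<epsilon>"
  obtains N ts hs where "eps_discretization p \<mu> T h \<epsilon> N ts hs"
proof -
  obtain c where c: "lp_continuous_on p \<mu> {0..T} c" "(\<integral>t. nrm (h t - c t) \<partial>lebesgue_on {0..T}) < \<epsilon> / 2"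
    using continuous_dense_L1[OF h_L1, of "\<epsilon> / 2"] \<epsilon> by auto
  have "0 < \<epsilon> / (2 * T)" using \<epsilon> T_pos by simp
  then obtain d where d: "0 < d"
    "\<And>s t. s \<in> {0..T} \<Longrightarrow> t \<in> {0..T} \<Longrightarrow> \<bar>s - t\<bar> < d \<Longrightarrow> nrm (c s - c t) < \<epsilon> / (2 * T)"
    using lp_uniformly_continuous[OF c(1)] by blast
  obtain N :: nat where N: "T / min d \<epsilon> < real N" using reals_Archimedean2 by blast
  have md: "0 < min d \<epsilon>" using d \<epsilon> by simp
  then have N0: "0 < real N" using N T_pos by (meson divide_pos_pos less_trans)
  define ts where "ts k = T * real k / real N" for k
  define hs where "hs k = c (ts k)" for k
  have step: "ts k - ts (k - 1) = T / real N" if "k \<in> {1..N}" for k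
    using that N0 by (cases k) (auto simp: ts_def field_simps)
  have "T < real N * min d \<epsilon>" using N by (simp only: pos_divide_less_eq[OF md])
  then have "T / real N < min d \<epsilon>" by (simp only: pos_divide_less_eq[OF N0] mult.commute)
  then have TN: "0 < T / real N" "T / real N < d" "T / real N < \<epsilon>" using N0 T_pos unfolding min_less_iff_conj by auto
  have inc: "\<forall>k\<in>{1..N}. ts (k - 1) < ts k" using step TN by fastforce
  have ts0: "ts 0 = 0" and tsN: "ts N = T" using N0 by (auto simp: ts_def)
  have tsT: "ts k \<in> {0..T}" if "k \<le> N" for k
    using partition_mono[OF inc, of 0 k] partition_mono[OF inc, of k N] that ts0 tsN by auto
  have hs: "hs k \<in> lp p \<mu>" if "k \<in> {1..N}" for k
    unfolding hs_def using that by (intro lp_cont_lp[OF c(1)] tsT) auto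
  let ?M = "\<lambda>k. lebesgue_on {ts (k - 1)..ts k}"
  have hcL1: "lp_L1 (lebesgue_on {0..T}) (\<lambda>t. h t - c t)"
    by (intro lp_L1_diff h_L1 lp_continuous_imp_L1 c)
  have piece: "(\<integral>\<^sup>+t\<in>{ts (k - 1)..ts k}. ennreal (nrm (h t - hs k)) \<partial>lebesgue)
      \<le> ennreal ((\<integral>t. nrm (h t - c t) \<partial>?M k) + T / real N * (\<epsilon> / (2 * T)))" if k: "k \<in> {1..N}" for k
  proof -
    have "ts (k - 1) \<in> {0..T}" "ts k \<in> {0..T}" using tsT[of "k - 1"] tsT[of k] k by auto
    then have sub: "{ts (k - 1)..ts k} \<subseteq> {0..T}" by auto
    have L1: "lp_L1 (?M k) (\<lambda>t. h t - hs k)"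
      by (intro lp_L1_diff lp_L1_const hs k lp_L1_subinterval[OF h_L1 sub])
    have hcL1': "lp_L1 (?M k) (\<lambda>t. h t - c t)" by (rule lp_L1_subinterval[OF hcL1 sub])
    have "(\<integral>t. nrm (h t - hs k) \<partial>?M k) \<le> (\<integral>t. nrm (h t - c t) + \<epsilon> / (2 * T) \<partial>?M k)"
    proof (rule integral_mono[OF lp_L1_norm(1)[OF L1]])
      show "integrable (?M k) (\<lambda>t. nrm (h t - c t) + \<epsilon> / (2 * T))"
        by (rule Bochner_Integration.integrable_add[OF lp_L1_norm(1)[OF hcL1']]) simp
      fix t assume "t \<in> space (?M k)"
      then have t: "t \<in> {ts (k - 1)..ts k}" by simp
      then have tT: "t \<in> {0..T}" using sub by auto
      have "\<bar>t - ts k\<bar> < d" using t step[OF k] TN by auto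
      then have "nrm (c t - hs k) < \<epsilon> / (2 * T)"
        unfolding hs_def using tT \<open>ts k \<in> {0..T}\<close> by (intro d(2))
      moreover have "nrm (h t - hs k) \<le> nrm (h t - c t) + nrm (c t - hs k)"
        by (intro lp_triangle h_lp tT hs k lp_cont_lp[OF c(1)])
      ultimately show "nrm (h t - hs k) \<le> nrm (h t - c t) + \<epsilon> / (2 * T)" by simp
    qed
    also have "\<dots> = (\<integral>t. nrm (h t - c t) \<partial>?M k) + T / real N * (\<epsilon> / (2 * T))"
      using step[OF k] TN lp_L1_norm(1)[OF hcL1']
      by (subst Bochner_Integration.integral_add) (auto simp: measure_restrict_space)
    finally show ?thesis
      using lp_L1_norm(2)[OF L1] by (simp add: nn_integral_restrict_space ennreal_leI)
  qed
  have "(\<Sum>k=1..N. \<integral>\<^sup>+t\<in>{ts (k - 1)..ts k}. ennreal (nrm (h t - hs k)) \<partial>lebesgue)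
      \<le> (\<Sum>k=1..N. ennreal ((\<integral>t. nrm (h t - c t) \<partial>?M k) + T / real N * (\<epsilon> / (2 * T))))"
    by (intro sum_mono piece)
  also have "\<dots> = ennreal (\<Sum>k=1..N. (\<integral>t. nrm (h t - c t) \<partial>?M k) + T / real N * (\<epsilon> / (2 * T)))"
    using T_pos \<epsilon> by (intro sum_ennreal add_nonneg_nonneg Bochner_Integration.integral_nonneg) auto
  also have "\<dots> \<le> ennreal \<epsilon>"
  proof (rule ennreal_leI)
    have "(\<Sum>k=1..N. \<integral>t. nrm (h t - c t) \<partial>?M k) = (\<integral>t. nrm (h t - c t) \<partial>lebesgue_on {0..T})"
      using sum_integral_partition[OF _ inc order_refl, of "\<lambda>t. nrm (h t - c t)"] lp_L1_norm(1)[OF hcL1]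
      by (simp add: ts0 tsN)
    then show "(\<Sum>k=1..N. (\<integral>t. nrm (h t - c t) \<partial>?M k) + T / real N * (\<epsilon> / (2 * T))) \<le> \<epsilon>"
      using c(2) N0 T_pos by (simp add: sum.distrib)
  qed
  finally have "eps_discretization p \<mu> T h \<epsilon> N ts hs"
    unfolding eps_discretization_def using N0 ts0 tsN inc hs step TN \<epsilon> by auto
  then show thesis by (rule that)
qed

text \<open>
  The scheme is well posed as soon as \<open>K \<epsilon> \<le> 1 / 2\<close>, each step being a resolvent.
\<close>

lemma approx_solution_exists:
  assumes d: "eps_discretization p \<mu> T h \<epsilon> N ts hs" and K\<epsilon>: "K * \<epsilon> \<le> 1/2"
  obtains ue where "eps_approx_solution p f w \<kappa> \<mu> u0 N ts hs ue"
proof -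
  from d have ts: "ts 0 = 0" "\<forall>k\<in>{1..N}. ts (k - 1) < ts k"
      "\<forall>k\<in>{1..N}. ts k - ts (k - 1) \<le> \<epsilon>" "\<forall>k\<in>{1..N}. hs k \<in> lp p \<mu>"
    by (auto simp: eps_discretization_def)
  define P where "P k v z \<longleftrightarrow> z \<in> lp p \<mu> \<and>
    z + (ts (Suc k) - ts k) *\<^sub>R \<A> z = v + (ts (Suc k) - ts k) *\<^sub>R hs (Suc k)" for k v z
  \<comment> \<open>The steps depend on earlier ones only through the last value, so they are chosen recursively.\<close>
  define us where "us = rec_nat u0 (\<lambda>k v. SOME z. P k v z)"
  have P: "us (Suc k) \<in> lp p \<mu> \<and> P k (us k) (us (Suc k))" if "us k \<in> lp p \<mu>" "Suc k \<le> N" for k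
  proof -
    have k: "Suc k \<in> {1..N}" using that by auto
    have l: "0 \<le> ts (Suc k) - ts k" "ts (Suc k) - ts k \<le> \<epsilon>"
      using ts(2)[rule_format, OF k] ts(3)[rule_format, OF k] by auto
    have "K * (ts (Suc k) - ts k) \<le> 1/2" using mult_left_mono[OF l(2) K_nonneg] K\<epsilon> by simp
    moreover have "us k + (ts (Suc k) - ts k) *\<^sub>R hs (Suc k) \<in> lp p \<mu>"
      using ts(4) k by (intro lp_add lp_scaleR that) auto
    ultimately obtain z where "P k (us k) z"
      using resolvent_exists[OF _ l(1)] unfolding P_def by metis
    moreover have "us (Suc k) = (SOME z. P k (us k) z)" by (simp add: us_def)
    ultimately have "P k (us k) (us (Suc k))" by (simp add: someI)
    then show ?thesis by (simp add: P_def)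
  qed
  have us: "k \<le> N \<longrightarrow> us k \<in> lp p \<mu>" for k
    by (induction k) (use P in \<open>auto simp: us_def u0_lp\<close>)
  define ue where "ue t = us (LEAST k. t \<le> ts k)" for t
  have "eps_approx_solution p f w \<kappa> \<mu> u0 N ts hs ue"
    unfolding eps_approx_solution_def dom_A_eq
  proof (intro exI[of _ us] conjI ballI)
    show "us 0 = u0" by (simp add: us_def)
    have "(LEAST k. 0 \<le> ts k) = 0" by (rule Least_equality) (auto simp: ts)
    then show "ue 0 = u0" by (simp add: ue_def us_def)
    fix k assume k: "k \<in> {1..N}"
    then show "us k \<in> lp p \<mu>" using us by simp
    have "P (k - 1) (us (k - 1)) (us (Suc (k - 1)))" using P[of "k - 1"] us[of "k - 1"] k by auto
    then show "us k + (ts k - ts (k - 1)) *\<^sub>R \<A> (us k) = us (k - 1) + (ts k - ts (k - 1)) *\<^sub>R hs k"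
      using k by (simp add: P_def)
    fix t assume t: "t \<in> {ts (k - 1)<..ts k}"
    have "(LEAST k. t \<le> ts k) = k"
    proof (rule Least_equality)
      fix y assume y: "t \<le> ts y"
      show "k \<le> y"
      proof (rule ccontr)
        assume "\<not> k \<le> y"
        then have "ts y \<le> ts (k - 1)" using k by (intro partition_mono[OF ts(2)]) auto
        then show False using y t by auto
      qed
    qed (use t in auto)
    then show "ue t = us k" by (simp add: ue_def)
  qed
  then show thesis by (rule that)
qed

lemma integral_solution_mild:
  assumes u: "integral_solution u"
  shows "mild_solution p f w \<kappa> \<mu> T u0 h u"
  unfolding mild_solution_def
proof (intro conjI allI impI)
  show "lp_continuous_on p \<mu> {0..T} u" using u by (simp add: integral_solution_def)
  fix \<epsilon> :: real assume \<epsilon>: "0 < \<epsilon>"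
  obtain \<epsilon>0 where e0: "0 < \<epsilon>0" "K * \<epsilon>0 \<le> 1/2" and
    close: "\<forall>\<epsilon>' N ts hs ue. 0 < \<epsilon>' \<longrightarrow> \<epsilon>' \<le> \<epsilon>0 \<longrightarrow> eps_discretization p \<mu> T h \<epsilon>' N ts hs \<longrightarrow>
      eps_approx_solution p f w \<kappa> \<mu> u0 N ts hs ue \<longrightarrow>
      (\<forall>t\<in>{0..ts N}. ue t \<in> lp p \<mu> \<and> nrm (u t - ue t) < \<epsilon>)"
    using euler_converges[OF u \<epsilon>] by (elim exE conjE)
  define \<epsilon>' where "\<epsilon>' = min \<epsilon> \<epsilon>0"
  have e': "0 < \<epsilon>'" "\<epsilon>' \<le> \<epsilon>0" "\<epsilon>' \<le> \<epsilon>" using \<epsilon> e0 by (auto simp: \<epsilon>'_def)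
  obtain N ts hs where d: "eps_discretization p \<mu> T h \<epsilon>' N ts hs" by (rule discretization_exists[OF e'(1)])
  have "K * \<epsilon>' \<le> 1/2" using mult_left_mono[OF e'(2) K_nonneg] e0(2) by simp
  then obtain ue where ue: "eps_approx_solution p f w \<kappa> \<mu> u0 N ts hs ue"
    by (rule approx_solution_exists[OF d])
  show "\<exists>N ts hs ue. eps_discretization p \<mu> T h \<epsilon> N ts hs \<and> eps_approx_solution p f w \<kappa> \<mu> u0 N ts hs ue \<and>
      (\<forall>t\<in>{0..ts N}. nrm (u t - ue t) < \<epsilon>)"
    using eps_discretization_mono[OF d e'(3)] ue close[rule_format, OF e'(1,2) d ue] by blast
qed

text \<open>
  At a time \<open>t < T\<close> both solutions are close to one and the same approximate solution, once \<open>\<epsilon>\<close> is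
  so small that the partition reaches beyond \<open>t\<close>. The partition may stop short of \<open>T\<close>, so the
  value there follows by continuity.
\<close>

lemma mild_solution_unique:
  assumes u: "integral_solution u" and v: "mild_solution p f w \<kappa> \<mu> T u0 h v" and t: "t \<in> {0..T}"
  shows "v t = u t"
proof -
  have vcont: "lp_continuous_on p \<mu> {0..T} v" using v by (simp add: mild_solution_def)
  have ucont: "lp_continuous_on p \<mu> {0..T} u" using u by (simp add: integral_solution_def)
  have eq: "v t = u t" if t: "0 \<le> t" "t < T" for t
  proof -
    have tT: "t \<in> {0..T}" using t by auto
    have vu: "v t - u t \<in> lp p \<mu>" by (intro lp_diff lp_cont_lp[OF vcont] lp_cont_lp[OF ucont] tT)
    have "nrm (v t - u t) \<le> 0 + \<eta>" if \<eta>: "0 < \<eta>" for \<eta>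
    proof -
      have \<eta>2: "0 < \<eta> / 2" using \<eta> by simp
      obtain \<epsilon>0 where e0: "0 < \<epsilon>0" and
        close_u: "\<forall>\<epsilon>' N ts hs ue. 0 < \<epsilon>' \<longrightarrow> \<epsilon>' \<le> \<epsilon>0 \<longrightarrow> eps_discretization p \<mu> T h \<epsilon>' N ts hs \<longrightarrow>
          eps_approx_solution p f w \<kappa> \<mu> u0 N ts hs ue \<longrightarrow>
          (\<forall>t\<in>{0..ts N}. ue t \<in> lp p \<mu> \<and> nrm (u t - ue t) < \<eta> / 2)"
        using euler_converges[OF u \<eta>2] by (elim exE conjE)
      define \<epsilon> where "\<epsilon> = min (\<eta> / 2) (min \<epsilon>0 (T - t))"
      have e: "0 < \<epsilon>" "\<epsilon> \<le> \<epsilon>0" "\<epsilon> \<le> \<eta> / 2" "\<epsilon> \<le> T - t" unfolding \<epsilon>_def using \<eta> e0 t by linarith+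
      have "\<exists>N ts hs ue. eps_discretization p \<mu> T h \<epsilon> N ts hs \<and>
          eps_approx_solution p f w \<kappa> \<mu> u0 N ts hs ue \<and> (\<forall>t\<in>{0..ts N}. nrm (v t - ue t) < \<epsilon>)"
        using v[unfolded mild_solution_def, THEN conjunct2, rule_format, OF e(1)] .
      then obtain N ts hs ue where d: "eps_discretization p \<mu> T h \<epsilon> N ts hs"
        and ue: "eps_approx_solution p f w \<kappa> \<mu> u0 N ts hs ue"
        and close: "\<forall>t\<in>{0..ts N}. nrm (v t - ue t) < \<epsilon>"
        by (elim exE conjE)
      have "T - ts N \<le> \<epsilon>" using d by (simp add: eps_discretization_def)
      then have tN: "t \<in> {0..ts N}" using e(4) t by auto
      have "nrm (v t - u t) \<le> nrm (v t - ue t) + nrm (ue t - u t)"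
        using close_u[rule_format, OF e(1,2) d ue tN]
        by (intro lp_triangle lp_cont_lp[OF vcont] lp_cont_lp[OF ucont] tT) auto
      moreover have "nrm (ue t - u t) < \<eta> / 2"
        using close_u[rule_format, OF e(1,2) d ue tN] lp_norm_commute[of "ue t" "u t"] by simp
      ultimately show ?thesis using close tN e(3) by force
    qed
    then have "nrm (v t - u t) \<le> 0" by (rule field_le_epsilon)
    then have "v t - u t = 0" using lp_norm_eq_0[OF vu] lp_norm_nonneg[of "v t - u t"] by linarith
    then show ?thesis by simp
  qed
  show ?thesis
  proof
    fix x
    have "continuous_on {0..T} (\<lambda>t. (v t - u t) x)"
      by (intro lp_continuous_coord lp_continuous_diff vcont ucont)
    moreover have "closure {0..<T} = {0..T}" using T_pos by simp
    ultimately have "(v t - u t) x = 0"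
      using continuous_constant_on_closure[of "{0..<T}" "\<lambda>t. (v t - u t) x" 0 t] eq t by simp
    then show "v t x = u t x" by simp
  qed
qed

section \<open>Regularity of the solution\<close>

lemma integral_solution_formula:
  assumes u: "integral_solution u" and t: "t \<in> {0<..<T}"
  shows "lp_integrable p \<mu> (lebesgue_on {0..t}) (\<lambda>s. \<A> (u s))"
    and "lp_integrable p \<mu> (lebesgue_on {0..t}) h"
    and "u t = u 0 - lp_integral p \<mu> (lebesgue_on {0..t}) (\<lambda>s. \<A> (u s)) + lp_integral p \<mu> (lebesgue_on {0..t}) h"
proof -
  have ucont: "lp_continuous_on p \<mu> {0..T} u" using u by (simp add: integral_solution_def)
  have sub: "{0..t} \<subseteq> {0..T}" using t by auto
  have hL: "lp_L1 (lebesgue_on {0..t}) h" by (rule lp_L1_subinterval[OF h_L1 sub])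
  have AL: "lp_L1 (lebesgue_on {0..t}) (\<lambda>s. \<A> (u s))"
    by (intro lp_continuous_imp_L1 op_A_continuous lp_continuous_on_subset[OF ucont sub])
  show "lp_integrable p \<mu> (lebesgue_on {0..t}) (\<lambda>s. \<A> (u s))" "lp_integrable p \<mu> (lebesgue_on {0..t}) h"
    using hL AL by (simp_all add: lp_integrable_ivl)
  have "u t = u0 + (coord_integral 0 t h - coord_integral 0 t (\<lambda>s. \<A> (u s)))"
    using u t by (simp add: integral_solution_def picard_def coord_integral_diff[OF hL AL])
  then show "u t = u 0 - lp_integral p \<mu> (lebesgue_on {0..t}) (\<lambda>s. \<A> (u s)) + lp_integral p \<mu> (lebesgue_on {0..t}) h"
    by (simp add: solution_at_0[OF u] lp_integral_eq_coord_integral[OF hL] lp_integral_eq_coord_integral[OF AL])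
qed

text \<open>
  The weak derivative is \<open>h - \<A> u\<close>; the defining identity is checked coordinate by coordinate.
\<close>

lemma integral_solution_strong:
  assumes u: "integral_solution u"
  shows "strong_solution p f w \<kappa> \<mu> T u0 h u"
proof -
  have ucont: "lp_continuous_on p \<mu> {0..T} u" using u by (simp add: integral_solution_def)
  let ?v = "\<lambda>s. h s - \<A> (u s)"
  let ?O = "lebesgue_on {0<..<T}"
  have uL: "lp_L1 (lebesgue_on {0..T}) u" by (rule lp_continuous_imp_L1[OF ucont])
  have vL: "lp_L1 (lebesgue_on {0..T}) ?v" by (rule rate_L1[OF ucont])
  have loc: "g \<in> lp_L1_loc p \<mu> {0<..<T}" if g: "lp_L1 (lebesgue_on {0..T}) g" for g
    unfolding lp_L1_loc_def
  proof (intro CollectI conjI ballI allI impI)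
    show "g t \<in> lp p \<mu>" if "t \<in> {0<..<T}" for t using g that by (simp add: lp_L1_def)
    fix S :: "real set" assume S: "compact S \<and> S \<subseteq> {0<..<T}"
    then have m: "S \<in> lmeasurable" by (intro lmeasurable_compact) auto
    have "lp_L1 (lebesgue_on S) g"
      using S m by (intro lp_L1_subset[OF g]) (auto dest: fmeasurableD)
    then show "lp_integrable p \<mu> (lebesgue_on S) g"
      using m by (subst lp_integrable_iff)
        (auto intro: finite_measure_lebesgue_on complete_measure_lebesgue_on dest: fmeasurableD)
  qed
  have finO: "finite_measure ?O" and compO: "complete_measure ?O"
    by (auto intro!: finite_measure_lebesgue_on complete_measure_lebesgue_on lmeasurable_open)
  have int: "lp_integral p \<mu> ?O g = coord_integral 0 T g" if g: "lp_L1 (lebesgue_on {0..T}) g" for g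
  proof -
    have "lp_L1 ?O g" by (rule lp_L1_subset[OF g]) auto
    then show ?thesis
      using lp_integral_coord[OF finO compO] integral_open_interval_lebesgue[OF lp_L1_coord[OF g]]
      by (simp add: coord_integral_def)
  qed
  have "lp_integral p \<mu> ?O (\<lambda>t. deriv \<phi> t *\<^sub>R u t) = - lp_integral p \<mu> ?O (\<lambda>t. \<phi> t *\<^sub>R ?v t)"
    if \<phi>: "test_function 0 T \<phi>" for \<phi>
  proof -
    have diff: "((deriv ^^ k) \<phi>) differentiable (at t)" for k t using \<phi> by (simp add: test_function_def)
    have c: "continuous_on {0..T} \<phi>" "continuous_on {0..T} (deriv \<phi>)"
      using diff[of 0] diff[of 1]
      by (auto intro!: continuous_at_imp_continuous_on intro: differentiable_imp_continuous_within)
    have "coord_integral 0 T (\<lambda>t. deriv \<phi> t *\<^sub>R u t) x = (- coord_integral 0 T (\<lambda>t. \<phi> t *\<^sub>R ?v t)) x" for x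
    proof -
      have U: "u t x = u0 x + (\<integral>s. ?v s x \<partial>lebesgue_on {0..t})" if "t \<in> {0..T}" for t
      proof -
        have "u t = u0 + coord_integral 0 t ?v" using u that by (simp add: integral_solution_def picard_def)
        then have "u t x = (u0 + coord_integral 0 t ?v) x" by simp
        then show ?thesis by (simp add: coord_integral_def)
      qed
      show ?thesis
        using integration_by_parts_test_function[OF lp_L1_coord[OF vL] \<phi> less_imp_le[OF T_pos] U]
        by (simp add: coord_integral_def)
    qed
    then show ?thesis
      unfolding int[OF lp_L1_scaleR[OF uL c(2)]] int[OF lp_L1_scaleR[OF vL c(1)]] by (rule ext)
  qed
  then have "lp_W11_loc_deriv p \<mu> 0 T u ?v"
    unfolding lp_W11_loc_deriv_def using loc[OF uL] loc[OF vL] by blast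
  moreover have "AE t in ?O. ?v t + \<A> (u t) = h t" by simp
  ultimately show ?thesis
    unfolding strong_solution_def dom_A_eq
    by (intro conjI ballI exI[of _ ?v] lp_cont_lp[OF ucont] ucont solution_at_0[OF u]) auto
qed

text \<open>
  The difference quotient of \<open>u\<close> at \<open>t\<close> is the mean of \<open>h - \<A> u\<close> over the interval between
  \<open>s\<close> and \<open>t\<close>, which converges because this function is now continuous.
\<close>

lemma integral_solution_classical:
  assumes u: "integral_solution u" and h: "lp_continuous_on p \<mu> {0..T} h"
  shows "classical_solution p f w \<kappa> \<mu> T u0 h u"
proof -
  have ucont: "lp_continuous_on p \<mu> {0..T} u" using u by (simp add: integral_solution_def)
  let ?v = "\<lambda>s. h s - \<A> (u s)"
  have vcont: "lp_continuous_on p \<mu> {0..T} ?v" by (intro lp_continuous_diff h op_A_continuous ucont)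
  have vL: "lp_L1 (lebesgue_on {0..T}) ?v" by (rule rate_L1[OF ucont])
  have "lp_has_deriv p \<mu> u (?v t) t" if t: "t \<in> {0<..<T}" for t
    unfolding lp_has_deriv_def
  proof
    have tT: "t \<in> {0..T}" using t by auto
    show vt: "?v t \<in> lp p \<mu>" by (rule lp_cont_lp[OF vcont tT])
    show "((\<lambda>s. nrm ((1 / (s - t)) *\<^sub>R (u s - u t) - ?v t)) \<longlongrightarrow> 0) (at t)"
    proof (rule tendstoI)
      fix e :: real assume e: "0 < e"
      then obtain d where d: "0 < d"
        "\<And>r s. r \<in> {0..T} \<Longrightarrow> s \<in> {0..T} \<Longrightarrow> \<bar>r - s\<bar> < d \<Longrightarrow> nrm (?v r - ?v s) < e / 2"
        using lp_uniformly_continuous[OF vcont, of "e / 2"] by auto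
      define d' where "d' = min d (min t (T - t))"
      have d': "0 < d'" "d' \<le> d" "d' \<le> t" "d' \<le> T - t" using d t by (auto simp: d'_def)
      have "dist (nrm ((1 / (s - t)) *\<^sub>R (u s - u t) - ?v t)) 0 < e" if s: "s \<noteq> t" "dist s t < d'" for s
      proof -
        have st: "\<bar>s - t\<bar> < d'" using s by (simp add: dist_real_def)
        have sT: "s \<in> {0..T}" using st d' by auto
        have le: "nrm (?v r - ?v t) \<le> e / 2" if "r \<in> {min s t..max s t}" for r
        proof -
          have "\<bar>r - t\<bar> < d" "r \<in> {0..T}" using that st d' sT tT by (auto simp: min_def max_def split: if_splits)
          then show ?thesis using d(2)[OF _ tT] less_imp_le by blast
        qed
        have "nrm ((1 / (s - t)) *\<^sub>R (u s - u t) - ?v t) \<le> e / 2"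
        proof (cases "t < s")
          case True
          have eq: "u s - u t = coord_integral t s ?v"
            using t sT True by (intro solution_increment[OF u]) auto
          show ?thesis
            unfolding eq using le True t sT
            by (intro average_close lp_L1_subinterval[OF vL] vt) (auto simp: min_def max_def)
        next
          case False
          then have lt: "s < t" using s by simp
          have eq: "u t - u s = coord_integral s t ?v"
            using t sT lt by (intro solution_increment[OF u]) auto
          have sw: "(1 / (s - t)) *\<^sub>R (u s - u t) = (1 / (t - s)) *\<^sub>R (u t - u s)"
            using lt by (simp add: fun_eq_iff field_simps)
          show ?thesis
            unfolding sw eq using le lt t sT
            by (intro average_close lp_L1_subinterval[OF vL] vt) (auto simp: min_def max_def)
        qed
        then show ?thesis using e by simp
      qed
      then show "\<forall>\<^sub>F s in at t. dist (nrm ((1 / (s - t)) *\<^sub>R (u s - u t) - ?v t)) 0 < e"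
        using d'(1) by (auto simp: eventually_at)
    qed
  qed
  moreover have "lp_continuous_on p \<mu> {0<..<T} ?v" by (rule lp_continuous_on_subset[OF vcont]) auto
  moreover have "\<forall>t\<in>{0<..<T}. ?v t + \<A> (u t) = h t" by simp
  ultimately show ?thesis
    unfolding classical_solution_def dom_A_eq
    by (intro conjI ballI exI[of _ ?v] lp_cont_lp[OF ucont] ucont solution_at_0[OF u]) auto
qed

end

theorem theorem3p8:
  fixes w :: "'a::countable \<Rightarrow> 'a \<Rightarrow> real"
    and \<kappa> \<mu> u0 :: "'a \<Rightarrow> real"
    and p T L :: real
    and f :: "real \<Rightarrow> real"
    and h :: "real \<Rightarrow> 'a \<Rightarrow> real"
  assumes "weighted_graph w \<kappa> \<mu>" and "connected_graph w"
    and "1 \<le> p" and "0 < T"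
    and "1 < p \<Longrightarrow> \<forall>x. (\<lambda>y. w x y powr p / \<mu> y powr (p - 1)) summable_on UNIV"
    and "0 < L" and "L-lipschitz_on UNIV f" and "f 0 = 0"
    and "bdd_above (range (\<lambda>x. ((\<Sum>\<^sub>\<infinity>y. w x y) + \<kappa> x) / \<mu> x))"
    and "u0 \<in> lp p \<mu>" and "h \<in> lp_L1_loc p \<mu> {0..T}"
    and "data_one_signed T u0 h \<or>
         (data_change_sign T u0 h \<and> (cond_IP w \<mu> \<or> cond_B w \<mu>))"
  shows "\<exists>u. mild_solution p f w \<kappa> \<mu> T u0 h u \<and>
           (\<forall>v. mild_solution p f w \<kappa> \<mu> T u0 h v \<longrightarrow> (\<forall>t\<in>{0..T}. v t = u t)) \<and>
           strong_solution p f w \<kappa> \<mu> T u0 h u \<and>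
           (\<forall>t\<in>{0<..<T}.
              lp_integrable p \<mu> (lebesgue_on {0..t}) (\<lambda>s. op_A f w \<kappa> \<mu> (u s)) \<and>
              lp_integrable p \<mu> (lebesgue_on {0..t}) h \<and>
              u t = u 0 - lp_integral p \<mu> (lebesgue_on {0..t}) (\<lambda>s. op_A f w \<kappa> \<mu> (u s))
                        + lp_integral p \<mu> (lebesgue_on {0..t}) h) \<and>
           (lp_continuous_on p \<mu> {0..T} h \<longrightarrow> classical_solution p f w \<kappa> \<mu> T u0 h u)"
proof -
  obtain D where D: "\<And>x. ((\<Sum>\<^sub>\<infinity>y. w x y) + \<kappa> x) / \<mu> x \<le> D"
    using assms(9) by (auto simp: bdd_above_def)
  interpret bounded_graph p \<mu> w \<kappa> f D L
    using assms(1,3,7,8) D by unfold_locales (auto simp: weighted_graph_def)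
  have "lp_L1 (lebesgue_on {0..T}) h"
    using assms(11) compact_Icc[of 0 T] lp_integrable_ivl[of 0 T h] by (auto simp: lp_L1_loc_def)
  then interpret evolution p \<mu> w \<kappa> f D L T u0 h
    using assms(4,10) by unfold_locales
  obtain u where u: "integral_solution u" using integral_solution_exists by blast
  show ?thesis
    using integral_solution_mild[OF u] mild_solution_unique[OF u] integral_solution_strong[OF u]
      integral_solution_formula[OF u] integral_solution_classical[OF u]
    by (intro exI[of _ u]) blast
qed

end
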